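(* Let $\mathcal D\subset\mathbb R^d$, $d\ge1$, be a bounded convex open set. Let $\Psi\in\mathcal B_0$ satisfy, for some $\mu>0$ and $\underline c\in(0,1]$, the scaling property $\Psi(\gamma u)\ge \underline c\,\gamma^{\mu}\Psi(u)$ for all $u>0$ and $\gamma\ge 1$. Let $V\in\mathscr K^\Psi$ be a $\Psi$-Kato class potential with $V^-\in L^p(\mathbb R^d)$, $p>\frac{d}{2\mu}$. Let $\varphi$ be a non-zero solution of the Dirichlet-Schrödinger eigenvalue problem $$(\Psi(-\Delta)+V)\varphi=\lambda\varphi \ \text{ in } \mathcal D,\qquad \varphi=0 \ \text{ in } \mathcal D^c,$$ with eigenvalue $\lambda$. Assume that $|\varphi|$ attains a global maximum at $x^*\in\mathcal D$, and denote $r=\operatorname{dist}(x^*,\partial\mathcal D)$ and $\eta=1-\frac{d}{2\mu p}$. Then there exist a constant $\Theta_1>0$, dependent on $d,\mu,\underline c,\eta,\operatorname{inrad}\mathcal D$, and a constant $\Theta_2>0$, dependent on $\eta$ only, such that $$\Theta_1\,\|V^-\|_{L^p(\mathbb R^d)}^{1/\eta}-\inf_{\mathcal D}V^+ +\lambda\ \ge\ \Theta_2\,\Psi(r^{-2}).$$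
   Context: $\mathcal B_0$ is the set of Bernstein functions vanishing at zero: $f\in C^\infty((0,\infty))$, $f\ge0$, $(-1)^n f^{(n)}\le 0$ for all $n\ge1$, and $\lim_{u\downarrow0}f(u)=0$. For $\Psi\in\mathcal B_0$, $\Psi(-\Delta)$ is the operator with Fourier multiplier $\Psi(|y|^2)$. Let $(S^\Psi_t)_{t\ge0}$ be the subordinator with $\mathbb E[e^{-uS^\Psi_t}]=e^{-t\Psi(u)}$, and $(B_t)_{t\ge0}$ an independent $d$-dimensional Brownian motion running twice as fast as standard Brownian motion (each coordinate has variance $2t$). $X_t=B_{S^\Psi_t}$ is the corresponding subordinate Brownian motion; $\mathbb P^x,\mathbb E^x$ refer to the process started at $x$. The class $\mathscr K^\Psi$ consists of all Borel functions $f:\mathbb R^d\to\mathbb R$ with $\lim_{t\downarrow0}\sup_{x\in\mathbb R^d}\mathbb E^x\big[\int_0^t|f(X_s)|ds\big]=0$. With $V^+=\max\{V,0\}$ and $V^-=\max\{-V,0\}$, a potential $V$ is said to be of $\Psi$-Kato class if $V^-\in\mathscr K^\Psi$ and $V^+\mathbf 1_{C}\in\mathscr K^\Psi$ for every compact $C\subset\mathbb R^d$. $\operatorname{inrad}\mathcal D$ is the inradius of $\mathcal D$ (supremum of radii of balls contained in $\mathcal D$). With $\tau_{\mathcal D}=\inf\{t>0: X_t\notin\mathcal D\}$, set $T^{\mathcal D,V}_tf(x)=\mathbb E^x\big[e^{-\int_0^tV(X_s)ds}f(X_t)\mathbf 1_{\{\tau_{\mathcal D}>t\}}\big]$, $x\in\mathcal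 D$; this is the semigroup generated by minus the Dirichlet realization of $\Psi(-\Delta)+V$ in $\mathcal D$. The eigenvalue problem is understood in weak sense: $\varphi\in L^2(\mathcal D)$ (extended by $0$ outside $\mathcal D$) satisfies $T^{\mathcal D,V}_t\varphi=e^{-\lambda t}\varphi$ for all $t>0$, taken in the version for which this identity holds at every $x\in\mathcal D$.
   Formalization: Ψ is assumed not identically zero (the claim fails for Ψ=0), Θ1 may also depend on the given Ψ (a Θ1 uniform in Ψ is impossible, e.g. Ψ(u)=au with a→0), and p is finite with p≥1 (for p<1, possible only when d=1, delta-like wells violate the claim). *)

theory Defs
  imports "HOL-Probability.Probability"
begin

section \<open>Euclidean space of variable dimension\<close>

text \<open>
  The constants of the theorem have prescribed dependence on the dimension, so the dimension
  is a natural number that can be quantified over and not a type.  Euclidean space of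
  dimension \<open>d\<close> is carried by the extensional functions on \<open>{..<d}\<close>, which is
  simultaneously the space of the product measure of \<open>d\<close> copies of \<open>lborel\<close> (Lebesgue
  measure on the Borel sets) and the carrier of the product topology of \<open>d\<close> copies of the
  real line (the Euclidean topology).
\<close>

type_synonym vec = "nat \<Rightarrow> real"

definition Rd :: "nat \<Rightarrow> vec set" where
  "Rd d = {..<d} \<rightarrow>\<^sub>E UNIV"

definition Rd_top :: "nat \<Rightarrow> vec topology" where
  "Rd_top d = product_topology (\<lambda>_. euclideanreal) {..<d}"

definition Rd_lborel :: "nat \<Rightarrow> vec measure" where
  "Rd_lborel d = Pi\<^sub>M {..<d} (\<lambda>_. lborel)"

definition Rd_dist :: "nat \<Rightarrow> vec \<Rightarrow> vec \<Rightarrow> real" where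
  "Rd_dist d x y = L2_set (\<lambda>i. x i - y i) {..<d}"

definition Rd_ball :: "nat \<Rightarrow> vec \<Rightarrow> real \<Rightarrow> vec set" where
  "Rd_ball d x \<rho> = {y \<in> Rd d. Rd_dist d x y < \<rho>}"

definition Rd_convex :: "nat \<Rightarrow> vec set \<Rightarrow> bool" where
  "Rd_convex d D \<longleftrightarrow>
     (\<forall>x\<in>D. \<forall>y\<in>D. \<forall>\<theta>\<in>{0..1}. (\<lambda>i\<in>{..<d}. (1 - \<theta>) * x i + \<theta> * y i) \<in> D)"

definition Rd_bounded :: "nat \<Rightarrow> vec set \<Rightarrow> bool" where
  "Rd_bounded d D \<longleftrightarrow> (\<exists>K. \<forall>x\<in>D. \<forall>y\<in>D. Rd_dist d x y \<le> K)"

definition inradius :: "nat \<Rightarrow> vec set \<Rightarrow> real" where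
  "inradius d D = Sup {\<rho>. \<rho> > 0 \<and> (\<exists>x\<in>Rd d. Rd_ball d x \<rho> \<subseteq> D)}"

definition boundary_dist :: "nat \<Rightarrow> vec set \<Rightarrow> vec \<Rightarrow> real" where
  "boundary_dist d D x = (INF y\<in>(Rd_top d) frontier_of D. Rd_dist d x y)"

section \<open>Bernstein functions\<close>

text \<open>Only the values on the open half-line matter; values at \<open>u \<le> 0\<close> are unconstrained.\<close>

definition bernstein0 :: "(real \<Rightarrow> real) \<Rightarrow> bool" where
  "bernstein0 f \<longleftrightarrow>
     (\<forall>n. \<forall>u>0. (deriv ^^ n) f field_differentiable (at u)) \<and>
     (\<forall>u>0. f u \<ge> 0) \<and>
     (\<forall>n\<ge>1. \<forall>u>0. (- 1) ^ n * (deriv ^^ n) f u \<le> 0) \<and>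
     (f \<longlongrightarrow> 0) (at_right 0)"

definition lower_scaling :: "(real \<Rightarrow> real) \<Rightarrow> real \<Rightarrow> real \<Rightarrow> bool" where
  "lower_scaling \<Psi> \<mu> c \<longleftrightarrow> (\<forall>u>0. \<forall>\<gamma>\<ge>1. \<Psi> (\<gamma> * u) \<ge> c * \<gamma> powr \<mu> * \<Psi> u)"

section \<open>Subordinate Brownian motion\<close>

text \<open>Processes are indexed by reals; only times \<open>t \<ge> 0\<close> are relevant.\<close>

definition indep_increments :: "'w measure \<Rightarrow> (real \<Rightarrow> 'w \<Rightarrow> real) \<Rightarrow> bool" where
  "indep_increments M Y \<longleftrightarrow>
     (\<forall>(n::nat) (s :: nat \<Rightarrow> real). 0 \<le> s 0 \<and> mono s \<longrightarrow>
        prob_space.indep_vars M (\<lambda>_. borel) (\<lambda>k \<omega>. Y (s (Suc k)) \<omega> - Y (s k) \<omega>) {..<n})"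

definition subordinator :: "'w measure \<Rightarrow> (real \<Rightarrow> real) \<Rightarrow> (real \<Rightarrow> 'w \<Rightarrow> real) \<Rightarrow> bool" where
  "subordinator M \<Psi> S \<longleftrightarrow>
     (\<forall>t\<ge>0. S t \<in> borel_measurable M) \<and>
     (\<forall>\<omega>\<in>space M. S 0 \<omega> = 0 \<and> mono_on {0..} (\<lambda>t. S t \<omega>) \<and>
        (\<forall>t\<ge>0. continuous (at_right t) (\<lambda>s. S s \<omega>))) \<and>
     indep_increments M S \<and>
     (\<forall>s t. 0 \<le> s \<and> s \<le> t \<longrightarrow>
        distr M borel (\<lambda>\<omega>. S t \<omega> - S s \<omega>) = distr M borel (S (t - s))) \<and>
     (\<forall>t\<ge>0. \<forall>u>0. (\<integral>\<omega>. exp (- u * S t \<omega>) \<partial>M) = exp (- t * \<Psi> u))"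

text \<open>One-dimensional Brownian motion started at 0 with variance \<open>2 * t\<close>;
  \<open>normal_density\<close> takes the standard deviation.\<close>

definition brownian1 :: "'w measure \<Rightarrow> (real \<Rightarrow> 'w \<Rightarrow> real) \<Rightarrow> bool" where
  "brownian1 M W \<longleftrightarrow>
     (\<forall>t\<ge>0. W t \<in> borel_measurable M) \<and>
     (\<forall>\<omega>\<in>space M. W 0 \<omega> = 0 \<and> continuous_on {0..} (\<lambda>t. W t \<omega>)) \<and>
     indep_increments M W \<and>
     (\<forall>s t. 0 \<le> s \<and> s < t \<longrightarrow>
        distributed M lborel (\<lambda>\<omega>. W t \<omega> - W s \<omega>) (normal_density 0 (sqrt (2 * (t - s)))))"

definition brownian :: "'w measure \<Rightarrow> nat \<Rightarrow> (nat \<Rightarrow> real \<Rightarrow> 'w \<Rightarrow> real) \<Rightarrow> bool" where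
  "brownian M d B \<longleftrightarrow>
     (\<forall>i<d. brownian1 M (B i)) \<and>
     prob_space.indep_vars M (\<lambda>_. Pi\<^sub>M {0..} (\<lambda>_. borel))
       (\<lambda>i \<omega>. \<lambda>t\<in>{0..}. B i t \<omega>) {..<d}"

definition sbm_setup ::
  "'w measure \<Rightarrow> nat \<Rightarrow> (real \<Rightarrow> real) \<Rightarrow> (real \<Rightarrow> 'w \<Rightarrow> real) \<Rightarrow>
   (nat \<Rightarrow> real \<Rightarrow> 'w \<Rightarrow> real) \<Rightarrow> bool" where
  "sbm_setup M d \<Psi> S B \<longleftrightarrow>
     prob_space M \<and> subordinator M \<Psi> S \<and> brownian M d B \<and>
     prob_space.indep_set M
       (sets (vimage_algebra (space M) (\<lambda>\<omega>. \<lambda>t\<in>{0..}. S t \<omega>)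
                (Pi\<^sub>M {0..} (\<lambda>_. borel))))
       (sets (vimage_algebra (space M) (\<lambda>\<omega>. \<lambda>(i, t)\<in>{..<d} \<times> {0..}. B i t \<omega>)
                (Pi\<^sub>M ({..<d} \<times> {0..}) (\<lambda>_. borel))))"

text \<open>The subordinate Brownian motion started at \<open>x\<close>.  Expectations under the law of the process
  started at \<open>x\<close> are taken as expectations of functionals of \<open>sbm d S B x\<close> under \<open>M\<close>.\<close>

definition sbm ::
  "nat \<Rightarrow> (real \<Rightarrow> 'w \<Rightarrow> real) \<Rightarrow> (nat \<Rightarrow> real \<Rightarrow> 'w \<Rightarrow> real) \<Rightarrow> vec \<Rightarrow> real \<Rightarrow> 'w \<Rightarrow> vec" where
  "sbm d S B x t \<omega> = (\<lambda>i\<in>{..<d}. x i + B i (S t \<omega>) \<omega>)"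

section \<open>Kato class, Feynman-Kac semigroup, eigenfunctions\<close>

definition kato_space ::
  "'w measure \<Rightarrow> nat \<Rightarrow> (real \<Rightarrow> 'w \<Rightarrow> real) \<Rightarrow> (nat \<Rightarrow> real \<Rightarrow> 'w \<Rightarrow> real) \<Rightarrow> (vec \<Rightarrow> real) set" where
  "kato_space M d S B =
     {f. f \<in> borel_measurable (Rd_lborel d) \<and>
       ((\<lambda>t. SUP x\<in>Rd d. \<integral>\<^sup>+\<omega>. (\<integral>\<^sup>+s\<in>{0..t}. ennreal \<bar>f (sbm d S B x s \<omega>)\<bar> \<partial>lborel) \<partial>M)
          \<longlongrightarrow> 0) (at_right 0)}"

definition pos_part :: "('a \<Rightarrow> real) \<Rightarrow> 'a \<Rightarrow> real" where
  "pos_part V x = max (V x) 0"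

definition neg_part :: "('a \<Rightarrow> real) \<Rightarrow> 'a \<Rightarrow> real" where
  "neg_part V x = max (- V x) 0"

definition kato_potential ::
  "'w measure \<Rightarrow> nat \<Rightarrow> (real \<Rightarrow> 'w \<Rightarrow> real) \<Rightarrow> (nat \<Rightarrow> real \<Rightarrow> 'w \<Rightarrow> real) \<Rightarrow> (vec \<Rightarrow> real) \<Rightarrow> bool" where
  "kato_potential M d S B V \<longleftrightarrow>
     neg_part V \<in> kato_space M d S B \<and>
     (\<forall>C. compactin (Rd_top d) C \<longrightarrow>
        (\<lambda>x. pos_part V x * indicator C x) \<in> kato_space M d S B)"

text \<open>Used for real exponents \<open>1 \<le> p < \<infinity>\<close> only.\<close>

definition Lp_space :: "nat \<Rightarrow> real \<Rightarrow> (vec \<Rightarrow> real) set" where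
  "Lp_space d p = {f. f \<in> borel_measurable (Rd_lborel d) \<and>
                      integrable (Rd_lborel d) (\<lambda>x. \<bar>f x\<bar> powr p)}"

definition Lp_norm :: "nat \<Rightarrow> real \<Rightarrow> (vec \<Rightarrow> real) \<Rightarrow> real" where
  "Lp_norm d p f = (\<integral>x. \<bar>f x\<bar> powr p \<partial>Rd_lborel d) powr (1 / p)"

text \<open>The infimum over the empty set is \<open>\<infinity>\<close>.\<close>

definition exit_time :: "vec set \<Rightarrow> (real \<Rightarrow> vec) \<Rightarrow> ereal" where
  "exit_time D \<xi> = Inf {ereal t | t. t > 0 \<and> \<xi> t \<notin> D}"

text \<open>
  The expectation is taken with respect to the completion of \<open>M\<close>, because in general events
  involving exit times are only measurable after completion (and the Bochner integral of a
  non-measurable function is 0).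
\<close>

definition feynman_kac ::
  "'w measure \<Rightarrow> nat \<Rightarrow> (real \<Rightarrow> 'w \<Rightarrow> real) \<Rightarrow> (nat \<Rightarrow> real \<Rightarrow> 'w \<Rightarrow> real) \<Rightarrow>
   vec set \<Rightarrow> (vec \<Rightarrow> real) \<Rightarrow> real \<Rightarrow> (vec \<Rightarrow> real) \<Rightarrow> vec \<Rightarrow> real" where
  "feynman_kac M d S B D V t f x =
     (\<integral>\<omega>. exp (- (LINT s:{0..t}|lborel. V (sbm d S B x s \<omega>))) * f (sbm d S B x t \<omega>) *
           indicator {\<omega>. exit_time D (\<lambda>s. sbm d S B x s \<omega>) > ereal t} \<omega> \<partial>completion M)"

text \<open>
  Non-zero solutions, in the sense of the semigroup, of the eigenvalue problem for
  \<open>\<Psi>(-\<Delta>) + V\<close> in \<open>D\<close> with eigenvalue \<open>lam\<close> and zero exterior condition.  Functions in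
  \<open>L\<^sup>2\<close> are Lebesgue measurable (measurable for the completion of the Borel measure), and
  non-zero means non-zero as an element of \<open>L\<^sup>2\<close>.
\<close>

definition dirichlet_eigenfunction ::
  "'w measure \<Rightarrow> nat \<Rightarrow> (real \<Rightarrow> 'w \<Rightarrow> real) \<Rightarrow> (nat \<Rightarrow> real \<Rightarrow> 'w \<Rightarrow> real) \<Rightarrow>
   vec set \<Rightarrow> (vec \<Rightarrow> real) \<Rightarrow> real \<Rightarrow> (vec \<Rightarrow> real) \<Rightarrow> bool" where
  "dirichlet_eigenfunction M d S B D V lam \<phi> \<longleftrightarrow>
     \<phi> \<in> borel_measurable (completion (Rd_lborel d)) \<and>
     integrable (completion (Rd_lborel d)) (\<lambda>x. (\<phi> x)\<^sup>2) \<and>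
     (\<forall>x\<in>Rd d - D. \<phi> x = 0) \<and>
     \<not> (AE x in completion (Rd_lborel d). \<phi> x = 0) \<and>
     (\<forall>t>0. \<forall>x\<in>D. feynman_kac M d S B D V t \<phi> x = exp (- lam * t) * \<phi> x)"

end

theory Submission
  imports Defs "HOL-Real_Asymp.Real_Asymp"
begin

text \<open>
  Evaluating the semigroup identity at \<open>x\<^sup>*\<close> and dividing by \<open>|\<phi>(x\<^sup>*)|\<close> gives
  \<open>1 \<le> e\<^bsup>(\<lambda> - inf V\<^sup>+) t\<^esup> E[e\<^bsup>\<integral> V\<^sup>-\<^esup>; X\<^sub>t \<in> D]\<close>, and Cauchy-Schwarz separates the exponential moment of
  \<open>\<integral> 2 V\<^sup>-\<close> from \<open>P(X\<^sub>t \<in> D)\<close>. At \<open>t = 2 / \<Psi>(r\<^bsup>-2\<^esup>)\<close> the subordinator exceeds \<open>r\<^sup>2\<close> with probability at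
  least \<open>1 - e\<^bsup>-1\<^esup>\<close>, and then a Gaussian at distance about \<open>r\<close> from a point outside the convex set \<open>D\<close> leaves \<open>D\<close>
  with a probability bounded below by a universal constant \<open>\<delta>\<close>. Scaling gives the on-diagonal bound
  \<open>E[S\<^sub>s\<^bsup>-d/2\<^esup>] \<le> C s\<^bsup>-d/(2 \<mu>)\<^esup>\<close>, hence \<open>E\<^sup>x[V\<^sup>-(X\<^sub>s)] \<le> K s\<^bsup>\<eta> - 1\<^esup>\<close> with \<open>K\<close> proportional to the norm of \<open>V\<^sup>-\<close>, and a
  Khasminskii argument bounds the exponential moment by \<open>e\<^bsup>\<beta> t\<^esup> / (1 - \<alpha>)\<close> with \<open>\<beta>\<close> proportional to
  \<open>(K / \<alpha>)\<^bsup>1/\<eta>\<^esup>\<close>. The choice \<open>\<alpha> = \<delta> / 2\<close> makes \<open>(1 - \<delta>) / (1 - \<alpha>) < 1\<close>, which leaves a positive gap of order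
  \<open>1 / t\<close>. The inradius enters because \<open>t\<close> has to be bounded a priori.
\<close>

section \<open>Joint measurability and independence\<close>

text \<open>The setup supplies a subordinator and Brownian coordinates on one probability space, but
  neither a Markov process nor a transition density. Both are obtained by freezing the subordinator,
  which leaves Gaussian vectors with independent increments; the Markov property is then available
  at finitely many deterministic times only. This shapes the Khasminskii argument: the exponential
  of a time integral is dominated, by Jensen's inequality, by an average of products over shifted
  grids. Origin of the constants: the bound P(S_t < r^2) \<le> exp(1 - t \<Psi>(r^(-2))) has to be
  below 1, hence the factor 2 in t. Scaling bounds \<Psi> from below by a multiple of u^\<mu> only
  for large u, so the kernel estimate holds only up to a fixed time T. As \<Psi> is increasing and r
  is at most the inradius R, the choice T = 2 / \<Psi>(R^(-2)) covers every t; this is how \<Psi>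
  itself enters \<Theta>1, whereas \<Theta>2 is a pure number. The exponent p is recovered from
  \<eta>. The norm of V^- is first replaced by a strictly larger N, so that all rates are positive
  even for V^- = 0.\<close>

lemma measurable_right_continuous_process:
  fixes Z :: "real \<Rightarrow> 'a \<Rightarrow> real"
  assumes meas: "\<And>t. 0 \<le> t \<Longrightarrow> Z t \<in> borel_measurable N"
    and cont: "\<And>\<omega> t. \<omega> \<in> space N \<Longrightarrow> 0 \<le> t \<Longrightarrow> continuous (at_right t) (\<lambda>s. Z s \<omega>)"
  shows "(\<lambda>p. Z (max 0 (fst p)) (snd p)) \<in> borel_measurable (borel \<Otimes>\<^sub>M N)"
proof -
  \<comment> \<open>Floor plus one and not a ceiling: the grid point lies strictly to the right of
    t, so right-continuity alone gives convergence.\<close>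
  define a where "a n t = (of_int \<lfloor>real (Suc n) * max 0 t\<rfloor> + 1) / real (Suc n)" for n :: nat and t :: real
  have a_ge: "max 0 t < a n t" "a n t \<le> max 0 t + 1 / real (Suc n)" for n t
  proof -
    define y where "y = real (Suc n) * max 0 t"
    have "y < of_int \<lfloor>y\<rfloor> + 1" "of_int \<lfloor>y\<rfloor> \<le> y" by linarith+
    moreover have "max 0 t = y / real (Suc n)" by (simp add: y_def)
    ultimately show "max 0 t < a n t" "a n t \<le> max 0 t + 1 / real (Suc n)"
      unfolding a_def y_def[symmetric] by (auto simp: divide_simps simp flip: of_nat_Suc)
  qed
  have a_lim: "(\<lambda>n. a n t) \<longlonglongrightarrow> max 0 t" for t
  proof (rule tendsto_sandwich[where f = "\<lambda>_. max 0 t"])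
    show "(\<lambda>n. max 0 t + 1 / real (Suc n)) \<longlonglongrightarrow> max 0 t"
      using tendsto_add[OF tendsto_const LIMSEQ_inverse_real_of_nat, of "max 0 t"]
      by (simp add: inverse_eq_divide)
  qed (use a_ge in \<open>auto intro!: always_eventually less_imp_le\<close>)
  have lim: "(\<lambda>n. Z (a n (fst p)) (snd p)) \<longlonglongrightarrow> Z (max 0 (fst p)) (snd p)"
    if "p \<in> space (borel \<Otimes>\<^sub>M N)" for p
  proof -
    have "snd p \<in> space N" using that by (auto simp: space_pair_measure)
    then have "((\<lambda>s. Z s (snd p)) \<longlongrightarrow> Z (max 0 (fst p)) (snd p)) (at_right (max 0 (fst p)))"
      using cont[of "snd p" "max 0 (fst p)"] by (simp add: continuous_within)
    moreover have "filterlim (\<lambda>n. a n (fst p)) (at_right (max 0 (fst p))) sequentially"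
      unfolding filterlim_at using a_lim a_ge(1)
      by (intro conjI always_eventually allI) (auto simp: less_imp_neq[symmetric])
    ultimately show ?thesis by (rule filterlim_compose)
  qed
  have "(\<lambda>p. Z (a n (fst p)) (snd p)) \<in> borel_measurable (borel \<Otimes>\<^sub>M N)" for n
  proof -
    have f: "(\<lambda>p. Z ((of_int k + 1) / real (Suc n)) (snd p)) \<in> borel_measurable (borel \<Otimes>\<^sub>M N)"
      if "k \<in> {0..}" for k :: int
      using that by (intro measurable_compose[OF measurable_snd meas]) auto
    \<comment> \<open>The index takes countably many values, so the composition stays measurable;
      the outer \<open>max 0\<close> keeps the sampled times nonnegative, where measurability of
      \<open>Z\<close> is assumed.\<close>
    have "(\<lambda>p. max 0 \<lfloor>real (Suc n) * max 0 (fst p)\<rfloor>) \<in> measurable (borel \<Otimes>\<^sub>M N) (count_space {0..})"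
      by (subst measurable_count_space_eq2_countable) (auto simp del: of_nat_Suc)
    from measurable_compose_countable'[OF f this]
    have "(\<lambda>p. Z ((of_int (max 0 \<lfloor>real (Suc n) * max 0 (fst p)\<rfloor>) + 1) / real (Suc n)) (snd p))
        \<in> borel_measurable (borel \<Otimes>\<^sub>M N)" by simp
    moreover have "max 0 \<lfloor>real (Suc n) * max 0 t\<rfloor> = \<lfloor>real (Suc n) * max 0 t\<rfloor>" for t :: real
      by (simp add: max_def)
    ultimately show ?thesis by (simp add: a_def)
  qed
  from borel_measurable_LIMSEQ_real[OF lim this] show ?thesis .
qed

lemma nn_integral_indicator_comp:
  assumes "Y \<in> measurable M N" "A \<in> sets N"
  shows "(\<integral>\<^sup>+\<omega>. indicator A (Y \<omega>) \<partial>M) = emeasure M {\<omega> \<in> space M. Y \<omega> \<in> A}"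
proof -
  have "(\<integral>\<^sup>+\<omega>. indicator A (Y \<omega>) \<partial>M) = (\<integral>\<^sup>+\<omega>. indicator (Y -` A \<inter> space M) \<omega> \<partial>M)"
    by (intro nn_integral_cong) (auto split: split_indicator)
  also have "\<dots> = emeasure M (Y -` A \<inter> space M)"
    using assms by (intro nn_integral_indicator measurable_sets)
  finally show ?thesis by (simp add: vimage_def Int_def conj_commute)
qed

section \<open>Product formulas and Fubini for independent variables\<close>

context prob_space
begin

lemma indep_vars_rectangleD:
  assumes "indep_vars N X K" "finite K" "\<And>k. k \<in> K \<Longrightarrow> A k \<in> sets (N k)"
  shows "prob {\<omega> \<in> space M. \<forall>k\<in>K. X k \<omega> \<in> A k} = (\<Prod>k\<in>K. prob {\<omega> \<in> space M. X k \<omega> \<in> A k})"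
proof (cases "K = {}")
  case True
  then show ?thesis by (simp add: prob_space)
next
  case False
  have "{\<omega> \<in> space M. \<forall>k\<in>K. X k \<omega> \<in> A k} = (\<Inter>k\<in>K. X k -` A k \<inter> space M)"
    using False by auto
  also have "prob \<dots> = (\<Prod>k\<in>K. prob (X k -` A k \<inter> space M))"
    using indep_varsD_finite[OF assms(1) False assms(2,3)] by simp
  finally show ?thesis by (simp add: vimage_def Int_def conj_commute)
qed

text \<open>Rectangles over the full index set suffice: the formula for a subfamily \<open>J\<close>
  follows by filling the remaining slots with the whole space. Independence can thus be read off
  from explicit product formulas.\<close>

lemma indep_vars_rectangleI:
  assumes "finite K" and rv: "\<And>k. k \<in> K \<Longrightarrow> random_variable (N k) (X k)"
    and eq: "\<And>A. (\<And>k. k \<in> K \<Longrightarrow> A k \<in> sets (N k)) \<Longrightarrow>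
      prob {\<omega> \<in> space M. \<forall>k\<in>K. X k \<omega> \<in> A k} = (\<Prod>k\<in>K. prob {\<omega> \<in> space M. X k \<omega> \<in> A k})"
  shows "indep_vars N X K"
  unfolding indep_vars_def2
proof (intro conjI ballI rv indep_setsI)
  show "{X i -` A \<inter> space M |A. A \<in> sets (N i)} \<subseteq> events" if "i \<in> K" for i
    using rv[OF that] by (auto intro: measurable_sets)
  fix C J assume J: "J \<noteq> {}" "J \<subseteq> K" "finite J"
    and "\<forall>j\<in>J. C j \<in> {X j -` A \<inter> space M |A. A \<in> sets (N j)}"
  then have "\<forall>j\<in>J. \<exists>A. A \<in> sets (N j) \<and> C j = X j -` A \<inter> space M" by auto
  then obtain A where A: "\<And>j. j \<in> J \<Longrightarrow> A j \<in> sets (N j)" "\<And>j. j \<in> J \<Longrightarrow> C j = X j -` A j \<inter> space M"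
    by metis
  define A' where "A' j = (if j \<in> J then A j else space (N j))" for j
  have "prob {\<omega> \<in> space M. \<forall>k\<in>K. X k \<omega> \<in> A' k} = (\<Prod>k\<in>K. prob {\<omega> \<in> space M. X k \<omega> \<in> A' k})"
    using A by (intro eq) (auto simp: A'_def)
  also have "{\<omega> \<in> space M. \<forall>k\<in>K. X k \<omega> \<in> A' k} = (\<Inter>j\<in>J. C j)"
  proof -
    have "X k \<omega> \<in> space (N k)" if "k \<in> K" "\<omega> \<in> space M" for k \<omega>
      using measurable_space[OF rv] that by blast
    then have "(\<forall>k\<in>K. X k \<omega> \<in> A' k) \<longleftrightarrow> (\<forall>k\<in>J. X k \<omega> \<in> A k)" if "\<omega> \<in> space M" for \<omega>
      using that J(2) by (auto simp: A'_def)
    then show ?thesis using J(1) by (auto simp: A(2))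
  qed
  also have "(\<Prod>k\<in>K. prob {\<omega> \<in> space M. X k \<omega> \<in> A' k}) = (\<Prod>k\<in>J. prob {\<omega> \<in> space M. X k \<omega> \<in> A' k})"
  proof (rule prod.mono_neutral_right[OF assms(1) J(2)], intro ballI)
    fix i assume "i \<in> K - J"
    then have "{\<omega> \<in> space M. X i \<omega> \<in> A' i} = space M"
      using measurable_space[OF rv] by (auto simp: A'_def)
    then show "prob {\<omega> \<in> space M. X i \<omega> \<in> A' i} = 1" by (simp add: prob_space)
  qed
  also have "\<dots> = (\<Prod>j\<in>J. prob (C j))"
    using A(2) by (intro prod.cong refl arg_cong[where f=prob]) (auto simp: A'_def)
  finally show "prob (\<Inter>j\<in>J. C j) = (\<Prod>j\<in>J. prob (C j))" .
qed

text \<open>The joint law is the product of the two laws, and Tonelli does the rest. Independence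
  enters as a product formula on preimages, so the two variables may have different types; below,
  one is a vector of subordinator values and the other the identity of \<Omega>.\<close>

lemma nn_integral_indep_pair:
  assumes X[measurable]: "random_variable S X" and Y[measurable]: "random_variable T Y"
    and indep: "\<And>A C. A \<in> sets S \<Longrightarrow> C \<in> sets T \<Longrightarrow>
      prob ((X -` A \<inter> space M) \<inter> (Y -` C \<inter> space M)) = prob (X -` A \<inter> space M) * prob (Y -` C \<inter> space M)"
    and F: "F \<in> borel_measurable (S \<Otimes>\<^sub>M T)"
  shows "(\<integral>\<^sup>+\<omega>. F (X \<omega>, Y \<omega>) \<partial>M) = (\<integral>\<^sup>+\<omega>'. \<integral>\<^sup>+\<omega>. F (X \<omega>', Y \<omega>) \<partial>M \<partial>M)"
proof -
  interpret X: prob_space "distr M S X" by (rule prob_space_distr) fact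
  interpret Y: prob_space "distr M T Y" by (rule prob_space_distr) fact
  have eq: "distr M S X \<Otimes>\<^sub>M distr M T Y = distr M (S \<Otimes>\<^sub>M T) (\<lambda>x. (X x, Y x))"
  proof (rule pair_measure_eqI)
    show "sets (distr M S X \<Otimes>\<^sub>M distr M T Y) = sets (distr M (S \<Otimes>\<^sub>M T) (\<lambda>x. (X x, Y x)))"
      by (simp cong: sets_pair_measure_cong)
    fix A C assume "A \<in> sets (distr M S X)" "C \<in> sets (distr M T Y)"
    then have [measurable]: "A \<in> sets S" "C \<in> sets T" by auto
    have "(\<lambda>x. (X x, Y x)) -` (A \<times> C) \<inter> space M = (X -` A \<inter> space M) \<inter> (Y -` C \<inter> space M)"
      by auto
    then show "emeasure (distr M S X) A * emeasure (distr M T Y) C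
        = emeasure (distr M (S \<Otimes>\<^sub>M T) (\<lambda>x. (X x, Y x))) (A \<times> C)"
      using indep[of A C] by (simp add: emeasure_distr emeasure_eq_measure ennreal_mult)
  qed (auto intro: X.sigma_finite_measure_axioms Y.sigma_finite_measure_axioms)
  have [measurable]: "F \<in> borel_measurable (S \<Otimes>\<^sub>M T)" by fact
  have "(\<integral>\<^sup>+\<omega>. F (X \<omega>, Y \<omega>) \<partial>M) = (\<integral>\<^sup>+z. F z \<partial>(distr M S X \<Otimes>\<^sub>M distr M T Y))"
    unfolding eq by (subst nn_integral_distr) auto
  also have "\<dots> = (\<integral>\<^sup>+x. \<integral>\<^sup>+y. F (x, y) \<partial>distr M T Y \<partial>distr M S X)"
    by (intro Y.nn_integral_fst[symmetric]) (simp add: eq F)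
  also have "\<dots> = (\<integral>\<^sup>+\<omega>'. \<integral>\<^sup>+y. F (X \<omega>', y) \<partial>distr M T Y \<partial>M)"
    by (subst nn_integral_distr) auto
  also have "\<dots> = (\<integral>\<^sup>+\<omega>'. \<integral>\<^sup>+\<omega>. F (X \<omega>', Y \<omega>) \<partial>M \<partial>M)"
  proof (rule nn_integral_cong)
    fix \<omega>' assume "\<omega>' \<in> space M"
    then have "X \<omega>' \<in> space S" using measurable_space[OF X] by blast
    then have "(\<lambda>y. F (X \<omega>', y)) \<in> borel_measurable T" by measurable
    then show "(\<integral>\<^sup>+y. F (X \<omega>', y) \<partial>distr M T Y) = (\<integral>\<^sup>+\<omega>. F (X \<omega>', Y \<omega>) \<partial>M)"
      by (subst nn_integral_distr) auto
  qed
  finally show ?thesis .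
qed

end

section \<open>Independent increments of subordinate Brownian motion\<close>

abbreviation Rd_borel :: "nat \<Rightarrow> vec measure" where
  "Rd_borel d \<equiv> Pi\<^sub>M {..<d} (\<lambda>_. borel)"

definition vadd :: "nat \<Rightarrow> vec \<Rightarrow> vec \<Rightarrow> vec" where
  "vadd d x y = (\<lambda>i\<in>{..<d}. x i + y i)"

definition vsub :: "nat \<Rightarrow> vec \<Rightarrow> vec \<Rightarrow> vec" where
  "vsub d x y = (\<lambda>i\<in>{..<d}. x i - y i)"

lemma measurable_vadd[measurable]:
  assumes [measurable]: "f \<in> measurable N (Rd_borel d)" "g \<in> measurable N (Rd_borel d)"
  shows "(\<lambda>x. vadd d (f x) (g x)) \<in> measurable N (Rd_borel d)"
  unfolding vadd_def by (intro measurable_restrict) measurable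

lemma measurable_vsub[measurable]:
  assumes [measurable]: "f \<in> measurable N (Rd_borel d)" "g \<in> measurable N (Rd_borel d)"
  shows "(\<lambda>x. vsub d (f x) (g x)) \<in> measurable N (Rd_borel d)"
  unfolding vsub_def by (intro measurable_restrict) measurable

lemma space_Rd_borel: "space (Rd_borel d) = Rd d"
  by (simp add: space_PiM Rd_def)

lemma sets_Rd_lborel[measurable_cong]: "sets (Rd_lborel d) = sets (Rd_borel d)"
  unfolding Rd_lborel_def by (intro sets_PiM_cong) auto

lemma vadd_in_Rd[simp]: "vadd d x y \<in> Rd d"
  by (simp add: vadd_def Rd_def)

lemma vadd_assoc: "vadd d (vadd d x y) z = vadd d x (vadd d y z)"
  by (auto simp: vadd_def)

lemma vadd_vsub: "y \<in> Rd d \<Longrightarrow> vadd d x (vsub d y x) = y"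
  by (auto simp: vadd_def vsub_def Rd_def PiE_def extensional_def)

section \<open>The process with times clamped at 0, and its measurability\<close>

locale subordinate_brownian =
  fixes M :: "'w measure" and d :: nat and \<Psi> :: "real \<Rightarrow> real"
    and S :: "real \<Rightarrow> 'w \<Rightarrow> real" and B :: "nat \<Rightarrow> real \<Rightarrow> 'w \<Rightarrow> real"
  assumes sbm_M: "sbm_setup M d \<Psi> S B" and dim_pos: "1 \<le> d"
begin

sublocale prob_space M
  using sbm_M by (simp add: sbm_setup_def)

text \<open>Clamping at 0 makes the path total in time, so that joint measurability can be stated
  over the whole real line and random times need no side condition.\<close>

definition Bv :: "real \<Rightarrow> 'w \<Rightarrow> vec" where
  "Bv \<sigma> \<omega> = (\<lambda>i\<in>{..<d}. B i (max 0 \<sigma>) \<omega>)"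

definition X :: "real \<Rightarrow> 'w \<Rightarrow> vec" where
  "X t \<omega> = Bv (S (max 0 t) \<omega>) \<omega>"

definition MB :: "'w measure" where
  "MB = vimage_algebra (space M) (\<lambda>\<omega>. \<lambda>(i, t)\<in>{..<d} \<times> {0..}. B i t \<omega>)
     (Pi\<^sub>M ({..<d} \<times> {0..}) (\<lambda>_. borel))"

abbreviation Z :: "vec \<Rightarrow> real \<Rightarrow> 'w \<Rightarrow> vec" where
  "Z x t \<omega> \<equiv> vadd d x (X t \<omega>)"

lemma subordinator: "subordinator M \<Psi> S" and brownian: "brownian M d B"
  using sbm_M by (auto simp: sbm_setup_def)

lemma brownian1: "i < d \<Longrightarrow> brownian1 M (B i)"
  using brownian by (auto simp: brownian_def)

lemma S_measurable: "0 \<le> t \<Longrightarrow> S t \<in> borel_measurable M"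
  using subordinator by (auto simp: subordinator_def)

lemma S_0: "\<omega> \<in> space M \<Longrightarrow> S 0 \<omega> = 0"
  using subordinator by (auto simp: subordinator_def)

lemma S_mono: "\<omega> \<in> space M \<Longrightarrow> 0 \<le> s \<Longrightarrow> s \<le> t \<Longrightarrow> S s \<omega> \<le> S t \<omega>"
  using subordinator by (auto simp: subordinator_def mono_on_def)

lemma S_nonneg: "\<omega> \<in> space M \<Longrightarrow> 0 \<le> t \<Longrightarrow> 0 \<le> S t \<omega>"
  using S_mono[of \<omega> 0 t] S_0 by simp

lemma B_0: "i < d \<Longrightarrow> \<omega> \<in> space M \<Longrightarrow> B i 0 \<omega> = 0"
  using brownian1 by (auto simp: brownian1_def)

lemma B_measurable: "i < d \<Longrightarrow> 0 \<le> t \<Longrightarrow> B i t \<in> borel_measurable M"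
  using brownian1 by (auto simp: brownian1_def)

lemma space_MB[simp]: "space MB = space M"
  by (simp add: MB_def)

lemma indep_S_B: "indep_set
     (sets (vimage_algebra (space M) (\<lambda>\<omega>. \<lambda>t\<in>{0..}. S t \<omega>) (Pi\<^sub>M {0..} (\<lambda>_. borel)))) (sets MB)"
  using sbm_M by (simp add: sbm_setup_def MB_def)

lemma sets_MB_subset: "sets MB \<subseteq> events"
  using indep_S_B by (auto simp: indep_sets2_eq)

lemma measurable_id_MB: "(\<lambda>\<omega>. \<omega>) \<in> measurable M MB"
  using sets_MB_subset by (auto intro!: measurableI dest: sets.sets_into_space)

lemma B_measurable_MB:
  assumes "i < d" "0 \<le> t"
  shows "B i t \<in> borel_measurable MB"
proof -
  have "(\<lambda>\<omega>. \<lambda>(i, t)\<in>{..<d} \<times> {0..}. B i t \<omega>) \<in> measurable MB (Pi\<^sub>M ({..<d} \<times> {0..}) (\<lambda>_. borel))"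
    unfolding MB_def by (rule measurable_vimage_algebra1) (auto simp: space_PiM)
  from measurable_compose[OF this measurable_component_singleton[of "(i, t)"]]
  show ?thesis using assms by simp
qed

lemma Bv_measurable_joint_MB: "(\<lambda>p. Bv (fst p) (snd p)) \<in> measurable (borel \<Otimes>\<^sub>M MB) (Rd_borel d)"
  unfolding Bv_def
proof (intro measurable_restrict measurable_right_continuous_process)
  fix i \<omega> and t :: real assume "i \<in> {..<d}" "\<omega> \<in> space MB" "0 \<le> t"
  then have "continuous_on {0..} (\<lambda>t. B i t \<omega>)"
    using brownian1 by (auto simp: brownian1_def)
  then have "continuous (at t within {0..}) (\<lambda>t. B i t \<omega>)"
    using \<open>0 \<le> t\<close> by (auto simp: continuous_on_eq_continuous_within)
  then show "continuous (at_right t) (\<lambda>s. B i s \<omega>)"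
    by (rule continuous_within_subset) (use \<open>0 \<le> t\<close> in auto)
qed (auto intro: B_measurable_MB)

lemma Bv_measurable_joint: "(\<lambda>p. Bv (fst p) (snd p)) \<in> measurable (borel \<Otimes>\<^sub>M M) (Rd_borel d)"
proof -
  have "(\<lambda>p. (fst p, snd p)) \<in> measurable (borel \<Otimes>\<^sub>M M) (borel \<Otimes>\<^sub>M MB)"
    by (intro measurable_Pair measurable_fst measurable_compose[OF measurable_snd measurable_id_MB])
  from measurable_compose[OF this Bv_measurable_joint_MB] show ?thesis by simp
qed

lemma Bv_measurable[measurable (raw)]:
  assumes "f \<in> borel_measurable N" "g \<in> measurable N M"
  shows "(\<lambda>x. Bv (f x) (g x)) \<in> measurable N (Rd_borel d)"
  using measurable_compose[OF measurable_Pair[OF assms] Bv_measurable_joint] by simp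

lemma Bv_measurable_MB[measurable (raw)]:
  assumes "f \<in> borel_measurable N" "g \<in> measurable N MB"
  shows "(\<lambda>x. Bv (f x) (g x)) \<in> measurable N (Rd_borel d)"
  using measurable_compose[OF measurable_Pair[OF assms] Bv_measurable_joint_MB] by simp

lemma S_measurable_joint[measurable (raw)]:
  assumes "f \<in> borel_measurable N" "g \<in> measurable N M"
  shows "(\<lambda>x. S (max 0 (f x)) (g x)) \<in> borel_measurable N"
proof -
  have "(\<lambda>p. S (max 0 (fst p)) (snd p)) \<in> borel_measurable (borel \<Otimes>\<^sub>M M)"
    by (rule measurable_right_continuous_process[OF S_measurable])
      (use subordinator in \<open>auto simp: subordinator_def\<close>)
  from measurable_compose[OF measurable_Pair[OF assms] this] show ?thesis by simp
qed

lemma X_measurable[measurable (raw)]: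
  assumes "f \<in> borel_measurable N" "g \<in> measurable N M"
  shows "(\<lambda>x. X (f x) (g x)) \<in> measurable N (Rd_borel d)"
  unfolding X_def using assms by measurable

lemma Bv_in_Rd[simp]: "Bv t \<omega> \<in> Rd d"
  by (simp add: Bv_def Rd_def)

lemma X_in_Rd[simp]: "X t \<omega> \<in> Rd d"
  by (simp add: X_def)

lemma sbm_eq: "\<omega> \<in> space M \<Longrightarrow> 0 \<le> t \<Longrightarrow> sbm d S B x t \<omega> = Z x t \<omega>"
  using S_nonneg[of \<omega> t] by (auto simp: sbm_def vadd_def X_def Bv_def max_def)

lemma Bv_0: "\<omega> \<in> space M \<Longrightarrow> Bv 0 \<omega> = (\<lambda>i\<in>{..<d}. 0)"
  by (auto simp: Bv_def B_0)

lemma vadd_X_0: "\<omega> \<in> space M \<Longrightarrow> x \<in> Rd d \<Longrightarrow> Z x 0 \<omega> = x"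
  by (auto simp: X_def S_0 Bv_0 vadd_def Rd_def PiE_def extensional_def)

text \<open>The second factor is the whole of \<open>\<Omega>\<close> with the \<open>\<sigma>\<close>-algebra generated by \<open>B\<close>: evaluation at a
  random time is measurable there, whereas it is not measurable on the product space of paths.\<close>

lemma nn_integral_freeze_subordinator:
  fixes t :: "nat \<Rightarrow> real"
  assumes t: "\<And>k. 0 \<le> t k" and F: "F \<in> borel_measurable (Pi\<^sub>M {..n} (\<lambda>_. borel) \<Otimes>\<^sub>M MB)"
  shows "(\<integral>\<^sup>+\<omega>. F (\<lambda>k\<in>{..n}. S (t k) \<omega>, \<omega>) \<partial>M) =
    (\<integral>\<^sup>+\<omega>'. \<integral>\<^sup>+\<omega>. F (\<lambda>k\<in>{..n}. S (t k) \<omega>', \<omega>) \<partial>M \<partial>M)"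
proof -
  let ?N = "Pi\<^sub>M {..n} (\<lambda>_. borel) :: (nat \<Rightarrow> real) measure"
  let ?V = "vimage_algebra (space M) (\<lambda>\<omega>. \<lambda>t\<in>{0..}. S t \<omega>) (Pi\<^sub>M {0..} (\<lambda>_. borel))"
  let ?Y = "\<lambda>\<omega>. \<lambda>k\<in>{..n}. S (t k) \<omega>"
  have rv: "random_variable ?N ?Y"
    by (intro measurable_restrict S_measurable t)
  have V: "?Y \<in> measurable ?V ?N"
  proof (rule measurable_restrict)
    fix k
    have "(\<lambda>\<omega>. \<lambda>t\<in>{0..}. S t \<omega>) \<in> measurable ?V (Pi\<^sub>M {0..} (\<lambda>_. borel))"
      by (rule measurable_vimage_algebra1) (auto simp: space_PiM)
    from measurable_compose[OF this measurable_component_singleton[of "t k"]]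
    show "(\<lambda>\<omega>. S (t k) \<omega>) \<in> borel_measurable ?V" using t by simp
  qed
  show ?thesis
  proof (rule nn_integral_indep_pair[OF rv measurable_id_MB _ F])
    fix A C assume "A \<in> sets ?N" "C \<in> sets MB"
    then have "?Y -` A \<inter> space M \<in> sets ?V" "(\<lambda>\<omega>. \<omega>) -` C \<inter> space M \<in> sets MB"
      using measurable_sets[OF V] sets.sets_into_space[of C MB] by (auto simp: Int_absorb2)
    then show "prob ((?Y -` A \<inter> space M) \<inter> ((\<lambda>\<omega>. \<omega>) -` C \<inter> space M))
        = prob (?Y -` A \<inter> space M) * prob ((\<lambda>\<omega>. \<omega>) -` C \<inter> space M)"
      by (rule indep_setD[OF indep_S_B])
  qed
qed

section \<open>Increments of the Brownian vector\<close>

definition Bpath :: "nat \<Rightarrow> 'w \<Rightarrow> real \<Rightarrow> real" where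
  "Bpath i \<omega> = (\<lambda>t\<in>{0..}. B i t \<omega>)"

lemma indep_paths: "indep_vars (\<lambda>_. Pi\<^sub>M {0..} (\<lambda>_. borel)) Bpath {..<d}"
  using brownian unfolding brownian_def Bpath_def[abs_def] by simp

lemma indep_coordinate_increments:
  assumes "0 \<le> s" "s \<le> t"
  shows "indep_vars (\<lambda>_. borel) (\<lambda>i \<omega>. B i t \<omega> - B i s \<omega>) {..<d}"
proof -
  have "indep_vars (\<lambda>_. borel) (\<lambda>i \<omega>. Bpath i \<omega> t - Bpath i \<omega> s) {..<d}"
    by (rule indep_vars_compose2[OF indep_paths, where Y = "\<lambda>_ w. w t - w s"])
      (use assms in \<open>auto intro!: borel_measurable_diff measurable_component_singleton\<close>)
  then show ?thesis using assms by (simp add: Bpath_def)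
qed

lemma distr_B_increment:
  assumes "i < d" "0 \<le> s" "s \<le> t"
  shows "distr M borel (\<lambda>\<omega>. B i t \<omega> - B i s \<omega>) = distr M borel (B i (t - s))"
\<comment> \<open>\<open>brownian1\<close> prescribes the law of an increment only for s < t; for s
  = t both sides are the point mass at 0.\<close>
proof (cases "s = t")
  case True
  then show ?thesis using assms by (intro distr_cong) (auto simp: B_0)
next
  case False
  have dist: "distributed M lborel (\<lambda>\<omega>. B i t \<omega> - B i s \<omega>) (normal_density 0 (sqrt (2 * (t - s))))"
    if "0 \<le> s" "s < t" for s t
    using brownian1[OF \<open>i < d\<close>] that by (auto simp: brownian1_def)
  have "distr M borel (B i (t - s)) = distr M borel (\<lambda>\<omega>. B i (t - s) \<omega> - B i 0 \<omega>)"
    using assms by (intro distr_cong) (auto simp: B_0)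
  also have "\<dots> = distr M lborel (\<lambda>\<omega>. B i (t - s) \<omega> - B i 0 \<omega>)"
    by (rule distr_cong) auto
  also have "\<dots> = density lborel (normal_density 0 (sqrt (2 * (t - s))))"
    using dist[of 0 "t - s"] assms False by (simp add: distributed_distr_eq_density)
  also have "\<dots> = distr M lborel (\<lambda>\<omega>. B i t \<omega> - B i s \<omega>)"
    using dist[of s t] assms False by (simp add: distributed_distr_eq_density)
  also have "\<dots> = distr M borel (\<lambda>\<omega>. B i t \<omega> - B i s \<omega>)"
    by (rule distr_cong) auto
  finally show ?thesis by simp
qed

lemma distr_Bv_increment_PiM:
  assumes "0 \<le> s" "s \<le> t"
  shows "distr M (Rd_borel d) (\<lambda>\<omega>. vsub d (Bv t \<omega>) (Bv s \<omega>)) =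
    (\<Pi>\<^sub>M i\<in>{..<d}. distr M borel (\<lambda>\<omega>. B i t \<omega> - B i s \<omega>))"
proof -
  have "{..<d} \<noteq> {}" using dim_pos by (auto simp: lessThan_empty_iff)
  have "distr M (Rd_borel d) (\<lambda>\<omega>. vsub d (Bv t \<omega>) (Bv s \<omega>)) =
      distr M (Rd_borel d) (\<lambda>\<omega>. \<lambda>i\<in>{..<d}. B i t \<omega> - B i s \<omega>)"
    using assms by (intro distr_cong) (auto simp: vsub_def Bv_def)
  also have "\<dots> = (\<Pi>\<^sub>M i\<in>{..<d}. distr M borel (\<lambda>\<omega>. B i t \<omega> - B i s \<omega>))"
    using assms
    by (intro indep_vars_iff_distr_eq_PiM'[THEN iffD1, OF \<open>{..<d} \<noteq> {}\<close> _ indep_coordinate_increments]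
        borel_measurable_diff B_measurable) auto
  finally show ?thesis .
qed

lemma distr_Bv_increment:
  assumes "0 \<le> s" "s \<le> t"
  shows "distr M (Rd_borel d) (\<lambda>\<omega>. vsub d (Bv t \<omega>) (Bv s \<omega>)) = distr M (Rd_borel d) (Bv (t - s))"
proof -
  have "distr M (Rd_borel d) (Bv (t - s)) =
      distr M (Rd_borel d) (\<lambda>\<omega>. vsub d (Bv (t - s) \<omega>) (Bv 0 \<omega>))"
    using assms by (intro distr_cong) (auto simp: vsub_def Bv_def B_0)
  also have "\<dots> = distr M (Rd_borel d) (\<lambda>\<omega>. vsub d (Bv t \<omega>) (Bv s \<omega>))"
    using assms distr_B_increment[of _ s t] distr_B_increment[of _ 0 "t - s"]
    by (subst (1 2) distr_Bv_increment_PiM) (auto intro!: PiM_cong)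
  finally show ?thesis by simp
qed

text \<open>Two kinds of independence are merged: the coordinates are independent as whole paths,
  and within one coordinate the increments over disjoint intervals are independent. Together they
  factorise every box over the array of pairs (i, k).\<close>

lemma indep_Bv_increments:
  fixes \<sigma> :: "nat \<Rightarrow> real"
  assumes \<sigma>: "mono \<sigma>" "0 \<le> \<sigma> 0"
  shows "indep_vars (\<lambda>_. Rd_borel d) (\<lambda>k \<omega>. vsub d (Bv (\<sigma> (Suc k)) \<omega>) (Bv (\<sigma> k) \<omega>)) {..<n}"
proof -
  have \<sigma>0: "0 \<le> \<sigma> k" for k using \<sigma> monoD[OF \<sigma>(1), of 0 k] by simp
  have path: "Bpath i \<omega> (\<sigma> k) = B i (\<sigma> k) \<omega>" for i \<omega> k using \<sigma>0 by (simp add: Bpath_def)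
  define W where "W p \<omega> = B (fst p) (\<sigma> (Suc (snd p))) \<omega> - B (fst p) (\<sigma> (snd p)) \<omega>" for p :: "nat \<times> nat" and \<omega>
  let ?V = "\<lambda>i \<omega>. \<lambda>k\<in>{..<n}. Bpath i \<omega> (\<sigma> (Suc k)) - Bpath i \<omega> (\<sigma> k)"
  have W_rv: "random_variable borel (W p)" if "p \<in> {..<d} \<times> {..<n}" for p
    using that unfolding W_def by (intro borel_measurable_diff B_measurable \<sigma>0) auto
  have V: "indep_vars (\<lambda>_. Pi\<^sub>M {..<n} (\<lambda>_. borel)) (\<lambda>i \<omega>. \<lambda>k\<in>{..<n}. Bpath i \<omega> (\<sigma> (Suc k)) - Bpath i \<omega> (\<sigma> k)) {..<d}"
    by (rule indep_vars_compose2[OF indep_paths, where Y = "\<lambda>_ w. \<lambda>k\<in>{..<n}. w (\<sigma> (Suc k)) - w (\<sigma> k)"])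
      (intro measurable_restrict borel_measurable_diff measurable_component_singleton; simp add: \<sigma>0)
  have "indep_vars (\<lambda>_. borel) W ({..<d} \<times> {..<n})"
  proof (rule indep_vars_rectangleI)
    fix A :: "nat \<times> nat \<Rightarrow> real set" assume "\<And>p. p \<in> {..<d} \<times> {..<n} \<Longrightarrow> A p \<in> sets borel"
    then have A: "A (i, k) \<in> sets borel" if "i < d" "k < n" for i k using that by auto
    have "prob {\<omega> \<in> space M. \<forall>p\<in>{..<d} \<times> {..<n}. W p \<omega> \<in> A p} =
        prob {\<omega> \<in> space M. \<forall>i\<in>{..<d}. ?V i \<omega> \<in> (\<Pi>\<^sub>E k\<in>{..<n}. A (i, k))}"
    proof (intro arg_cong[where f = prob] Collect_cong conj_cong refl)
      fix \<omega>
      have "(\<forall>p\<in>{..<d} \<times> {..<n}. W p \<omega> \<in> A p) \<longleftrightarrow> (\<forall>i\<in>{..<d}. \<forall>k\<in>{..<n}. W (i, k) \<omega> \<in> A (i, k))"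
        by blast
      then show "(\<forall>p\<in>{..<d} \<times> {..<n}. W p \<omega> \<in> A p) \<longleftrightarrow>
          (\<forall>i\<in>{..<d}. ?V i \<omega> \<in> (\<Pi>\<^sub>E k\<in>{..<n}. A (i, k)))"
        unfolding restrict_PiE_iff path W_def by simp
    qed
    also have "\<dots> = (\<Prod>i<d. prob {\<omega> \<in> space M. ?V i \<omega> \<in> (\<Pi>\<^sub>E k\<in>{..<n}. A (i, k))})"
      by (rule indep_vars_rectangleD[OF V]) (auto intro!: sets_PiM_I_finite A)
    also have "\<dots> = (\<Prod>i<d. prob {\<omega> \<in> space M. \<forall>k\<in>{..<n}. B i (\<sigma> (Suc k)) \<omega> - B i (\<sigma> k) \<omega> \<in> A (i, k)})"
      by (simp only: path restrict_PiE_iff)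
    also have "\<dots> = (\<Prod>i<d. \<Prod>k<n. prob {\<omega> \<in> space M. B i (\<sigma> (Suc k)) \<omega> - B i (\<sigma> k) \<omega> \<in> A (i, k)})"
    proof (intro prod.cong refl)
      fix i assume "i \<in> {..<d}"
      then have "indep_vars (\<lambda>_. borel) (\<lambda>k \<omega>. B i (\<sigma> (Suc k)) \<omega> - B i (\<sigma> k) \<omega>) {..<n}"
        using brownian1[of i] \<sigma> by (auto simp: brownian1_def indep_increments_def)
      from indep_vars_rectangleD[OF this] show "prob {\<omega> \<in> space M. \<forall>k\<in>{..<n}. B i (\<sigma> (Suc k)) \<omega> - B i (\<sigma> k) \<omega> \<in> A (i, k)} =
          (\<Prod>k<n. prob {\<omega> \<in> space M. B i (\<sigma> (Suc k)) \<omega> - B i (\<sigma> k) \<omega> \<in> A (i, k)})"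
        using A \<open>i \<in> {..<d}\<close> by auto
    qed
    also have "\<dots> = (\<Prod>p\<in>{..<d} \<times> {..<n}. prob {\<omega> \<in> space M. W p \<omega> \<in> A p})"
      by (simp add: prod.cartesian_product W_def case_prod_beta')
    finally show "prob {\<omega> \<in> space M. \<forall>p\<in>{..<d} \<times> {..<n}. W p \<omega> \<in> A p} = \<dots>" .
  qed (auto intro: W_rv)
  \<comment> \<open>The array is regrouped by time index: blocks of an independent family over
    disjoint index sets are again independent.\<close>
  then have "indep_vars (\<lambda>k. Pi\<^sub>M ({..<d} \<times> {k}) (\<lambda>_. borel)) (\<lambda>k \<omega>. restrict (\<lambda>p. W p \<omega>) ({..<d} \<times> {k})) {..<n}"
    by (rule indep_vars_restrict) (auto simp: disjoint_family_on_def)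
  then have "indep_vars (\<lambda>_. Rd_borel d) (\<lambda>k \<omega>. \<lambda>i\<in>{..<d}. restrict (\<lambda>p. W p \<omega>) ({..<d} \<times> {k}) (i, k)) {..<n}"
    by (rule indep_vars_compose2[where Y = "\<lambda>k w. \<lambda>i\<in>{..<d}. w (i, k)"])
      (auto intro!: measurable_restrict measurable_component_singleton)
  moreover have "(\<lambda>k \<omega>. \<lambda>i\<in>{..<d}. restrict (\<lambda>p. W p \<omega>) ({..<d} \<times> {k}) (i, k)) =
      (\<lambda>k \<omega>. vsub d (Bv (\<sigma> (Suc k)) \<omega>) (Bv (\<sigma> k) \<omega>))"
    using \<sigma>0 by (auto simp: W_def vsub_def Bv_def fun_eq_iff)
  ultimately show ?thesis by simp
qed


section \<open>Independence and stationarity of the increments of X\<close>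

lemma nn_integral_X_freeze:
  assumes f[measurable]: "f \<in> borel_measurable (Rd_borel d)" and "0 \<le> t"
  shows "(\<integral>\<^sup>+\<omega>. f (X t \<omega>) \<partial>M) = (\<integral>\<^sup>+\<omega>'. \<integral>\<^sup>+\<omega>. f (Bv (S t \<omega>') \<omega>) \<partial>M \<partial>M)"
proof -
  have [measurable]: "(\<lambda>p. fst p (0::nat)) \<in> borel_measurable (Pi\<^sub>M {..0} (\<lambda>_. borel) \<Otimes>\<^sub>M MB)"
    by (rule measurable_compose[OF measurable_fst measurable_component_singleton]) simp
  have "(\<lambda>p. f (Bv (fst p (0::nat)) (snd p))) \<in> borel_measurable (Pi\<^sub>M {..0} (\<lambda>_. borel) \<Otimes>\<^sub>M MB)"
    by measurable
  from nn_integral_freeze_subordinator[of "\<lambda>_. t", OF \<open>0 \<le> t\<close> this]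
  show ?thesis using \<open>0 \<le> t\<close> by (simp add: X_def)
qed

text \<open>With S frozen, the increments of X are Brownian increments over adjacent intervals,
  hence independent with laws that depend only on the interval lengths. The conditional probability
  is therefore a product of functions of the increments of S, and those are independent and
  stationary as well. Independence and stationarity of X are both contained in this formula.\<close>

lemma prob_X_increments:
  fixes t :: "nat \<Rightarrow> real"
  assumes t: "mono t" "0 \<le> t 0" and A: "\<And>k. k < n \<Longrightarrow> A k \<in> sets (Rd_borel d)"
  shows "emeasure M {\<omega> \<in> space M. \<forall>k\<in>{..<n}. vsub d (X (t (Suc k)) \<omega>) (X (t k) \<omega>) \<in> A k} =
    (\<Prod>k<n. emeasure M {\<omega> \<in> space M. X (t (Suc k) - t k) \<omega> \<in> A k})"
proof -
  have t0: "0 \<le> t k" for k using t monoD[OF t(1), of 0 k] by simp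
  have t_mono: "t k \<le> t (Suc k)" for k using monoD[OF t(1), of k "Suc k"] by simp
  \<comment> \<open>The probability that a Brownian increment over a time span \<delta> lies in
    \<open>A k\<close>; only the length of the span matters, so it can be evaluated at an increment
    of S.\<close>
  define h where "h k \<delta> = (\<integral>\<^sup>+\<omega>. indicator (A k) (Bv \<delta> \<omega>) \<partial>M)" for k \<delta>
  let ?G = "\<lambda>k. {\<omega> \<in> space M. X (t (Suc k) - t k) \<omega> \<in> A k}"
  have ind[measurable]: "(\<lambda>x. indicator (A k) x :: ennreal) \<in> borel_measurable (Rd_borel d)" if "k < n" for k
    using A[OF that] by simp
  have h[measurable]: "h k \<in> borel_measurable borel" if "k < n" for k
  proof -
    note [measurable] = A[OF that]
    show ?thesis unfolding h_def by measurable
  qed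
  define F where "F p = (\<Prod>k<n. indicator (A k) (vsub d (Bv (fst p (Suc k)) (snd p)) (Bv (fst p k) (snd p))) :: ennreal)"
    for p :: "(nat \<Rightarrow> real) \<times> 'w"
  have F: "F \<in> borel_measurable (Pi\<^sub>M {..n} (\<lambda>_. borel) \<Otimes>\<^sub>M MB)"
    unfolding F_def
  proof (intro borel_measurable_prod_ennreal)
    fix k assume "k \<in> {..<n}"
    then have [measurable]: "A k \<in> sets (Rd_borel d)"
        "(\<lambda>p. fst p k) \<in> borel_measurable (Pi\<^sub>M {..n} (\<lambda>_. borel) \<Otimes>\<^sub>M MB)"
        "(\<lambda>p. fst p (Suc k)) \<in> borel_measurable (Pi\<^sub>M {..n} (\<lambda>_. borel) \<Otimes>\<^sub>M MB)"
      using A by (auto intro!: measurable_compose[OF measurable_fst measurable_component_singleton])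
    show "(\<lambda>p. indicator (A k) (vsub d (Bv (fst p (Suc k)) (snd p)) (Bv (fst p k) (snd p))) :: ennreal)
        \<in> borel_measurable (Pi\<^sub>M {..n} (\<lambda>_. borel) \<Otimes>\<^sub>M MB)"
      by measurable
  qed
  have events: "{\<omega> \<in> space M. \<forall>k\<in>{..<n}. Y k \<omega> \<in> A k} \<in> events"
    if "\<And>k. k < n \<Longrightarrow> Y k \<in> measurable M (Rd_borel d)" for Y
  proof (rule sets.sets_Collect_finite_All)
    fix k assume "k \<in> {..<n}"
    then show "{\<omega> \<in> space M. Y k \<omega> \<in> A k} \<in> events"
      using measurable_sets[OF that A, of k k] by (simp add: vimage_def Int_def conj_commute)
  qed simp
  have int_prod: "(\<integral>\<^sup>+\<omega>. (\<Prod>k<n. indicator (A k) (Y k \<omega>)) \<partial>M) =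
      emeasure M {\<omega> \<in> space M. \<forall>k\<in>{..<n}. Y k \<omega> \<in> A k}" (is "_ = emeasure M ?E")
    if "\<And>k. k < n \<Longrightarrow> Y k \<in> measurable M (Rd_borel d)" for Y
  proof -
    have "(\<Prod>k<n. indicator (A k) (Y k \<omega>) :: ennreal) = indicator ?E \<omega>" if "\<omega> \<in> space M" for \<omega>
      using that by (cases "\<omega> \<in> ?E") (auto intro!: prod_zero simp: indicator_def)
    then have "(\<integral>\<^sup>+\<omega>. (\<Prod>k<n. indicator (A k) (Y k \<omega>)) \<partial>M) = (\<integral>\<^sup>+\<omega>. indicator ?E \<omega> \<partial>M)"
      by (rule nn_integral_cong)
    then show ?thesis using events[OF that] by simp
  qed
  have "emeasure M {\<omega> \<in> space M. \<forall>k\<in>{..<n}. vsub d (X (t (Suc k)) \<omega>) (X (t k) \<omega>) \<in> A k} =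
      (\<integral>\<^sup>+\<omega>. F (\<lambda>k\<in>{..n}. S (t k) \<omega>, \<omega>) \<partial>M)"
    using t0 by (subst int_prod[symmetric]) (measurable, auto intro!: nn_integral_cong simp: F_def X_def)
  also have "\<dots> = (\<integral>\<^sup>+\<omega>'. \<integral>\<^sup>+\<omega>. F (\<lambda>k\<in>{..n}. S (t k) \<omega>', \<omega>) \<partial>M \<partial>M)"
    by (rule nn_integral_freeze_subordinator[OF t0 F])
  also have "\<dots> = (\<integral>\<^sup>+\<omega>'. (\<Prod>k<n. h k (S (t (Suc k)) \<omega>' - S (t k) \<omega>')) \<partial>M)"
  proof (rule nn_integral_cong)
    fix \<omega>' assume \<omega>': "\<omega>' \<in> space M"
    define \<sigma> where "\<sigma> k = S (t k) \<omega>'" for k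
    have \<sigma>: "mono \<sigma>" "0 \<le> \<sigma> k" "\<sigma> k \<le> \<sigma> (Suc k)" for k
      using S_mono[OF \<omega>'] S_nonneg[OF \<omega>'] t0 t_mono by (auto simp: \<sigma>_def mono_iff_le_Suc)
    have "(\<integral>\<^sup>+\<omega>. F (\<lambda>k\<in>{..n}. S (t k) \<omega>', \<omega>) \<partial>M) =
        emeasure M {\<omega> \<in> space M. \<forall>k\<in>{..<n}. vsub d (Bv (\<sigma> (Suc k)) \<omega>) (Bv (\<sigma> k) \<omega>) \<in> A k}"
      by (subst int_prod[symmetric]) (measurable, auto intro!: nn_integral_cong simp: F_def \<sigma>_def)
    also have "\<dots> = (\<Prod>k<n. emeasure M {\<omega> \<in> space M. vsub d (Bv (\<sigma> (Suc k)) \<omega>) (Bv (\<sigma> k) \<omega>) \<in> A k})"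
      using indep_vars_rectangleD[OF indep_Bv_increments[OF \<sigma>(1,2)], of "n" A] A
      by (simp add: emeasure_eq_measure prod_ennreal)
    also have "\<dots> = (\<Prod>k<n. h k (\<sigma> (Suc k) - \<sigma> k))"
    proof (rule prod.cong[OF refl])
      fix k assume "k \<in> {..<n}"
      then have Ak[measurable]: "A k \<in> sets (Rd_borel d)" using A by auto
      have "emeasure M {\<omega> \<in> space M. vsub d (Bv (\<sigma> (Suc k)) \<omega>) (Bv (\<sigma> k) \<omega>) \<in> A k} =
          emeasure (distr M (Rd_borel d) (\<lambda>\<omega>. vsub d (Bv (\<sigma> (Suc k)) \<omega>) (Bv (\<sigma> k) \<omega>))) (A k)"
        by (subst emeasure_distr) (auto intro!: arg_cong[where f = "emeasure M"])
      also have "\<dots> = h k (\<sigma> (Suc k) - \<sigma> k)"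
      proof -
        have "emeasure (distr M (Rd_borel d) (Bv (\<sigma> (Suc k) - \<sigma> k))) (A k) =
            (\<integral>\<^sup>+y. indicator (A k) y \<partial>distr M (Rd_borel d) (Bv (\<sigma> (Suc k) - \<sigma> k)))"
          by simp
        also have "\<dots> = h k (\<sigma> (Suc k) - \<sigma> k)"
          unfolding h_def by (subst nn_integral_distr) auto
        finally show ?thesis unfolding distr_Bv_increment[OF \<sigma>(2,3)] .
      qed
      finally show "emeasure M {\<omega> \<in> space M. vsub d (Bv (\<sigma> (Suc k)) \<omega>) (Bv (\<sigma> k) \<omega>) \<in> A k} =
          h k (\<sigma> (Suc k) - \<sigma> k)" .
    qed
    finally show "(\<integral>\<^sup>+\<omega>. F (\<lambda>k\<in>{..n}. S (t k) \<omega>', \<omega>) \<partial>M) =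
        (\<Prod>k<n. h k (S (t (Suc k)) \<omega>' - S (t k) \<omega>'))"
      by (simp add: \<sigma>_def)
  qed
  also have "\<dots> = (\<Prod>k<n. \<integral>\<^sup>+\<omega>'. h k (S (t (Suc k)) \<omega>' - S (t k) \<omega>') \<partial>M)"
  proof (rule indep_vars_nn_integral)
    have "indep_vars (\<lambda>_. borel) (\<lambda>k \<omega>. S (t (Suc k)) \<omega> - S (t k) \<omega>) {..<n}"
      using subordinator t by (auto simp: subordinator_def indep_increments_def)
    then show "indep_vars (\<lambda>_. borel) (\<lambda>k \<omega>. h k (S (t (Suc k)) \<omega> - S (t k) \<omega>)) {..<n}"
      by (rule indep_vars_compose2) (auto intro: h)
  qed auto
  also have "\<dots> = (\<Prod>k<n. emeasure M (?G k))"
  proof (rule prod.cong[OF refl])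
    fix k assume "k \<in> {..<n}"
    then have k: "k < n" and [measurable]: "A k \<in> sets (Rd_borel d)" "h k \<in> borel_measurable borel"
      using A h by auto
    have \<delta>: "0 \<le> t (Suc k) - t k" using t_mono by simp
    note [measurable] = S_measurable[OF t0] S_measurable[OF \<delta>]
    have "(\<integral>\<^sup>+\<omega>. h k (S (t (Suc k)) \<omega> - S (t k) \<omega>) \<partial>M) =
        (\<integral>\<^sup>+x. h k x \<partial>distr M borel (\<lambda>\<omega>. S (t (Suc k)) \<omega> - S (t k) \<omega>))"
      by (subst nn_integral_distr) auto
    also have "distr M borel (\<lambda>\<omega>. S (t (Suc k)) \<omega> - S (t k) \<omega>) = distr M borel (S (t (Suc k) - t k))"
      using subordinator t0 t_mono by (auto simp: subordinator_def)
    also have "(\<integral>\<^sup>+x. h k x \<partial>distr M borel (S (t (Suc k) - t k))) = (\<integral>\<^sup>+\<omega>. h k (S (t (Suc k) - t k) \<omega>) \<partial>M)"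
      by (subst nn_integral_distr) auto
    also have "\<dots> = (\<integral>\<^sup>+\<omega>. indicator (A k) (X (t (Suc k) - t k) \<omega>) \<partial>M)"
      unfolding h_def by (rule nn_integral_X_freeze[symmetric, OF ind[OF k] \<delta>])
    also have "\<dots> = emeasure M (?G k)"
      by (rule nn_integral_indicator_comp) measurable
    finally show "(\<integral>\<^sup>+\<omega>. h k (S (t (Suc k)) \<omega> - S (t k) \<omega>) \<partial>M) =
        emeasure M (?G k)" .
  qed
  finally show ?thesis .
qed

lemma distr_X_increment:
  assumes "0 \<le> s" "s \<le> t"
  shows "distr M (Rd_borel d) (\<lambda>\<omega>. vsub d (X t \<omega>) (X s \<omega>)) = distr M (Rd_borel d) (X (t - s))"
proof (rule measure_eqI)
  fix A assume "A \<in> sets (distr M (Rd_borel d) (\<lambda>\<omega>. vsub d (X t \<omega>) (X s \<omega>)))"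
  then have A[measurable]: "A \<in> sets (Rd_borel d)" by simp
  have "emeasure M {\<omega> \<in> space M. vsub d (X t \<omega>) (X s \<omega>) \<in> A} = emeasure M {\<omega> \<in> space M. X (t - s) \<omega> \<in> A}"
    using prob_X_increments[of "\<lambda>k. if k = 0 then s else t" 1 "\<lambda>_. A"] assms A
    by (simp add: mono_def)
  then show "emeasure (distr M (Rd_borel d) (\<lambda>\<omega>. vsub d (X t \<omega>) (X s \<omega>))) A =
      emeasure (distr M (Rd_borel d) (X (t - s))) A"
    by (simp add: emeasure_distr vimage_def Int_def conj_commute)
qed simp

text \<open>Stationarity turns each factor of \<open>prob_X_increments\<close> into the probability
  of the corresponding increment, which is the product formula for independence.\<close>

lemma indep_X_increments:
  fixes t :: "nat \<Rightarrow> real"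
  assumes t: "mono t" "0 \<le> t 0"
  shows "indep_vars (\<lambda>_. Rd_borel d) (\<lambda>k \<omega>. vsub d (X (t (Suc k)) \<omega>) (X (t k) \<omega>)) {..<n}"
proof (rule indep_vars_rectangleI)
  fix A assume "\<And>k. k \<in> {..<n} \<Longrightarrow> A k \<in> sets (Rd_borel d)"
  then have A: "A k \<in> sets (Rd_borel d)" if "k < n" for k using that by auto
  have t0: "0 \<le> t k" for k using t monoD[OF t(1), of 0 k] by simp
  have t_mono: "t k \<le> t (Suc k)" for k using monoD[OF t(1), of k "Suc k"] by simp
  let ?E = "\<lambda>k. {\<omega> \<in> space M. vsub d (X (t (Suc k)) \<omega>) (X (t k) \<omega>) \<in> A k}"
  have "emeasure M {\<omega> \<in> space M. \<forall>k\<in>{..<n}. vsub d (X (t (Suc k)) \<omega>) (X (t k) \<omega>) \<in> A k} =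
    (\<Prod>k<n. emeasure M {\<omega> \<in> space M. X (t (Suc k) - t k) \<omega> \<in> A k})"
    by (rule prob_X_increments[OF t A])
  also have "\<dots> = (\<Prod>k<n. emeasure M (?E k))"
  proof (rule prod.cong[OF refl])
    fix k assume "k \<in> {..<n}"
    then have "A k \<in> sets (Rd_borel d)" using A by auto
    then show "emeasure M {\<omega> \<in> space M. X (t (Suc k) - t k) \<omega> \<in> A k} =
        emeasure M (?E k)"
      using arg_cong[OF distr_X_increment[OF t0 t_mono], of "\<lambda>D. emeasure D (A k)" k]
      by (simp add: emeasure_distr vimage_def Int_def conj_commute)
  qed
  finally show "prob {\<omega> \<in> space M. \<forall>k\<in>{..<n}. vsub d (X (t (Suc k)) \<omega>) (X (t k) \<omega>) \<in> A k} =
    (\<Prod>k<n. prob (?E k))"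
    by (simp add: emeasure_eq_measure prod_ennreal prod_nonneg)
qed auto

section \<open>Transition operators and the Markov property on finite grids\<close>

definition P :: "real \<Rightarrow> (vec \<Rightarrow> ennreal) \<Rightarrow> vec \<Rightarrow> ennreal" where
  "P s f x = (\<integral>\<^sup>+\<omega>. f (Z x s \<omega>) \<partial>M)"

lemma P_measurable[measurable]:
  assumes [measurable]: "f \<in> borel_measurable (Rd_borel d)"
  shows "P s f \<in> borel_measurable (Rd_borel d)"
  unfolding P_def by measurable

text \<open>The positions up to time \<open>t m\<close> are functions of the first \<open>m\<close>
  increments, and the step to \<open>t (Suc m)\<close> uses only the next one, which is independent
  of them. The grid has to start at 0, since only there is the position known to be x.\<close>

lemma markov_step:
  fixes t :: "nat \<Rightarrow> real"
  assumes t: "mono t" "t 0 = 0" and x: "x \<in> Rd d"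
    and G[measurable]: "G \<in> borel_measurable (Pi\<^sub>M {..m} (\<lambda>_. Rd_borel d))"
    and f[measurable]: "f \<in> borel_measurable (Rd_borel d)"
  shows "(\<integral>\<^sup>+\<omega>. G (\<lambda>k\<in>{..m}. Z x (t k) \<omega>) * f (Z x (t (Suc m)) \<omega>) \<partial>M) =
    (\<integral>\<^sup>+\<omega>. G (\<lambda>k\<in>{..m}. Z x (t k) \<omega>) * P (t (Suc m) - t m) f (Z x (t m) \<omega>) \<partial>M)"
proof -
  have t0: "0 \<le> t k" for k using t monoD[OF t(1), of 0 k] by simp
  have t_mono: "t k \<le> t (Suc k)" for k using monoD[OF t(1), of k "Suc k"] by simp
  let ?path = "\<lambda>\<omega>. \<lambda>k\<in>{..m}. Z x (t k) \<omega>"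
  define \<Delta> where "\<Delta> k \<omega> = vsub d (X (t (Suc k)) \<omega>) (X (t k) \<omega>)" for k \<omega>
  have [measurable]: "\<Delta> k \<in> measurable M (Rd_borel d)" for k unfolding \<Delta>_def by measurable
  \<comment> \<open>The position at time \<open>t k\<close>, rebuilt from the first k increments; it
    makes \<open>F\<close> a function of past and last increment separately.\<close>
  define pos where "pos k w = (\<lambda>i\<in>{..<d}. x i + (\<Sum>j<k. w j i))" for k :: nat and w :: "nat \<Rightarrow> vec"
  have pos_Suc: "pos (Suc k) w = vadd d (pos k w) (w k)" for k w
    by (auto simp: pos_def vadd_def add.assoc)
  have pos_eq: "pos k w = Z x (t k) \<omega>"
    if "\<omega> \<in> space M" "\<And>j. j < k \<Longrightarrow> w j = \<Delta> j \<omega>" for k w \<omega>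
    using that(2)
  proof (induction k)
    case 0
    then show ?case using vadd_X_0[OF that(1) x] x t
      by (auto simp: pos_def Rd_def PiE_def extensional_def)
  next
    case (Suc k)
    then show ?case
      by (simp add: pos_Suc \<Delta>_def vadd_assoc vadd_vsub)
  qed
  let ?N = "Pi\<^sub>M {..<m} (\<lambda>_. Rd_borel d)" and ?T = "Pi\<^sub>M {m} (\<lambda>_. Rd_borel d)"
  let ?past = "\<lambda>\<omega>. restrict (\<lambda>k. \<Delta> k \<omega>) {..<m}" and ?last = "\<lambda>\<omega>. restrict (\<lambda>k. \<Delta> k \<omega>) {m}"
  have pos_meas: "pos k \<in> measurable ?N (Rd_borel d)" if "k \<le> m" for k
    unfolding pos_def
  proof (intro measurable_restrict borel_measurable_add borel_measurable_sum measurable_const)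
    fix i j assume "i \<in> {..<d}" "j \<in> {..<k}"
    then show "(\<lambda>w. w j i) \<in> borel_measurable ?N"
      using that by (intro measurable_compose[where f = "\<lambda>w. w j" and g = "\<lambda>v. v i" and N = "Rd_borel d"]
          measurable_component_singleton) auto
  qed simp
  define F where "F p = G (\<lambda>k\<in>{..m}. pos k (fst p)) * f (vadd d (pos m (fst p)) (snd p m))"
    for p :: "(nat \<Rightarrow> vec) \<times> (nat \<Rightarrow> vec)"
  have [measurable]: "(\<lambda>p. \<lambda>k\<in>{..m}. pos k (fst p)) \<in> measurable (?N \<Otimes>\<^sub>M ?T) (Pi\<^sub>M {..m} (\<lambda>_. Rd_borel d))"
    by (intro measurable_restrict measurable_compose[OF measurable_fst pos_meas]) auto
  have [measurable]: "(\<lambda>p. pos m (fst p)) \<in> measurable (?N \<Otimes>\<^sub>M ?T) (Rd_borel d)"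
    by (intro measurable_compose[OF measurable_fst pos_meas]) auto
  have [measurable]: "(\<lambda>p. snd p m) \<in> measurable (?N \<Otimes>\<^sub>M ?T) (Rd_borel d)"
    by (intro measurable_compose[OF measurable_snd measurable_component_singleton]) auto
  have F: "F \<in> borel_measurable (?N \<Otimes>\<^sub>M ?T)"
    unfolding F_def by measurable
  have ind: "indep_var ?N ?past ?T ?last"
    using indep_X_increments[of t "Suc m"] t
    by (intro indep_var_restrict[where I = "{..<Suc m}"]) (auto simp: \<Delta>_def)
  have "(\<integral>\<^sup>+\<omega>. G (?path \<omega>) * f (Z x (t (Suc m)) \<omega>) \<partial>M) =
      (\<integral>\<^sup>+\<omega>. F (?past \<omega>, ?last \<omega>) \<partial>M)"
  proof (rule nn_integral_cong)
    fix \<omega> assume \<omega>: "\<omega> \<in> space M"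
    have 1: "(\<lambda>k\<in>{..m}. pos k (?past \<omega>)) = (?path \<omega>)"
      by (intro restrict_ext pos_eq[OF \<omega>]) auto
    have 2: "pos m (?past \<omega>) = Z x (t m) \<omega>" by (intro pos_eq[OF \<omega>]) auto
    show "G (?path \<omega>) * f (Z x (t (Suc m)) \<omega>) = F (?past \<omega>, ?last \<omega>)"
      unfolding F_def fst_conv snd_conv 1 2 by (simp add: \<Delta>_def vadd_assoc vadd_vsub)
  qed
  also have "\<dots> = (\<integral>\<^sup>+\<omega>'. \<integral>\<^sup>+\<omega>. F (?past \<omega>', ?last \<omega>) \<partial>M \<partial>M)"
  proof (rule nn_integral_indep_pair[OF _ _ _ F])
    fix A C assume AC: "A \<in> sets ?N" "C \<in> sets ?T"
    have "(\<lambda>\<omega>. (?past \<omega>, ?last \<omega>)) -` (A \<times> C) \<inter> space M = (?past -` A \<inter> space M) \<inter> (?last -` C \<inter> space M)"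
      by auto
    with indep_varD[OF ind AC]
    show "prob ((?past -` A \<inter> space M) \<inter> (?last -` C \<inter> space M)) =
        prob (?past -` A \<inter> space M) * prob (?last -` C \<inter> space M)" by simp
  qed (auto intro!: measurable_restrict)
  also have "\<dots> = (\<integral>\<^sup>+\<omega>. G (?path \<omega>) * P (t (Suc m) - t m) f (Z x (t m) \<omega>) \<partial>M)"
  proof (rule nn_integral_cong)
    fix \<omega> assume \<omega>: "\<omega> \<in> space M"
    have 1: "(\<lambda>k\<in>{..m}. pos k (?past \<omega>)) = (?path \<omega>)"
      by (intro restrict_ext pos_eq[OF \<omega>]) auto
    have 2: "pos m (?past \<omega>) = Z x (t m) \<omega>" by (intro pos_eq[OF \<omega>]) auto
    define z where "z = Z x (t m) \<omega>"
    have z[measurable]: "z \<in> space (Rd_borel d)" unfolding space_Rd_borel z_def by simp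
    have "(\<integral>\<^sup>+\<omega>'. F (?past \<omega>, ?last \<omega>') \<partial>M) =
        (\<integral>\<^sup>+\<omega>'. G (?path \<omega>) * f (vadd d z (\<Delta> m \<omega>')) \<partial>M)"
      by (simp add: F_def 1 2 z_def)
    also have "\<dots> = G (?path \<omega>) * (\<integral>\<^sup>+\<omega>'. f (vadd d z (\<Delta> m \<omega>')) \<partial>M)"
      by (rule nn_integral_cmult) measurable
    also have "(\<integral>\<^sup>+\<omega>'. f (vadd d z (\<Delta> m \<omega>')) \<partial>M) = (\<integral>\<^sup>+y. f (vadd d z y) \<partial>distr M (Rd_borel d) (\<Delta> m))"
      by (subst nn_integral_distr) auto
    also have "distr M (Rd_borel d) (\<Delta> m) = distr M (Rd_borel d) (X (t (Suc m) - t m))"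
      unfolding \<Delta>_def by (rule distr_X_increment[OF t0 t_mono])
    also have "(\<integral>\<^sup>+y. f (vadd d z y) \<partial>distr M (Rd_borel d) (X (t (Suc m) - t m))) = P (t (Suc m) - t m) f z"
      unfolding P_def by (subst nn_integral_distr) auto
    finally show "(\<integral>\<^sup>+\<omega>'. F (?past \<omega>, ?last \<omega>') \<partial>M) =
        G (?path \<omega>) * P (t (Suc m) - t m) f (Z x (t m) \<omega>)"
      unfolding z_def .
  qed
  finally show ?thesis .
qed

lemma P_semigroup:
  assumes "0 \<le> s" "0 \<le> h" "x \<in> Rd d" and [measurable]: "f \<in> borel_measurable (Rd_borel d)"
  shows "P s (P h f) x = P (s + h) f x"
  using markov_step[of "\<lambda>k. if k = 0 then 0 else if k = 1 then s else s + h" x "\<lambda>_. 1" 1 f] assms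
  by (simp add: P_def mono_def)

lemma P_0: "x \<in> Rd d \<Longrightarrow> P 0 f x = f x"
proof -
  assume "x \<in> Rd d"
  then have "P 0 f x = (\<integral>\<^sup>+\<omega>. f x \<partial>M)"
    unfolding P_def by (intro nn_integral_cong) (simp add: vadd_X_0)
  then show ?thesis by (simp add: emeasure_space_1)
qed

lemma P_mono: "(\<And>y. y \<in> Rd d \<Longrightarrow> f y \<le> g y) \<Longrightarrow> P s f x \<le> P s g x"
  unfolding P_def by (intro nn_integral_mono) auto

lemma P_const: "P s (\<lambda>_. c) x = c"
  unfolding P_def by (simp add: emeasure_space_1)

lemma P_cmult:
  assumes [measurable]: "f \<in> borel_measurable (Rd_borel d)" and "x \<in> Rd d"
  shows "P s (\<lambda>y. c * f y) x = c * P s f x"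
proof -
  have [measurable]: "x \<in> space (Rd_borel d)" using assms by (simp add: space_Rd_borel)
  show ?thesis unfolding P_def by (rule nn_integral_cmult) measurable
qed

lemma P_add:
  assumes [measurable]: "f \<in> borel_measurable (Rd_borel d)" "g \<in> borel_measurable (Rd_borel d)" and "x \<in> Rd d"
  shows "P s (\<lambda>y. f y + g y) x = P s f x + P s g x"
proof -
  have [measurable]: "x \<in> space (Rd_borel d)" using assms by (simp add: space_Rd_borel)
  show ?thesis unfolding P_def by (rule nn_integral_add) measurable
qed

text \<open>The grid is peeled from its last time: \<open>markov_step\<close> absorbs the last
  factor into the terminal function, which is why \<open>w\<close> stays arbitrary in the induction.
  The result turns a path expectation into an iterated operator.\<close>

lemma nn_integral_prod_grid:
  fixes h u :: real
  assumes "0 \<le> h" "0 \<le> u" and x: "x \<in> Rd d"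
    and q[measurable]: "q \<in> borel_measurable (Rd_borel d)" and "w \<in> borel_measurable (Rd_borel d)"
  shows "(\<integral>\<^sup>+\<omega>. (\<Prod>k\<le>m. q (Z x (u + real k * h) \<omega>)) * w (Z x (u + real m * h) \<omega>) \<partial>M) =
    P u (\<lambda>y. q y * ((\<lambda>v. P h (\<lambda>z. q z * v z)) ^^ m) w y) x"
  using assms(5)
proof (induction m arbitrary: w)
  case 0
  then show ?case by (simp add: P_def)
next
  case (Suc m)
  note [measurable] = Suc.prems
  \<comment> \<open>The sample times are shifted by one index to make room for
    \<open>t 0 = 0\<close>, as required by \<open>markov_step\<close>; the offset u sits in the
    first step.\<close>
  define t where "t k = (if k = 0 then 0 else u + real (k - 1) * h)" for k :: nat
  have "mono t"
  proof (rule monoI)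
    fix i j :: nat assume "i \<le> j"
    then have "real (i - 1) * h \<le> real (j - 1) * h" using assms by (intro mult_right_mono) auto
    then show "t i \<le> t j" using \<open>i \<le> j\<close> assms by (auto simp: t_def)
  qed
  define G where "G z = (\<Prod>k\<le>m. q (z (Suc k)))" for z :: "nat \<Rightarrow> vec"
  have G: "G \<in> borel_measurable (Pi\<^sub>M {..Suc m} (\<lambda>_. Rd_borel d))"
    unfolding G_def by (intro borel_measurable_prod_ennreal 
      measurable_compose[where f = "\<lambda>z. z (Suc k)" and g = q and N = "Rd_borel d" for k]
      measurable_component_singleton q) auto
  have t_Suc: "t (Suc k) = u + real k * h" for k by (simp add: t_def)
  have t_diff: "t (Suc (Suc m)) - t (Suc m) = h" by (simp add: t_def algebra_simps)
  have "(\<integral>\<^sup>+\<omega>. (\<Prod>k\<le>Suc m. q (Z x (u + real k * h) \<omega>)) * w (Z x (u + real (Suc m) * h) \<omega>) \<partial>M) =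
      (\<integral>\<^sup>+\<omega>. G (\<lambda>k\<in>{..Suc m}. Z x (t k) \<omega>) *
        (q (Z x (t (Suc (Suc m))) \<omega>) * w (Z x (t (Suc (Suc m))) \<omega>)) \<partial>M)"
    unfolding G_def by (intro nn_integral_cong) (simp add: t_Suc mult.assoc)
  also have "\<dots> = (\<integral>\<^sup>+\<omega>. G (\<lambda>k\<in>{..Suc m}. Z x (t k) \<omega>) *
        P (t (Suc (Suc m)) - t (Suc m)) (\<lambda>z. q z * w z) (Z x (t (Suc m)) \<omega>) \<partial>M)"
    by (rule markov_step[OF \<open>mono t\<close> _ x G]) (auto simp: t_def)
  also have "\<dots> = (\<integral>\<^sup>+\<omega>. (\<Prod>k\<le>m. q (Z x (u + real k * h) \<omega>)) *
      P h (\<lambda>z. q z * w z) (Z x (u + real m * h) \<omega>) \<partial>M)"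
    unfolding t_diff G_def by (intro nn_integral_cong) (simp add: t_Suc)
  also have "\<dots> = P u (\<lambda>y. q y * ((\<lambda>v. P h (\<lambda>z. q z * v z)) ^^ m) (P h (\<lambda>z. q z * w z)) y) x"
    by (rule Suc.IH) measurable
  finally show ?case by (simp only: funpow_Suc_right o_apply)
qed

end

section \<open>Gaussian kernels and moments of the subordinator\<close>

lemma PiM_density:
  assumes I: "finite I" and "product_sigma_finite N" "product_sigma_finite (\<lambda>i. density (N i) (f i))"
    and f[measurable]: "\<And>i. f i \<in> borel_measurable (N i)"
  shows "(\<Pi>\<^sub>M i\<in>I. density (N i) (f i)) = density (Pi\<^sub>M I N) (\<lambda>x. \<Prod>i\<in>I. f i (x i))"
proof -
  interpret N: product_sigma_finite N by fact
  interpret D: product_sigma_finite "\<lambda>i. density (N i) (f i)" by fact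
  have meas: "(\<lambda>x. \<Prod>i\<in>I. f i (x i)) \<in> borel_measurable (Pi\<^sub>M I N)"
  proof (rule borel_measurable_prod_ennreal)
    fix i assume "i \<in> I"
    then show "(\<lambda>x. f i (x i)) \<in> borel_measurable (Pi\<^sub>M I N)"
      by (rule measurable_compose[where f = "\<lambda>x. x i", OF measurable_component_singleton f])
  qed
  show ?thesis
  proof (rule D.PiM_eqI[symmetric, OF I])
    show "sets (density (Pi\<^sub>M I N) (\<lambda>x. \<Prod>i\<in>I. f i (x i))) = sets (\<Pi>\<^sub>M i\<in>I. density (N i) (f i))"
      by (simp cong: sets_PiM_cong)
    fix A assume "\<And>i. i \<in> I \<Longrightarrow> A i \<in> sets (density (N i) (f i))"
    then have A[measurable]: "A i \<in> sets (N i)" if "i \<in> I" for i using that by auto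
    have "emeasure (density (Pi\<^sub>M I N) (\<lambda>x. \<Prod>i\<in>I. f i (x i))) (Pi\<^sub>E I A) =
        (\<integral>\<^sup>+x. (\<Prod>i\<in>I. f i (x i)) * indicator (Pi\<^sub>E I A) x \<partial>Pi\<^sub>M I N)"
      using A I by (intro emeasure_density meas sets_PiM_I_finite) auto
    also have "\<dots> = (\<integral>\<^sup>+x. (\<Prod>i\<in>I. f i (x i) * indicator (A i) (x i)) \<partial>Pi\<^sub>M I N)"
    proof (rule nn_integral_cong)
      fix x assume "x \<in> space (Pi\<^sub>M I N)"
      then have "(indicator (Pi\<^sub>E I A) x :: ennreal) = (\<Prod>i\<in>I. indicator (A i) (x i))"
        using I by (cases "x \<in> Pi\<^sub>E I A")
          (auto simp: space_PiM PiE_iff indicator_def intro!: prod_zero[symmetric])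
      then show "(\<Prod>i\<in>I. f i (x i)) * indicator (Pi\<^sub>E I A) x = (\<Prod>i\<in>I. f i (x i) * indicator (A i) (x i))"
        by (simp add: prod.distrib)
    qed
    also have "\<dots> = (\<Prod>i\<in>I. \<integral>\<^sup>+y. f i y * indicator (A i) y \<partial>N i)"
      using I A by (intro N.product_nn_integral_prod borel_measurable_times_ennreal borel_measurable_indicator) auto
    also have "\<dots> = (\<Prod>i\<in>I. emeasure (density (N i) (f i)) (A i))"
      using A by (intro prod.cong refl) (auto simp: emeasure_density)
    finally show "emeasure (density (Pi\<^sub>M I N) (\<lambda>x. \<Prod>i\<in>I. f i (x i))) (Pi\<^sub>E I A) =
        (\<Prod>i\<in>I. emeasure (density (N i) (f i)) (A i))" .
  qed
qed

abbreviation gauss1 :: "real \<Rightarrow> real \<Rightarrow> real measure" where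
  "gauss1 \<sigma> m \<equiv> density lborel (\<lambda>y. ennreal (normal_density m (sqrt (2 * \<sigma>)) y))"

text \<open>The law of x plus the Brownian vector at time \<sigma>. The standard deviation is sqrt
  (2 \<sigma>), because the motion runs at double speed.\<close>

definition gauss :: "nat \<Rightarrow> real \<Rightarrow> vec \<Rightarrow> vec measure" where
  "gauss d \<sigma> x = (\<Pi>\<^sub>M i\<in>{..<d}. gauss1 \<sigma> (x i))"

lemma prob_space_normal:
  "0 < \<sigma> \<Longrightarrow> prob_space (gauss1 \<sigma> m)"
  by (intro prob_space_normal_density) auto

lemma product_sigma_finite_normal:
  "0 < \<sigma> \<Longrightarrow> product_sigma_finite (\<lambda>i. gauss1 \<sigma> (m i))"
  unfolding product_sigma_finite_def
  using prob_space_normal by (meson prob_space_imp_sigma_finite)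

lemma sets_gauss[measurable_cong]: "sets (gauss d \<sigma> x) = sets (Rd_borel d)"
  unfolding gauss_def by (intro sets_PiM_cong) auto

lemma space_gauss: "space (gauss d \<sigma> x) = Rd d"
  using sets_eq_imp_space_eq[OF sets_gauss] space_Rd_borel by simp

lemma prob_space_gauss: "0 < \<sigma> \<Longrightarrow> prob_space (gauss d \<sigma> x)"
  unfolding gauss_def by (intro prob_space_PiM prob_space_normal)

lemma gauss_density:
  assumes "0 < \<sigma>"
  shows "gauss d \<sigma> x = density (Rd_lborel d) (\<lambda>y. \<Prod>i<d. ennreal (normal_density (x i) (sqrt (2 * \<sigma>)) (y i)))"
  unfolding gauss_def Rd_lborel_def
  by (intro PiM_density product_sigma_finite_normal assms)
    (auto simp: product_sigma_finite_def intro: lborel.sigma_finite_measure_axioms)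

text \<open>The density never exceeds its peak, which is (4 \<pi> \<sigma>)^(-1/2) in each
  coordinate.\<close>

lemma gauss_le:
  assumes "0 < \<sigma>" and [measurable]: "f \<in> borel_measurable (Rd_borel d)"
  shows "(\<integral>\<^sup>+y. f y \<partial>gauss d \<sigma> x) \<le> ennreal ((4 * pi * \<sigma>) powr (- real d / 2)) * (\<integral>\<^sup>+y. f y \<partial>Rd_lborel d)"
proof -
  define K where "K = 1 / sqrt (4 * pi * \<sigma>)"
  have K: "0 \<le> K" "K ^ d = (4 * pi * \<sigma>) powr (- real d / 2)"
    using assms(1)
    by (auto simp: K_def powr_minus_divide powr_half_sqrt[symmetric] power_divide powr_powr powr_realpow[symmetric])
  have le: "normal_density m (sqrt (2 * \<sigma>)) z \<le> K" for m z
    using assms(1) by (auto simp: normal_density_def K_def mult.assoc divide_right_mono)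
  have meas: "(\<lambda>y. \<Prod>i<d. ennreal (normal_density (x i) (sqrt (2 * \<sigma>)) (y i))) \<in> borel_measurable (Rd_borel d)"
    by (intro borel_measurable_prod_ennreal measurable_compose[OF measurable_component_singleton]) auto
  have "(\<integral>\<^sup>+y. f y \<partial>gauss d \<sigma> x) = (\<integral>\<^sup>+y. (\<Prod>i<d. ennreal (normal_density (x i) (sqrt (2 * \<sigma>)) (y i))) * f y \<partial>Rd_lborel d)"
    unfolding gauss_density[OF assms(1)] using meas
    by (intro nn_integral_density) (simp_all cong: measurable_cong_sets add: sets_Rd_lborel)
  also have "\<dots> \<le> (\<integral>\<^sup>+y. ennreal (K ^ d) * f y \<partial>Rd_lborel d)"
  proof (intro nn_integral_mono mult_right_mono)
    fix y :: vec
    have "(\<Prod>i<d. normal_density (x i) (sqrt (2 * \<sigma>)) (y i)) \<le> (\<Prod>i<d. K)"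
      by (intro prod_mono) (auto intro: le)
    then show "(\<Prod>i<d. ennreal (normal_density (x i) (sqrt (2 * \<sigma>)) (y i))) \<le> ennreal (K ^ d)"
      by (simp add: prod_ennreal ennreal_leI)
  qed auto
  also have "\<dots> = ennreal (K ^ d) * (\<integral>\<^sup>+y. f y \<partial>Rd_lborel d)"
    by (intro nn_integral_cmult) (simp cong: measurable_cong_sets add: sets_Rd_lborel)
  finally show ?thesis unfolding K(2) .
qed

section \<open>Negative moments of the subordinator\<close>

lemma exp_minus_le_powr:
  fixes z k :: real
  assumes "0 < z" "0 < k"
  shows "exp (- z) \<le> (k / z) powr k"
proof -
  have "z / k \<le> exp (z / k)" using exp_ge_add_one_self[of "z / k"] by linarith
  then have "(z / k) powr k \<le> exp (z / k) powr k" using assms by (intro powr_mono2) auto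
  also have "\<dots> = exp z" using assms by (simp add: powr_def)
  finally have "inverse (exp z) \<le> inverse ((z / k) powr k)"
    using assms by (intro le_imp_inverse_le) auto
  also have "inverse ((z / k) powr k) = (k / z) powr k"
    using assms by (simp add: powr_divide)
  finally show ?thesis by (simp add: exp_minus)
qed

text \<open>\<sigma>^(-a) is the integral of a u^(a-1) over u from 0 to 1/\<sigma>, and on that
  range 1 \<le> e exp(-u \<sigma>). The part below u0 contributes u0^a and is split off, because a
  lower bound on the Laplace exponent will be available for large u only.\<close>

lemma negative_moment_le:
  fixes \<sigma> a u0 :: real
  assumes "0 < \<sigma>" "0 < a" "0 < u0"
  shows "ennreal (\<sigma> powr (- a)) \<le>
    ennreal (u0 powr a) + ennreal (exp 1 * a) * (\<integral>\<^sup>+u. ennreal (u powr (a - 1) * exp (- u * \<sigma>)) * indicator {u0..} u \<partial>lborel)"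
proof (cases "1 / \<sigma> \<le> u0")
  case True
  have "\<sigma> powr (- a) = (1 / \<sigma>) powr a" using assms by (simp add: powr_minus_divide powr_divide)
  also have "\<dots> \<le> u0 powr a" using assms True by (intro powr_mono2) auto
  finally have "ennreal (\<sigma> powr (- a)) \<le> ennreal (u0 powr a)" by (rule ennreal_leI)
  then show ?thesis by (rule order.trans) simp
next
  case False
  have "DERIV (\<lambda>u. u powr a) u :> a * u powr (a - 1)" if "u \<in> {u0..1 / \<sigma>}" for u
    using that assms(3) by (intro has_real_derivative_powr) simp
  then have "(\<integral>\<^sup>+u. ennreal (a * u powr (a - 1)) * indicator {u0..1 / \<sigma>} u \<partial>lborel) =
      ennreal ((1 / \<sigma>) powr a - u0 powr a)"
    using assms False by (intro nn_integral_FTC_Icc) auto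
  moreover have "(1 / \<sigma>) powr a = \<sigma> powr (- a)"
    using assms by (simp add: powr_minus_divide powr_divide)
  moreover have "(\<integral>\<^sup>+u. ennreal (a * u powr (a - 1)) * indicator {u0..1 / \<sigma>} u \<partial>lborel) \<le>
      (\<integral>\<^sup>+u. ennreal (exp 1 * a) * (ennreal (u powr (a - 1) * exp (- u * \<sigma>)) * indicator {u0..} u) \<partial>lborel)"
  proof (intro nn_integral_mono)
    fix u :: real
    show "ennreal (a * u powr (a - 1)) * indicator {u0..1 / \<sigma>} u \<le>
        ennreal (exp 1 * a) * (ennreal (u powr (a - 1) * exp (- u * \<sigma>)) * indicator {u0..} u)"
    proof (cases "u \<in> {u0..1 / \<sigma>}")
      case True
      then have "u * \<sigma> \<le> 1" using assms by (auto simp: field_simps)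
      then have "1 \<le> exp 1 * exp (- u * \<sigma>)" by (simp flip: exp_add)
      then have "a * u powr (a - 1) * 1 \<le> a * u powr (a - 1) * (exp 1 * exp (- u * \<sigma>))"
        using assms by (intro mult_left_mono) auto
      then show ?thesis using True assms
        by (auto simp: ennreal_mult[symmetric] mult_ac intro!: ennreal_leI)
    qed auto
  qed
  moreover have "\<dots> = ennreal (exp 1 * a) * (\<integral>\<^sup>+u. ennreal (u powr (a - 1) * exp (- u * \<sigma>)) * indicator {u0..} u \<partial>lborel)"
    by (intro nn_integral_cmult) measurable
  moreover have "ennreal (\<sigma> powr (- a)) = ennreal (u0 powr a) + ennreal (\<sigma> powr (- a) - u0 powr a)"
  proof -
    have "u0 powr a \<le> (1 / \<sigma>) powr a" using assms False by (intro powr_mono2) auto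
    then show ?thesis using calculation(2) by (subst ennreal_plus[symmetric]) auto
  qed
  ultimately show ?thesis by (simp add: add_left_mono)
qed

context subordinate_brownian
begin

lemma nn_integral_vadd_Bv:
  assumes "0 < \<sigma>" "x \<in> Rd d" and [measurable]: "f \<in> borel_measurable (Rd_borel d)"
  shows "(\<integral>\<^sup>+\<omega>. f (vadd d x (Bv \<sigma> \<omega>)) \<partial>M) = (\<integral>\<^sup>+y. f y \<partial>gauss d \<sigma> x)"
proof -
  have "{..<d} \<noteq> {}" using dim_pos by (auto simp: lessThan_empty_iff)
  have [measurable]: "x \<in> space (Rd_borel d)" using assms by (simp add: space_Rd_borel)
  have dist: "distributed M lborel (\<lambda>\<omega>. x i + B i \<sigma> \<omega>) (normal_density (x i) (sqrt (2 * \<sigma>)))" if "i < d" for i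
  proof -
    have "distributed M lborel (\<lambda>\<omega>. B i \<sigma> \<omega> - B i 0 \<omega>) (normal_density 0 (sqrt (2 * (\<sigma> - 0))))"
      using brownian1[OF that] assms(1) unfolding brownian1_def by blast
    from normal_density_affine[OF this, of 1 "x i"]
    have *: "distributed M lborel (\<lambda>\<omega>. x i + (B i \<sigma> \<omega> - B i 0 \<omega>)) (normal_density (x i) (sqrt (2 * \<sigma>)))"
      using assms(1) by simp
    have "distr M lborel (\<lambda>\<omega>. x i + (B i \<sigma> \<omega> - B i 0 \<omega>)) = distr M lborel (\<lambda>\<omega>. x i + B i \<sigma> \<omega>)"
      by (intro distr_cong) (auto simp: B_0 that)
    with * show ?thesis
      using B_measurable[OF that, of \<sigma>] assms(1) by (auto simp: distributed_def)
  qed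
  have "distr M (Rd_borel d) (\<lambda>\<omega>. vadd d x (Bv \<sigma> \<omega>)) = distr M (Rd_borel d) (\<lambda>\<omega>. \<lambda>i\<in>{..<d}. x i + B i \<sigma> \<omega>)"
    using assms(1) by (intro distr_cong) (auto simp: vadd_def Bv_def)
  also have "\<dots> = (\<Pi>\<^sub>M i\<in>{..<d}. distr M borel (\<lambda>\<omega>. x i + B i \<sigma> \<omega>))"
  proof (rule indep_vars_iff_distr_eq_PiM'[THEN iffD1, OF \<open>{..<d} \<noteq> {}\<close>])
    have "indep_vars (\<lambda>_. borel) (\<lambda>i \<omega>. x i + (B i \<sigma> \<omega> - B i 0 \<omega>)) {..<d}"
      by (rule indep_vars_compose2[OF indep_coordinate_increments[of 0 \<sigma>]]) (use assms in auto)
    also have "?this \<longleftrightarrow> indep_vars (\<lambda>_. borel) (\<lambda>i \<omega>. x i + (Bpath i \<omega> \<sigma> - Bpath i \<omega> 0)) {..<d}"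
      using assms by (simp add: Bpath_def)
    finally show "indep_vars (\<lambda>_. borel) (\<lambda>i \<omega>. x i + B i \<sigma> \<omega>) {..<d}"
      using indep_vars_compose2[OF indep_paths, where Y = "\<lambda>i w. x i + w \<sigma>" and N = "\<lambda>_. borel"] assms
      by (simp add: Bpath_def borel_measurable_add measurable_component_singleton)
  qed (use assms in \<open>auto intro!: borel_measurable_add B_measurable\<close>)
  also have "\<dots> = gauss d \<sigma> x"
    unfolding gauss_def
  proof (rule PiM_cong[OF refl])
    fix i assume "i \<in> {..<d}"
    have "distr M borel (\<lambda>\<omega>. x i + B i \<sigma> \<omega>) = distr M lborel (\<lambda>\<omega>. x i + B i \<sigma> \<omega>)"
      by (rule distr_cong) auto
    then show "distr M borel (\<lambda>\<omega>. x i + B i \<sigma> \<omega>) = gauss1 \<sigma> (x i)"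
      using dist[of i] \<open>i \<in> {..<d}\<close> by (simp add: distributed_distr_eq_density)
  qed
  finally have law: "distr M (Rd_borel d) (\<lambda>\<omega>. vadd d x (Bv \<sigma> \<omega>)) = gauss d \<sigma> x" .
  show ?thesis unfolding law[symmetric] by (simp add: nn_integral_distr)
qed

lemma laplace_S:
  assumes "0 \<le> t" "0 < u"
  shows "(\<integral>\<^sup>+\<omega>. ennreal (exp (- u * S t \<omega>)) \<partial>M) = ennreal (exp (- t * \<Psi> u))"
proof -
  note [measurable] = S_measurable[OF assms(1)]
  have "integrable M (\<lambda>\<omega>. exp (- u * S t \<omega>))"
    using S_nonneg[OF _ assms(1)] assms(2) by (intro integrable_const_bound[where B = 1]) auto
  then have "(\<integral>\<^sup>+\<omega>. ennreal (exp (- u * S t \<omega>)) \<partial>M) = ennreal (\<integral>\<omega>. exp (- u * S t \<omega>) \<partial>M)"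
    by (intro nn_integral_eq_integral) auto
  then show ?thesis using subordinator assms by (auto simp: subordinator_def)
qed

text \<open>Read off from the Laplace transform of \<open>S 1\<close>, which decreases in u.\<close>

lemma \<Psi>_mono:
  assumes "0 < u" "u \<le> v"
  shows "\<Psi> u \<le> \<Psi> v"
proof -
  have "(\<integral>\<^sup>+\<omega>. ennreal (exp (- v * S 1 \<omega>)) \<partial>M) \<le> (\<integral>\<^sup>+\<omega>. ennreal (exp (- u * S 1 \<omega>)) \<partial>M)"
    using assms S_nonneg[of _ 1] by (auto intro!: nn_integral_mono ennreal_leI mult_right_mono)
  then show ?thesis using assms laplace_S[of 1 u] laplace_S[of 1 v] by simp
qed

text \<open>A zero of the exponent forces 1 - exp(-u S_1), which is nonnegative, to have mean 0.
  Then S_1 = 0 almost surely and the exponent vanishes everywhere.\<close>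

lemma \<Psi>_pos:
  assumes "0 < u0" "\<Psi> u0 \<noteq> 0" "0 < u"
  shows "0 < \<Psi> u"
proof (rule ccontr)
  assume "\<not> 0 < \<Psi> u"
  note [measurable] = S_measurable[of 1]
  have int: "integrable M (\<lambda>\<omega>. exp (- u * S 1 \<omega>))"
    using S_nonneg[of _ 1] assms(3) by (intro integrable_const_bound[where B = 1]) auto
  have "(\<integral>\<omega>. exp (- u * S 1 \<omega>) \<partial>M) = exp (- \<Psi> u)"
    using subordinator assms(3) by (auto simp: subordinator_def)
  then have "(\<integral>\<omega>. 1 - exp (- u * S 1 \<omega>) \<partial>M) = 1 - exp (- \<Psi> u)"
    using int by (simp add: prob_space)
  moreover have "0 \<le> (\<integral>\<omega>. 1 - exp (- u * S 1 \<omega>) \<partial>M)"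
    using S_nonneg[of _ 1] assms(3) by (intro integral_nonneg_AE) auto
  ultimately have "(\<integral>\<omega>. 1 - exp (- u * S 1 \<omega>) \<partial>M) = 0"
    using \<open>\<not> 0 < \<Psi> u\<close> by simp
  then have "AE \<omega> in M. 1 - exp (- u * S 1 \<omega>) = 0"
    using int S_nonneg[of _ 1] assms(3) by (subst (asm) integral_nonneg_eq_0_iff_AE) auto
  then have "AE \<omega> in M. S 1 \<omega> = 0" using assms(3) by auto
  then have "(\<integral>\<omega>. exp (- u0 * S 1 \<omega>) \<partial>M) = (\<integral>\<omega>. 1 \<partial>M)"
    by (intro integral_cong_AE) auto
  moreover have "(\<integral>\<omega>. exp (- u0 * S 1 \<omega>) \<partial>M) = exp (- \<Psi> u0)"
    using subordinator assms(1) by (auto simp: subordinator_def)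
  ultimately show False using assms(2) by (simp add: prob_space)
qed

text \<open>The event S_s = 0 has probability at most E[exp(-u S_s)] for every u, and the growth of
  \<Psi> sends this to 0 as u tends to infinity.\<close>

lemma AE_S_pos:
  assumes "0 < s" "0 < b" "0 < \<mu>" and low: "\<And>u. u1 \<le> u \<Longrightarrow> b * u powr \<mu> \<le> \<Psi> u"
  shows "AE \<omega> in M. 0 < S s \<omega>"
proof -
  note [measurable] = S_measurable[of s]
  have s: "0 \<le> s" using assms by simp
  have le: "emeasure M {\<omega> \<in> space M. S s \<omega> = 0} \<le> ennreal (exp (- s * (b * u powr \<mu>)))"
    if "0 < u" "u1 \<le> u" for u
  proof -
    have "emeasure M {\<omega> \<in> space M. S s \<omega> = 0} = (\<integral>\<^sup>+\<omega>. indicator {\<omega> \<in> space M. S s \<omega> = 0} \<omega> \<partial>M)"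
      using s by (intro nn_integral_indicator[symmetric]) measurable
    also have "\<dots> \<le> (\<integral>\<^sup>+\<omega>. ennreal (exp (- u * S s \<omega>)) \<partial>M)"
      by (intro nn_integral_mono) (auto split: split_indicator)
    also have "\<dots> = ennreal (exp (- s * \<Psi> u))" by (rule laplace_S[OF s that(1)])
    also have "\<dots> \<le> ennreal (exp (- s * (b * u powr \<mu>)))"
      using low[OF that(2)] assms by (intro ennreal_leI) auto
    finally show ?thesis .
  qed
  have "((\<lambda>u. exp (- s * (b * u powr \<mu>))) \<longlongrightarrow> 0) at_top"
    using assms by real_asymp
  then have "((\<lambda>u. ennreal (exp (- s * (b * u powr \<mu>)))) \<longlongrightarrow> ennreal 0) at_top"
    by (rule tendsto_ennrealI)
  then have "emeasure M {\<omega> \<in> space M. S s \<omega> = 0} \<le> ennreal 0"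
  proof (rule tendsto_lowerbound)
    show "\<forall>\<^sub>F u in at_top. emeasure M {\<omega> \<in> space M. S s \<omega> = 0} \<le> ennreal (exp (- s * (b * u powr \<mu>)))"
      using eventually_gt_at_top[of 0] eventually_ge_at_top[of u1] by eventually_elim (rule le)
  qed simp
  then have "AE \<omega> in M. S s \<omega> \<noteq> 0"
    using s by (intro AE_I[where N = "{\<omega> \<in> space M. S s \<omega> = 0}"]) auto
  then show ?thesis using S_nonneg[OF _ s] by (auto elim!: AE_mp intro!: AE_I2 simp: order_less_le)
qed

text \<open>\<open>negative_moment_le\<close> is integrated over \<Omega> and Tonelli brings in the
  Laplace transform. The exponent k is chosen so that u^(a-1) (u^\<mu>)^(-k) = u^(-2), which is
  integrable at infinity.\<close>

lemma negative_moment_S: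
  fixes a \<mu> b s :: real
  defines "k \<equiv> (a + 1) / \<mu>"
  assumes "0 < s" "0 < b" "0 < \<mu>" "0 < a"
    and low: "\<And>u. s powr (- 1 / \<mu>) \<le> u \<Longrightarrow> b * u powr \<mu> \<le> \<Psi> u"
  shows "(\<integral>\<^sup>+\<omega>. ennreal (S s \<omega> powr (- a)) \<partial>M) \<le> ennreal ((1 + exp 1 * a * (k / b) powr k) * s powr (- a / \<mu>))"
proof -
  note [measurable] = S_measurable[of s]
  have s: "0 \<le> s" using assms by simp
  \<comment> \<open>The natural cutoff for time s: both u0^a and s^(-k) / u0 are then multiples of
    s^(-a/\<mu>).\<close>
  define u0 where "u0 = s powr (- 1 / \<mu>)"
  let ?g = "\<lambda>u \<omega>. ennreal (u powr (a - 1) * exp (- u * S s \<omega>)) * indicator {u0..} u"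
  have u0: "0 < u0" using assms by (simp add: u0_def)
  have k: "0 < k" "k * \<mu> = a + 1" using assms by (auto simp: k_def)
  interpret pair_sigma_finite M lborel by unfold_locales
  have ms: "(\<lambda>\<omega>. S s \<omega>) \<in> borel_measurable M" using s by measurable
  have "(\<integral>\<^sup>+\<omega>. \<integral>\<^sup>+u. ?g u \<omega> \<partial>lborel \<partial>M) =
      (\<integral>\<^sup>+u. \<integral>\<^sup>+\<omega>. ?g u \<omega> \<partial>M \<partial>lborel)"
  proof (rule Fubini'[symmetric])
    show "(\<lambda>(\<omega>, u). ?g u \<omega>) \<in> borel_measurable (M \<Otimes>\<^sub>M lborel)"
      using measurable_compose[OF measurable_fst ms] by measurable
  qed
  also have "\<dots> \<le> (\<integral>\<^sup>+u. ennreal ((k / (s * b)) powr k * (1 / u\<^sup>2)) * indicator {u0..} u \<partial>lborel)"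
  proof (rule nn_integral_mono)
    fix u :: real
    show "(\<integral>\<^sup>+\<omega>. ?g u \<omega> \<partial>M) \<le>
        ennreal ((k / (s * b)) powr k * (1 / u\<^sup>2)) * indicator {u0..} u"
    proof (cases "u0 \<le> u")
      case True
      then have u: "0 < u" using u0 by simp
      have "(\<integral>\<^sup>+\<omega>. ?g u \<omega> \<partial>M) =
          ennreal (u powr (a - 1)) * (\<integral>\<^sup>+\<omega>. ennreal (exp (- u * S s \<omega>)) \<partial>M)"
        using True ms by (simp add: ennreal_mult nn_integral_cmult)
      also have "\<dots> = ennreal (u powr (a - 1) * exp (- s * \<Psi> u))"
        using laplace_S[OF s u] by (simp add: ennreal_mult)
      also have "\<dots> \<le> ennreal (u powr (a - 1) * ((k / (s * b * u powr \<mu>)) powr k))"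
      proof (intro ennreal_leI mult_left_mono)
        have "exp (- s * \<Psi> u) \<le> exp (- (s * b * u powr \<mu>))"
          using low[of u] True assms by (simp add: u0_def mult.assoc)
        also have "\<dots> \<le> (k / (s * b * u powr \<mu>)) powr k"
          using assms u k by (intro exp_minus_le_powr) auto
        finally show "exp (- s * \<Psi> u) \<le> (k / (s * b * u powr \<mu>)) powr k" .
      qed auto
      also have "u powr (a - 1) * ((k / (s * b * u powr \<mu>)) powr k) = (k / (s * b)) powr k * (1 / u\<^sup>2)"
      proof -
        have "(k / (s * b * u powr \<mu>)) powr k = (k / (s * b)) powr k / u powr (a + 1)"
          using assms k u by (simp add: powr_divide powr_mult powr_powr mult.commute[of \<mu> k])
        moreover have "u powr (a - 1) / u powr (a + 1) = 1 / u\<^sup>2"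
          using u by (simp add: powr_diff[symmetric] powr_minus_divide)
        ultimately show ?thesis by (metis (no_types, lifting) mult.commute times_divide_eq_right times_divide_times_eq)
      qed
      finally show ?thesis using True by simp
    qed simp
  qed
  also have "\<dots> = ennreal ((k / (s * b)) powr k) * (\<integral>\<^sup>+u. ennreal (1 / u\<^sup>2) * indicator {u0..} u \<partial>lborel)"
    by (subst nn_integral_cmult[symmetric])
      (auto simp: ennreal_mult'[symmetric] mult.assoc[symmetric] intro!: nn_integral_cong)
  also have "(\<integral>\<^sup>+u. ennreal (1 / u\<^sup>2) * indicator {u0..} u \<partial>lborel) = ennreal (0 - (- 1 / u0))"
  proof (rule nn_integral_FTC_atLeast)
    show "((\<lambda>u. - 1 / u) \<longlongrightarrow> (0::real)) at_top"
      by (rule tendsto_divide_0[OF tendsto_const filterlim_at_top_imp_at_infinity[OF filterlim_ident]])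
  qed (use u0 in \<open>auto intro!: derivative_eq_intros simp: power2_eq_square\<close>)
  finally have J: "(\<integral>\<^sup>+\<omega>. \<integral>\<^sup>+u. ?g u \<omega> \<partial>lborel \<partial>M) \<le>
      ennreal ((k / (s * b)) powr k) * ennreal (1 / u0)" by simp
  have "(\<integral>\<^sup>+\<omega>. ennreal (S s \<omega> powr (- a)) \<partial>M) \<le> (\<integral>\<^sup>+\<omega>. ennreal (u0 powr a) + ennreal (exp 1 * a) *
      (\<integral>\<^sup>+u. ?g u \<omega> \<partial>lborel) \<partial>M)"
  proof (rule nn_integral_mono_AE)
    have "AE \<omega> in M. 0 < S s \<omega>" by (rule AE_S_pos[OF assms(2-4) low])
    then show "AE \<omega> in M. ennreal (S s \<omega> powr (- a)) \<le> ennreal (u0 powr a) + ennreal (exp 1 * a) *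
        (\<integral>\<^sup>+u. ?g u \<omega> \<partial>lborel)"
      by eventually_elim (rule negative_moment_le[OF _ assms(5) u0])
  qed
  also have "\<dots> = ennreal (u0 powr a) + ennreal (exp 1 * a) *
      (\<integral>\<^sup>+\<omega>. \<integral>\<^sup>+u. ?g u \<omega> \<partial>lborel \<partial>M)"
    using ms by (simp add: nn_integral_add nn_integral_cmult emeasure_space_1)
  also have "\<dots> \<le> ennreal (u0 powr a) + ennreal (exp 1 * a) * (ennreal ((k / (s * b)) powr k) * ennreal (1 / u0))"
    by (intro add_left_mono mult_left_mono J) simp
  also have "\<dots> = ennreal (u0 powr a + exp 1 * a * ((k / (s * b)) powr k * (1 / u0)))"
  proof -
    have "0 \<le> exp 1 * a" "0 \<le> 1 / u0" using assms u0 by auto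
    then show ?thesis
      by (simp only: ennreal_mult[symmetric] ennreal_plus[symmetric] mult_nonneg_nonneg powr_ge_zero)
  qed
  also have "u0 powr a = s powr (- a / \<mu>)"
    using assms by (simp add: u0_def powr_powr)
  also have "(k / (s * b)) powr k * (1 / u0) = (k / b) powr k * s powr (- a / \<mu>)"
  proof -
    have "(k / (s * b)) powr k * (1 / u0) = (k / b) powr k * (s powr (- k) * s powr (1 / \<mu>))"
      using assms k by (simp add: u0_def powr_divide powr_mult powr_minus_divide)
    also have "s powr (- k) * s powr (1 / \<mu>) = s powr (- a / \<mu>)"
      using assms by (simp add: powr_add[symmetric] k_def field_simps)
    finally show ?thesis .
  qed
  finally show ?thesis by (simp add: algebra_simps)
qed

end

section \<open>Leaving a convex set\<close>

lemma distr_reflect_normal: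
  assumes "0 < \<sigma>"
  shows "distr (gauss1 \<sigma> m) borel (\<lambda>z. 2 * m - z) =
    gauss1 \<sigma> m" (is "distr ?N _ _ = ?N")
proof -
  interpret prob_space ?N by (rule prob_space_normal[OF assms])
  have "distributed ?N lborel (\<lambda>z. z) (normal_density m (sqrt (2 * \<sigma>)))"
    by (auto simp: distributed_def distr_id2)
  from normal_density_affine[OF this, of "-1" "2 * m"] assms
  have "distributed ?N lborel (\<lambda>z. 2 * m - z) (normal_density m (sqrt (2 * \<sigma>)))" by simp
  then have "distr ?N lborel (\<lambda>z. 2 * m - z) = ?N"
    by (simp add: distributed_distr_eq_density)
  moreover have "distr ?N lborel (\<lambda>z. 2 * m - z) = distr ?N borel (\<lambda>z. 2 * m - z)"
    by (rule distr_cong) auto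
  ultimately show ?thesis by simp
qed

lemma nn_integral_gauss_reflect:
  assumes "0 < \<sigma>" and [measurable]: "g \<in> borel_measurable (Rd_borel d)"
  shows "(\<integral>\<^sup>+z. g (\<lambda>i\<in>{..<d}. 2 * y i - z i) \<partial>gauss d \<sigma> y) = (\<integral>\<^sup>+z. g z \<partial>gauss d \<sigma> y)"
proof -
  let ?N = "\<lambda>i. gauss1 \<sigma> (y i)"
  let ?R = "\<lambda>z. \<lambda>i\<in>{..<d}. 2 * y i - z i"
  interpret N: product_sigma_finite ?N by (rule product_sigma_finite_normal[OF assms(1)])
  have R: "?R \<in> measurable (gauss d \<sigma> y) (Rd_borel d)"
  proof -
    have "?R \<in> measurable (Rd_borel d) (Rd_borel d)" by measurable
    then show ?thesis by (simp cong: measurable_cong_sets[OF sets_gauss refl])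
  qed
  have "distr (gauss d \<sigma> y) (Rd_borel d) ?R = Pi\<^sub>M {..<d} ?N"
  proof (rule N.PiM_eqI)
    show "sets (distr (gauss d \<sigma> y) (Rd_borel d) ?R) = sets (Pi\<^sub>M {..<d} ?N)"
      using sets_gauss[of d \<sigma> y] by (simp add: gauss_def)
    fix A assume "\<And>i. i \<in> {..<d} \<Longrightarrow> A i \<in> sets (?N i)"
    then have A: "A i \<in> sets borel" if "i < d" for i using that by auto
    have "?R -` Pi\<^sub>E {..<d} A \<inter> space (gauss d \<sigma> y) = (\<Pi>\<^sub>E i\<in>{..<d}. (\<lambda>z. 2 * y i - z) -` A i)"
      by (auto simp: space_gauss Rd_def PiE_iff)
    then have "emeasure (distr (gauss d \<sigma> y) (Rd_borel d) ?R) (Pi\<^sub>E {..<d} A) =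
        emeasure (Pi\<^sub>M {..<d} ?N) (\<Pi>\<^sub>E i\<in>{..<d}. (\<lambda>z. 2 * y i - z) -` A i)"
      using A by (subst emeasure_distr[OF R]) (auto simp: gauss_def intro!: sets_PiM_I_finite)
    also have "\<dots> = (\<Prod>i<d. emeasure (?N i) ((\<lambda>z. 2 * y i - z) -` A i))"
    proof (rule N.emeasure_PiM)
      fix i assume "i \<in> {..<d}"
      have "(\<lambda>z. 2 * y i - z) \<in> borel_measurable borel" by measurable
      from measurable_sets[OF this A[of i]] show "(\<lambda>z. 2 * y i - z) -` A i \<in> sets (?N i)"
        using \<open>i \<in> {..<d}\<close> by simp
    qed simp
    also have "\<dots> = (\<Prod>i<d. emeasure (?N i) (A i))"
    proof (rule prod.cong[OF refl])
      fix i assume "i \<in> {..<d}"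
      then show "emeasure (?N i) ((\<lambda>z. 2 * y i - z) -` A i) = emeasure (?N i) (A i)"
        using A[of i] by (subst (2) distr_reflect_normal[OF assms(1), symmetric]) (simp add: emeasure_distr)
    qed
    finally show "emeasure (distr (gauss d \<sigma> y) (Rd_borel d) ?R) (Pi\<^sub>E {..<d} A) = (\<Prod>i<d. emeasure (?N i) (A i))" .
  qed simp
  then have "distr (gauss d \<sigma> y) (Rd_borel d) ?R = gauss d \<sigma> y" by (simp add: gauss_def)
  then have "(\<integral>\<^sup>+z. g z \<partial>gauss d \<sigma> y) = (\<integral>\<^sup>+z. g z \<partial>distr (gauss d \<sigma> y) (Rd_borel d) ?R)" by simp
  also have "\<dots> = (\<integral>\<^sup>+z. g (?R z) \<partial>gauss d \<sigma> y)" using R by (rule nn_integral_distr) simp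
  finally show ?thesis by simp
qed

text \<open>The Cameron-Martin formula. The exponent comes from expanding |z - x|^2 = |z - y|^2 + 2
  (z - y).(y - x) + |y - x|^2, one coordinate at a time.\<close>

lemma nn_integral_gauss_shift:
  assumes "0 < \<sigma>" and [measurable]: "g \<in> borel_measurable (Rd_borel d)"
  shows "(\<integral>\<^sup>+z. g z \<partial>gauss d \<sigma> x) =
    (\<integral>\<^sup>+z. ennreal (exp (- (2 * (\<Sum>i<d. (z i - y i) * (y i - x i)) + (\<Sum>i<d. (y i - x i)\<^sup>2)) / (4 * \<sigma>))) * g z \<partial>gauss d \<sigma> y)"
proof -
  let ?N = "\<lambda>i. gauss1 \<sigma> (y i)"
  define \<rho> where "\<rho> i z = ennreal (exp (- (2 * ((z - y i) * (y i - x i)) + (y i - x i)\<^sup>2) / (4 * \<sigma>)))" for i z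
  have \<rho>[measurable]: "\<rho> i \<in> borel_measurable borel" for i unfolding \<rho>_def by measurable
  have dens: "density (?N i) (\<rho> i) = gauss1 \<sigma> (x i)" for i
  proof -
    have eq: "normal_density (y i) (sqrt (2 * \<sigma>)) z * exp (- (2 * ((z - y i) * (y i - x i)) + (y i - x i)\<^sup>2) / (4 * \<sigma>))
        = normal_density (x i) (sqrt (2 * \<sigma>)) z" for z
    proof -
      have "- (z - y i)\<^sup>2 / (4 * \<sigma>) + - (2 * ((z - y i) * (y i - x i)) + (y i - x i)\<^sup>2) / (4 * \<sigma>) = - (z - x i)\<^sup>2 / (4 * \<sigma>)"
        by (simp add: add_divide_distrib[symmetric] power2_eq_square algebra_simps)
      then show ?thesis
        using assms(1) by (simp add: normal_density_def exp_add[symmetric])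
    qed
    have "density (?N i) (\<rho> i) = density lborel (\<lambda>z. ennreal (normal_density (y i) (sqrt (2 * \<sigma>)) z) * \<rho> i z)"
      by (rule density_density_eq) auto
    also have "\<dots> = gauss1 \<sigma> (x i)"
      by (simp only: \<rho>_def ennreal_mult[symmetric] normal_density_nonneg exp_ge_zero eq)
    finally show ?thesis .
  qed
  have "gauss d \<sigma> x = density (gauss d \<sigma> y) (\<lambda>z. \<Prod>i<d. \<rho> i (z i))"
  proof -
    have "product_sigma_finite (\<lambda>i. density (?N i) (\<rho> i))"
      unfolding dens by (rule product_sigma_finite_normal[OF assms(1)])
    from PiM_density[of "{..<d}", OF _ product_sigma_finite_normal[OF assms(1)] this]
    show ?thesis by (simp add: dens gauss_def)
  qed
  moreover have "(\<lambda>z. \<Prod>i<d. \<rho> i (z i)) \<in> borel_measurable (Rd_borel d)"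
  proof (rule borel_measurable_prod_ennreal)
    fix i assume "i \<in> {..<d}"
    then show "(\<lambda>z. \<rho> i (z i)) \<in> borel_measurable (Rd_borel d)"
      by (rule measurable_compose[where f = "\<lambda>z. z i", OF measurable_component_singleton \<rho>])
  qed
  ultimately have "(\<integral>\<^sup>+z. g z \<partial>gauss d \<sigma> x) = (\<integral>\<^sup>+z. (\<Prod>i<d. \<rho> i (z i)) * g z \<partial>gauss d \<sigma> y)"
    by (simp add: nn_integral_density cong: measurable_cong_sets[OF sets_gauss refl])
  moreover have "(\<Prod>i<d. \<rho> i (z i)) =
      ennreal (exp (- (2 * (\<Sum>i<d. (z i - y i) * (y i - x i)) + (\<Sum>i<d. (y i - x i)\<^sup>2)) / (4 * \<sigma>)))" for z
    by (simp add: \<rho>_def prod_ennreal exp_sum[symmetric] sum_negf sum_divide_distrib[symmetric] sum.distrib sum_distrib_left sum_subtractf sum_negf)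
  ultimately show ?thesis by simp
qed

text \<open>\<open>- A\<close> is the complement in the whole type and may contain points outside
  the space of \<open>N\<close>, so measurability is claimed for its indicator and not for the
  set.\<close>

lemma measurable_indicator_compl:
  assumes [measurable]: "A \<in> sets N"
  shows "(\<lambda>z. indicator (- A) z :: ennreal) \<in> borel_measurable N"
proof -
  have "(\<lambda>z. indicator (- A) z :: ennreal) = (\<lambda>z. 1 - indicator A z)"
    by (auto simp: indicator_def)
  then show ?thesis by simp
qed

text \<open>A convex set missing \<open>y\<close> cannot contain both \<open>z\<close> and its mirror image in \<open>y\<close>, so it misses
  half of the mass of a Gaussian centred at \<open>y\<close>; moving the centre to \<open>x\<close> is an exponential tilt
  whose effect is bounded without reference to the dimension.\<close>

lemma gauss_escape:
  assumes \<sigma>: "0 < \<sigma>" and D: "D \<in> sets (Rd_borel d)" "Rd_convex d D" and y: "y \<in> Rd d" "y \<notin> D"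
  shows "ennreal (exp (- (\<Sum>i<d. (y i - x i)\<^sup>2) / (2 * \<sigma>)) / 4) \<le> (\<integral>\<^sup>+z. indicator (- D) z \<partial>gauss d \<sigma> x)"
proof -
  define V where "V = (\<Sum>i<d. (y i - x i)\<^sup>2)"
  \<comment> \<open>\<open>m\<close> normalises the tilt: exp(-w)/m and, by reflection, exp(w)/m
    both have mean 1 under the Gaussian centred at y.\<close>
  define m where "m = exp (V / (4 * \<sigma>))"
  define w where "w z = (\<Sum>i<d. (z i - y i) * (y i - x i)) / (2 * \<sigma>)" for z
  let ?p = "\<lambda>z. ennreal (exp (- w z) / m)"
  let ?n = "\<lambda>z. ennreal (exp (w z) / m)"
  let ?R = "\<lambda>z. \<lambda>i\<in>{..<d}. 2 * y i - z i"
  let ?Q = "gauss d \<sigma> y"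
  interpret Q: prob_space ?Q by (rule prob_space_gauss[OF \<sigma>])
  interpret Qx: prob_space "gauss d \<sigma> x" by (rule prob_space_gauss[OF \<sigma>])
  have m: "0 < m" by (simp add: m_def)
  have w_meas[measurable]: "w \<in> borel_measurable (Rd_borel d)"
    unfolding w_def by measurable
  have R_meas[measurable]: "?R \<in> measurable (Rd_borel d) (Rd_borel d)" by measurable
  note D(1)[measurable]
  note a_meas[measurable] = measurable_indicator_compl[OF D(1)]
  have tilt: "exp (- (2 * (\<Sum>i<d. (z i - y i) * (y i - x i)) + V) / (4 * \<sigma>)) = exp (- w z) / m" for z
  proof -
    have "- (2 * A + V) / (4 * \<sigma>) = - (A / (2 * \<sigma>)) - V / (4 * \<sigma>)" for A
      using \<sigma> by (simp add: field_simps)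
    then show ?thesis by (simp add: w_def m_def exp_diff)
  qed
  have wR: "w (?R z) = - w z" for z
  proof -
    have "(\<Sum>i<d. (?R z i - y i) * (y i - x i)) = - (\<Sum>i<d. (z i - y i) * (y i - x i))"
      unfolding sum_negf[symmetric] by (intro sum.cong) (auto simp: algebra_simps)
    then show ?thesis by (simp add: w_def)
  qed
  define L where "L = (\<integral>\<^sup>+z. indicator (- D) z \<partial>gauss d \<sigma> x)"
  have L1: "L = (\<integral>\<^sup>+z. ?p z * indicator (- D) z \<partial>?Q)"
    unfolding L_def by (subst nn_integral_gauss_shift[OF \<sigma> a_meas, of x y]) (simp only: tilt V_def[symmetric])
  \<comment> \<open>The same escape probability is written a second time through the mirror image,
    so that the two indicators can be added; their sum is at least 1.\<close>
  have "L = (\<integral>\<^sup>+z. ennreal (exp (- w (?R z)) / m) * indicator (- D) (?R z) \<partial>?Q)"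
    unfolding L1 by (rule nn_integral_gauss_reflect[OF \<sigma>, symmetric]) measurable
  then have L2: "L = (\<integral>\<^sup>+z. ?n z * indicator (- D) (?R z) \<partial>?Q)"
    unfolding wR by simp
  have one1: "1 = (\<integral>\<^sup>+z. ?p z \<partial>?Q)"
    using nn_integral_gauss_shift[OF \<sigma>, of "\<lambda>_. 1" d x y] Qx.emeasure_space_1
    unfolding V_def[symmetric] tilt by simp
  have "1 = (\<integral>\<^sup>+z. ennreal (exp (- w (?R z)) / m) \<partial>?Q)"
    unfolding one1 by (rule nn_integral_gauss_reflect[OF \<sigma>, symmetric]) measurable
  then have one2: "1 = (\<integral>\<^sup>+z. ?n z \<partial>?Q)"
    unfolding wR by simp
  have L_fin: "L \<le> 1"
  proof -
    have "L \<le> (\<integral>\<^sup>+z. 1 \<partial>gauss d \<sigma> x)" unfolding L_def by (intro nn_integral_mono) (auto split: split_indicator)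
    then show ?thesis using Qx.emeasure_space_1 by simp
  qed
  have split: "ennreal (a * (p * i + q * j) + b * (p + q)) =
      ennreal a * (ennreal p * ennreal i + ennreal q * ennreal j) + ennreal b * (ennreal p + ennreal q)"
    if "0 \<le> a" "0 \<le> b" "0 \<le> p" "0 \<le> q" "0 \<le> i" "0 \<le> j" for a b p q i j :: real
    using that by (simp add: ennreal_mult ennreal_plus)
  have "ennreal (4 * m) = (\<integral>\<^sup>+z. ennreal (4 * m) \<partial>?Q)"
    using Q.emeasure_space_1 by simp
  also have "\<dots> \<le> (\<integral>\<^sup>+z. ennreal (4 * m ^ 3) * (?p z * indicator (- D) z +
      ?n z * indicator (- D) (?R z)) +
      ennreal m * (?p z + ?n z) \<partial>?Q)"
  proof (rule nn_integral_mono)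
    fix z assume "z \<in> space ?Q"
    then have z: "z \<in> Rd d" by (simp add: space_gauss)
    define i1 i2 :: real where "i1 = indicator (- D) z" and "i2 = indicator (- D) (?R z)"
    have "\<not> (z \<in> D \<and> ?R z \<in> D)"
    proof
      assume "z \<in> D \<and> ?R z \<in> D"
      then have "\<forall>\<theta>\<in>{0..1}. (\<lambda>i\<in>{..<d}. (1 - \<theta>) * z i + \<theta> * ?R z i) \<in> D"
        using D(2) unfolding Rd_convex_def by blast
      then have "(\<lambda>i\<in>{..<d}. (1 - 1 / 2) * z i + 1 / 2 * ?R z i) \<in> D"
        by (rule bspec) simp
      moreover have "(\<lambda>i\<in>{..<d}. (1 - 1 / 2) * z i + 1 / 2 * ?R z i) = y"
        using y(1) by (intro ext) (auto simp: Rd_def PiE_def extensional_def field_simps)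
      ultimately show False using y(2) by simp
    qed
    then have i: "0 \<le> i1" "0 \<le> i2" "1 \<le> i1 + i2"
      by (auto simp: i1_def i2_def indicator_def)
    define e where "e = exp (- \<bar>w z\<bar>)"
    have e: "0 < e" "e \<le> exp (- w z)" "e \<le> exp (w z)" "1 / e \<le> exp (- w z) + exp (w z)"
      by (auto simp: e_def exp_minus[symmetric] abs_if inverse_eq_divide[symmetric])
    \<comment> \<open>A pointwise form of Cauchy-Schwarz. The number e is below both tilting weights
      and 1/e is below their sum. In l^2 e + 1/e \<ge> 2 l the choice l = 2 m is the one that makes
      the integrated bound on L largest, namely 1 / (4 m^2).\<close>
    have "0 \<le> (2 * m * e - 1)\<^sup>2 / e" using e(1) by simp
    also have "(2 * m * e - 1)\<^sup>2 / e = 4 * m\<^sup>2 * e - 4 * m + 1 / e"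
      using e(1) by (simp add: power2_eq_square field_simps)
    finally have "4 * m \<le> 4 * m\<^sup>2 * e + 1 / e" by simp
    also have "\<dots> \<le> 4 * m\<^sup>2 * (exp (- w z) * i1 + exp (w z) * i2) + (exp (- w z) + exp (w z))"
    proof (intro add_mono e(4) mult_left_mono)
      have "e * 1 \<le> e * (i1 + i2)" using e(1) i by (intro mult_left_mono) auto
      also have "\<dots> \<le> exp (- w z) * i1 + exp (w z) * i2"
        using e i by (auto simp: distrib_left intro!: add_mono mult_right_mono)
      finally show "e \<le> exp (- w z) * i1 + exp (w z) * i2" by simp
    qed simp
    also have "\<dots> = 4 * m ^ 3 * (exp (- w z) / m * i1 + exp (w z) / m * i2) + m * (exp (- w z) / m + exp (w z) / m)"
      using m by (simp add: power2_eq_square power3_eq_cube field_simps)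
    finally have "ennreal (4 * m) \<le> ennreal \<dots>" by (rule ennreal_leI)
    also have "\<dots> = ennreal (4 * m ^ 3) * (?p z * ennreal i1 + ?n z * ennreal i2) +
        ennreal m * (?p z + ?n z)"
      using m i by (intro split) auto
    finally show "ennreal (4 * m) \<le> ennreal (4 * m ^ 3) * (?p z * indicator (- D) z +
        ?n z * indicator (- D) (?R z)) +
        ennreal m * (?p z + ?n z)"
      by (simp add: i1_def i2_def ennreal_indicator)
  qed
  also have "\<dots> = ennreal (4 * m ^ 3) * (L + L) + ennreal m * (1 + 1)"
    by (simp add: nn_integral_add nn_integral_cmult flip: L1 L2 one1 one2)
  finally have le: "ennreal (4 * m) \<le> ennreal (4 * m ^ 3) * (L + L) + ennreal m * (1 + 1)" .
  obtain l where l: "L = ennreal l" "0 \<le> l" using L_fin by (cases L) (auto simp: top_unique)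
  have "ennreal (4 * m) \<le> ennreal (4 * m ^ 3 * (l + l) + m * (1 + 1))"
  proof -
    have e: "L + L = ennreal (l + l)" "1 + 1 = ennreal (1 + 1)"
      using l by (simp_all only: ennreal_plus ennreal_1 zero_le_one)
    have nn: "0 \<le> 4 * m ^ 3" "0 \<le> m" "0 \<le> l + l" "0 \<le> (1 + 1 :: real)" using l m by auto
    show ?thesis
      using le unfolding e by (simp only: ennreal_mult[symmetric] ennreal_plus[symmetric] nn mult_nonneg_nonneg)
  qed
  then have "4 * m \<le> 4 * m ^ 3 * (l + l) + m * (1 + 1)"
    using l m by (subst (asm) ennreal_le_iff) auto
  then have "1 / m\<^sup>2 / 4 \<le> l"
  proof -
    assume "4 * m \<le> 4 * m ^ 3 * (l + l) + m * (1 + 1)"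
    then have "(2 * m) * 1 \<le> (2 * m) * (4 * m\<^sup>2 * l)"
      by (simp add: power2_eq_square power3_eq_cube algebra_simps)
    then have "1 \<le> (m\<^sup>2 * 4) * l" using m by (subst (asm) mult_le_cancel_left_pos) auto
    then show ?thesis using m by (simp add: divide_le_eq mult.commute)
  qed
  moreover have "1 / m\<^sup>2 = exp (- V / (2 * \<sigma>))"
  proof -
    have "1 / m\<^sup>2 = exp (- (2 * (V / (4 * \<sigma>))))"
      unfolding m_def exp_minus exp_double by (simp add: inverse_eq_divide)
    also have "- (2 * (V / (4 * \<sigma>))) = - V / (2 * \<sigma>)" using \<sigma> by simp
    finally show ?thesis .
  qed
  ultimately show ?thesis
    unfolding L_def[symmetric] V_def[symmetric] l(1) by (intro ennreal_leI) simp
qed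

section \<open>Escape probability and heat-kernel bounds for X\<close>

context subordinate_brownian
begin

text \<open>Markov's inequality for exp(-S_t / r^2): it is at least e^(-1) on the event S_t < r^2
  and has mean e^(-2). The value 2 of the exponent is what leaves a probability e^(-1) below
  1.\<close>

lemma prob_S_ge:
  assumes t: "0 \<le> t" and r: "0 < r" "t * \<Psi> (1 / r\<^sup>2) = 2"
  shows "1 - exp (- 1) \<le> prob {\<omega> \<in> space M. r\<^sup>2 \<le> S t \<omega>}"
proof -
  note [measurable] = S_measurable[OF t]
  have u: "0 < 1 / r\<^sup>2" using r by simp
  have "ennreal (exp (- 1)) * emeasure M {\<omega> \<in> space M. S t \<omega> < r\<^sup>2} =
      (\<integral>\<^sup>+\<omega>. ennreal (exp (- 1)) * indicator {\<omega> \<in> space M. S t \<omega> < r\<^sup>2} \<omega> \<partial>M)"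
    by (simp add: nn_integral_cmult_indicator)
  also have "\<dots> \<le> (\<integral>\<^sup>+\<omega>. ennreal (exp (- (1 / r\<^sup>2) * S t \<omega>)) \<partial>M)"
    using r by (intro nn_integral_mono) (auto split: split_indicator simp: field_simps)
  also have "\<dots> = ennreal (exp (- 2))"
    using laplace_S[OF t u] r(2) by simp
  finally have "exp (- 1) * prob {\<omega> \<in> space M. S t \<omega> < r\<^sup>2} \<le> exp (- 2)"
    by (simp add: emeasure_eq_measure ennreal_mult[symmetric])
  also have "exp (- 2) = exp (- 1) * exp (- 1 :: real)" by (simp add: exp_add[symmetric])
  finally have "prob {\<omega> \<in> space M. S t \<omega> < r\<^sup>2} \<le> exp (- 1)" by simp
  moreover have "prob {\<omega> \<in> space M. r\<^sup>2 \<le> S t \<omega>} = 1 - prob {\<omega> \<in> space M. \<not> r\<^sup>2 \<le> S t \<omega>}"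
    by (subst prob_neg) auto
  ultimately show ?thesis by (simp add: not_le)
qed

lemma prob_escape:
  assumes t: "0 \<le> t" and r: "0 < r" "t * \<Psi> (1 / r\<^sup>2) = 2"
    and D: "D \<in> sets (Rd_borel d)" "Rd_convex d D" and y: "y \<in> Rd d" "y \<notin> D"
    and x: "x \<in> Rd d" and dist: "(\<Sum>i<d. (y i - x i)\<^sup>2) \<le> 2 * r\<^sup>2"
  shows "prob {\<omega> \<in> space M. Z x t \<omega> \<in> D} \<le> 1 - (1 - exp (- 1)) * exp (- 1) / 4"
proof -
  note [measurable] = S_measurable[OF t] D(1)
  have [measurable]: "x \<in> space (Rd_borel d)" using x by (simp add: space_Rd_borel)
  note ind_meas[measurable] = measurable_indicator_compl[OF D(1)]
  have "ennreal ((1 - exp (- 1)) * exp (- 1) / 4) \<le> ennreal (exp (- 1) / 4 * prob {\<omega> \<in> space M. r\<^sup>2 \<le> S t \<omega>})"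
    using prob_S_ge[OF t r] by (intro ennreal_leI) simp
  also have "\<dots> = (\<integral>\<^sup>+\<omega>'. ennreal (exp (- 1) / 4) * indicator {\<omega> \<in> space M. r\<^sup>2 \<le> S t \<omega>} \<omega>' \<partial>M)"
    by (simp add: nn_integral_cmult_indicator emeasure_eq_measure ennreal_mult'[symmetric])
  also have "\<dots> \<le> (\<integral>\<^sup>+\<omega>'. \<integral>\<^sup>+\<omega>. indicator (- D) (vadd d x (Bv (S t \<omega>') \<omega>)) \<partial>M \<partial>M)"
  proof (rule nn_integral_mono)
    fix \<omega>' assume "\<omega>' \<in> space M"
    show "ennreal (exp (- 1) / 4) * indicator {\<omega> \<in> space M. r\<^sup>2 \<le> S t \<omega>} \<omega>' \<le>
        (\<integral>\<^sup>+\<omega>. indicator (- D) (vadd d x (Bv (S t \<omega>') \<omega>)) \<partial>M)"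
    proof (cases "r\<^sup>2 \<le> S t \<omega>'")
      case True
      then have \<sigma>: "0 < S t \<omega>'" using r(1) by (smt (verit) zero_less_power)
      have "(\<Sum>i<d. (y i - x i)\<^sup>2) / (2 * S t \<omega>') \<le> 1"
        using dist True \<sigma> by (simp add: divide_le_eq)
      then have "ennreal (exp (- 1) / 4) \<le> ennreal (exp (- (\<Sum>i<d. (y i - x i)\<^sup>2) / (2 * S t \<omega>')) / 4)"
        by (intro ennreal_leI) simp
      also have "\<dots> \<le> (\<integral>\<^sup>+z. indicator (- D) z \<partial>gauss d (S t \<omega>') x)"
        by (rule gauss_escape[OF \<sigma> D y])
      also have "\<dots> = (\<integral>\<^sup>+\<omega>. indicator (- D) (vadd d x (Bv (S t \<omega>') \<omega>)) \<partial>M)"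
        by (rule nn_integral_vadd_Bv[symmetric, OF \<sigma> x ind_meas])
      finally show ?thesis using True by (simp split: split_indicator)
    qed simp
  qed
  also have "\<dots> = (\<integral>\<^sup>+\<omega>. indicator (- D) (Z x t \<omega>) \<partial>M)"
    by (rule nn_integral_X_freeze[symmetric, OF _ t]) measurable
  also have "\<dots> = (\<integral>\<^sup>+\<omega>. indicator {\<omega> \<in> space M. Z x t \<omega> \<notin> D} \<omega> \<partial>M)"
    by (intro nn_integral_cong) (auto split: split_indicator)
  also have "\<dots> = ennreal (prob {\<omega> \<in> space M. Z x t \<omega> \<notin> D})"
    by (subst nn_integral_indicator) (auto simp: emeasure_eq_measure)
  finally have "(1 - exp (- 1)) * exp (- 1) / 4 \<le> prob {\<omega> \<in> space M. Z x t \<omega> \<notin> D}"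
    by simp
  moreover have "prob {\<omega> \<in> space M. Z x t \<omega> \<notin> D} = 1 - prob {\<omega> \<in> space M. Z x t \<omega> \<in> D}"
    by (rule prob_neg) measurable
  ultimately show ?thesis by simp
qed

text \<open>The Gaussian peak bound holds for each frozen value of S_s and is averaged; the factor
  (4 \<pi>)^(-d/2) \<le> 1 is dropped.\<close>

lemma P_le_heat:
  assumes "0 \<le> s" "AE \<omega> in M. 0 < S s \<omega>" "x \<in> Rd d" and f[measurable]: "f \<in> borel_measurable (Rd_borel d)"
  shows "P s f x \<le> (\<integral>\<^sup>+\<omega>. ennreal (S s \<omega> powr (- (real d / 2))) \<partial>M) * (\<integral>\<^sup>+y. f y \<partial>Rd_lborel d)"
proof -
  note [measurable] = S_measurable[OF assms(1)]
  let ?J = "\<integral>\<^sup>+y. f y \<partial>Rd_lborel d"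
  let ?m = "\<lambda>\<omega>. ennreal (S s \<omega> powr (- (real d / 2)))"
  have [measurable]: "x \<in> space (Rd_borel d)" using assms by (simp add: space_Rd_borel)
  have "P s f x = (\<integral>\<^sup>+\<omega>'. \<integral>\<^sup>+\<omega>. f (vadd d x (Bv (S s \<omega>') \<omega>)) \<partial>M \<partial>M)"
    unfolding P_def by (rule nn_integral_X_freeze[OF _ assms(1)]) measurable
  also have "\<dots> \<le> (\<integral>\<^sup>+\<omega>'. ?m \<omega>' * ?J \<partial>M)"
  proof (rule nn_integral_mono_AE)
    show "AE \<omega>' in M. (\<integral>\<^sup>+\<omega>. f (vadd d x (Bv (S s \<omega>') \<omega>)) \<partial>M) \<le>
        ?m \<omega>' * ?J"
      using assms(2)
    proof eventually_elim
      fix \<omega>' assume \<sigma>: "0 < S s \<omega>'"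
      have "(\<integral>\<^sup>+\<omega>. f (vadd d x (Bv (S s \<omega>') \<omega>)) \<partial>M) \<le>
          ennreal ((4 * pi * S s \<omega>') powr (- real d / 2)) * ?J"
        unfolding nn_integral_vadd_Bv[OF \<sigma> assms(3) f] by (rule gauss_le[OF \<sigma> f])
      also have "\<dots> \<le> ?m \<omega>' * ?J"
      proof (intro mult_right_mono ennreal_leI)
        have "S s \<omega>' * 1 \<le> S s \<omega>' * (4 * pi)" using \<sigma> pi_gt3 by (intro mult_left_mono) auto
        then show "(4 * pi * S s \<omega>') powr (- real d / 2) \<le> S s \<omega>' powr (- (real d / 2))"
          using \<sigma> by (simp add: powr_minus powr_mono2 le_imp_inverse_le mult.commute)
      qed simp
      finally show "(\<integral>\<^sup>+\<omega>. f (vadd d x (Bv (S s \<omega>') \<omega>)) \<partial>M) \<le>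
          ?m \<omega>' * ?J" .
    qed
  qed
  also have "\<dots> = (\<integral>\<^sup>+\<omega>. ?m \<omega> \<partial>M) * ?J"
    by (rule nn_integral_multc) measurable
  finally show ?thesis .
qed

text \<open>Jensen's inequality for the p-th power, in the form of its tangent at b: Young's
  inequality below is an equality at y = b, and \<open>P s\<close> preserves constants.\<close>

lemma P_le_Lp:
  fixes g :: "vec \<Rightarrow> real"
  assumes "1 \<le> p" "0 < b" and [measurable]: "g \<in> borel_measurable (Rd_borel d)" and g: "\<And>y. 0 \<le> g y"
    and x: "x \<in> Rd d" and le: "P s (\<lambda>y. ennreal (g y powr p)) x \<le> ennreal (b powr p)"
  shows "P s (\<lambda>y. ennreal (g y)) x \<le> ennreal b"
proof -
  have young: "y \<le> b powr (1 - p) / p * y powr p + (1 - 1 / p) * b" if "0 \<le> y" for y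
  proof (cases "y = 0")
    case True
    then show ?thesis using assms by simp
  next
    case False
    then have y: "0 < y" using that by simp
    have "((y / b) powr p) powr (1 / p) * 1 powr (1 - 1 / p) \<le> 1 / p * (y / b) powr p + (1 - 1 / p) * 1"
      using assms y by (intro Youngs_inequality_0) auto
    then have "b * (y / b) \<le> b * (1 / p * (y / b) powr p + (1 - 1 / p) * 1)"
      using assms y by (intro mult_left_mono) (auto simp: powr_powr)
    also have "b * (1 / p * (y / b) powr p + (1 - 1 / p) * 1) = b powr (1 - p) / p * y powr p + (1 - 1 / p) * b"
      using assms y by (simp add: powr_divide powr_diff field_simps)
    finally show ?thesis using assms by simp
  qed
  have nn: "0 \<le> b powr (1 - p) / p" "0 \<le> (1 - 1 / p) * b" using assms by auto
  have "P s (\<lambda>y. ennreal (g y)) x \<le> P s (\<lambda>y. ennreal (b powr (1 - p) / p) * ennreal (g y powr p) + ennreal ((1 - 1 / p) * b)) x"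
  proof (rule P_mono)
    fix y
    have "ennreal (g y) \<le> ennreal (b powr (1 - p) / p * g y powr p + (1 - 1 / p) * b)"
      by (rule ennreal_leI[OF young[OF g]])
    also have "\<dots> = ennreal (b powr (1 - p) / p) * ennreal (g y powr p) + ennreal ((1 - 1 / p) * b)"
      using nn by (simp only: ennreal_mult[symmetric] ennreal_plus[symmetric] powr_ge_zero mult_nonneg_nonneg)
    finally show "ennreal (g y) \<le> \<dots>" .
  qed
  also have "\<dots> = ennreal (b powr (1 - p) / p) * P s (\<lambda>y. ennreal (g y powr p)) x + ennreal ((1 - 1 / p) * b)"
    using x by (subst P_add) (simp_all add: P_cmult P_const)
  also have "\<dots> \<le> ennreal (b powr (1 - p) / p) * ennreal (b powr p) + ennreal ((1 - 1 / p) * b)"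
    by (intro add_right_mono mult_left_mono le) simp
  also have "\<dots> = ennreal (b powr (1 - p) / p * b powr p + (1 - 1 / p) * b)"
    using nn by (simp only: ennreal_mult[symmetric] ennreal_plus[symmetric] powr_ge_zero mult_nonneg_nonneg)
  also have "b powr (1 - p) / p * b powr p + (1 - 1 / p) * b = b"
  proof -
    have "b powr (1 - p) * b powr p = b" using assms by (simp flip: powr_add)
    then show ?thesis using assms by (simp add: field_simps)
  qed
  finally show ?thesis .
qed

end

section \<open>Khasminskii's exponential bound\<close>

text \<open>A right-endpoint Riemann sum for the integral of s^(\<eta>-1) exp(-\<beta> s). Each term
  is dominated by an increment of one function \<Phi>, so the bound does not depend on the
  mesh.\<close>

lemma discrete_laplace_sum:
  fixes \<eta> \<beta> h :: real
  assumes \<eta>: "0 < \<eta>" "\<eta> \<le> 1" and "0 < \<beta>" "0 < h"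
  shows "(\<Sum>i=1..m. h * (real i * h) powr (\<eta> - 1) * exp (- \<beta> * (real i * h))) \<le> (1 / \<eta> + 1) * \<beta> powr (- \<eta>)"
proof -
  \<comment> \<open>\<Phi> grows at rate s^(\<eta>-1) below 1/\<beta>, to which \<beta>^(1-\<eta>)
    exp(-\<beta> s) is added everywhere. The first part pays for the singularity at 0, the second
    for the tail, where s^(\<eta>-1) \<le> \<beta>^(1-\<eta>).\<close>
  define \<Phi> where "\<Phi> s = 1 / \<eta> * (min s (1 / \<beta>)) powr \<eta> - \<beta> powr (- \<eta>) * exp (- \<beta> * s)" for s
  have step: "h * (real (Suc j) * h) powr (\<eta> - 1) * exp (- \<beta> * (real (Suc j) * h)) \<le> \<Phi> (real (Suc j) * h) - \<Phi> (real j * h)" for j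
  proof -
    define a b where "a = real j * h" and "b = real (Suc j) * h"
    have ab: "0 \<le> a" "0 < b" "b = a + h"
      using assms mult_pos_pos[of "real (Suc j)" h] by (auto simp: a_def b_def distrib_right)
    have "exp (- \<beta> * b) * (1 + \<beta> * h) \<le> exp (- \<beta> * b) * exp (\<beta> * h)"
      by (intro mult_left_mono exp_ge_add_one_self) auto
    also have "\<dots> = exp (- \<beta> * a)" using ab by (simp add: exp_add[symmetric] algebra_simps)
    finally have e: "\<beta> * h * exp (- \<beta> * b) \<le> exp (- \<beta> * a) - exp (- \<beta> * b)" by (simp add: algebra_simps)
    have mono: "(min a (1 / \<beta>)) powr \<eta> \<le> (min b (1 / \<beta>)) powr \<eta>"
      using ab assms by (intro powr_mono2) auto
    show ?thesis
    proof (cases "b \<le> 1 / \<beta>")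
      case True
      \<comment> \<open>Concavity of the \<eta>-th power: its graph lies below the tangent at 1.
        This bounds the increment of the \<eta>-th power from below by its slope at the right
        endpoint.\<close>
      have "(a / b) powr \<eta> \<le> \<eta> * (a / b) + (1 - \<eta>)"
      proof (cases "a = 0")
        case True
        then show ?thesis using \<eta> by simp
      next
        case False
        then show ?thesis using Youngs_inequality_0[of \<eta> "1 - \<eta>" "a / b" 1] ab \<eta> by simp
      qed
      then have "\<eta> * (h / b) \<le> 1 - (a / b) powr \<eta>"
        using ab by (simp add: field_simps)
      then have "b powr \<eta> * (\<eta> * (h / b)) \<le> b powr \<eta> * (1 - (a / b) powr \<eta>)"
        by (intro mult_left_mono) auto
      also have "\<dots> = b powr \<eta> - a powr \<eta>" using ab by (simp add: powr_divide algebra_simps)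
      also have "b powr \<eta> * (\<eta> * (h / b)) = \<eta> * (h * b powr (\<eta> - 1))"
        using ab by (simp add: powr_diff)
      finally have "h * b powr (\<eta> - 1) \<le> 1 / \<eta> * b powr \<eta> - 1 / \<eta> * a powr \<eta>"
        using \<eta> by (simp add: field_simps)
      moreover have "h * b powr (\<eta> - 1) * exp (- \<beta> * b) \<le> h * b powr (\<eta> - 1) * 1"
        using ab assms by (intro mult_left_mono) auto
      moreover have "\<beta> powr (- \<eta>) * exp (- \<beta> * b) \<le> \<beta> powr (- \<eta>) * exp (- \<beta> * a)"
        using ab assms by (intro mult_left_mono) auto
      moreover have "min b (1 / \<beta>) = b" "min a (1 / \<beta>) = a" using True ab assms by auto
      ultimately show ?thesis unfolding \<Phi>_def a_def[symmetric] b_def[symmetric] by simp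
    next
      case False
      have "h * b powr (\<eta> - 1) * exp (- \<beta> * b) \<le> h * (1 / \<beta>) powr (\<eta> - 1) * exp (- \<beta> * b)"
        using False ab assms by (intro mult_right_mono mult_left_mono powr_mono2') auto
      also have "(1 / \<beta>) powr (\<eta> - 1) = \<beta> powr (- \<eta>) * \<beta>"
        using assms by (simp add: powr_divide powr_diff powr_minus field_simps)
      also have "h * (\<beta> powr (- \<eta>) * \<beta>) * exp (- \<beta> * b) = \<beta> powr (- \<eta>) * (\<beta> * h * exp (- \<beta> * b))"
        by simp
      also have "\<dots> \<le> \<beta> powr (- \<eta>) * (exp (- \<beta> * a) - exp (- \<beta> * b))"
        by (intro mult_left_mono e) auto
      also have "\<dots> \<le> \<Phi> b - \<Phi> a"
        using mult_left_mono[OF mono, of "1 / \<eta>"] \<eta> by (simp add: \<Phi>_def algebra_simps)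
      finally show ?thesis unfolding a_def b_def .
    qed
  qed
  have "(\<Sum>i=1..m. h * (real i * h) powr (\<eta> - 1) * exp (- \<beta> * (real i * h))) =
      (\<Sum>j<m. h * (real (Suc j) * h) powr (\<eta> - 1) * exp (- \<beta> * (real (Suc j) * h)))"
    by (rule sum.reindex_bij_witness[of _ Suc "\<lambda>i. i - 1"]) auto
  also have "\<dots> \<le> (\<Sum>j<m. \<Phi> (real (Suc j) * h) - \<Phi> (real j * h))"
    by (intro sum_mono step)
  also have "\<dots> = \<Phi> (real m * h) - \<Phi> 0"
    using sum_lessThan_telescope[of "\<lambda>j. \<Phi> (real j * h)" m] by simp
  also have "\<dots> \<le> (1 / \<eta> + 1) * \<beta> powr (- \<eta>)"
  proof -
    have "(min (real m * h) (1 / \<beta>)) powr \<eta> \<le> (1 / \<beta>) powr \<eta>"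
      using assms by (intro powr_mono2) auto
    also have "\<dots> = \<beta> powr (- \<eta>)" using assms by (simp add: powr_divide powr_minus_divide)
    finally have "1 / \<eta> * (min (real m * h) (1 / \<beta>)) powr \<eta> \<le> 1 / \<eta> * \<beta> powr (- \<eta>)"
      using \<eta> by (intro mult_left_mono) auto
    moreover have "0 \<le> \<beta> powr (- \<eta>) * exp (- \<beta> * (real m * h))" by simp
    moreover have "\<Phi> 0 = - (\<beta> powr (- \<eta>))" using assms by (simp add: \<Phi>_def)
    ultimately show ?thesis unfolding \<Phi>_def distrib_right by linarith
  qed
  finally show ?thesis .
qed

text \<open>The integral over [0, t] is the average over offsets u in [0, h) of h times the sum over
  the grid u + k h, and the exponential is convex. The right-hand side samples the path at finitely
  many deterministic times, which is where the Markov property is available.\<close>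

lemma exp_integral_le_shifted_average:
  fixes \<phi> :: "real \<Rightarrow> real"
  assumes "0 < h" and [measurable]: "\<phi> \<in> borel_measurable borel" and \<phi>: "\<And>s. 0 \<le> \<phi> s" "\<And>s. \<phi> s \<le> N"
  shows "ennreal (exp (LINT s:{0..real (Suc m) * h}|lborel. \<phi> s)) \<le>
    ennreal (1 / h) * (\<integral>\<^sup>+u. ennreal (exp (h * (\<Sum>k\<le>m. \<phi> (u + real k * h)))) * indicator {0..<h} u \<partial>lborel)"
proof -
  define t where "t = real (Suc m) * h"
  have t: "0 < t" using assms(1) by (simp add: t_def)
  have N: "0 \<le> N" using \<phi>[of 0] by linarith
  define a where "a = (LINT s:{0..t}|lborel. \<phi> s)"
  let ?T = "\<lambda>k. \<integral>\<^sup>+u. ennreal (\<phi> (u + real k * h)) * indicator {0..<h} u \<partial>lborel"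
  have split: "(\<integral>\<^sup>+s. ennreal (\<phi> s) * indicator {0..<real n * h} s \<partial>lborel) =
      (\<Sum>k<n. ?T k)" for n
  proof (induction n)
    case (Suc n)
    have "(\<integral>\<^sup>+s. ennreal (\<phi> s) * indicator {0..<real (Suc n) * h} s \<partial>lborel) =
        (\<integral>\<^sup>+s. (ennreal (\<phi> s) * indicator {0..<real n * h} s + ennreal (\<phi> s) * indicator {real n * h..<real (Suc n) * h} s) \<partial>lborel)"
    proof (intro nn_integral_cong)
      fix s :: real
      have "0 \<le> real n * h" "real n * h \<le> real (Suc n) * h" using assms(1) by (auto intro: mult_right_mono)
      then show "ennreal (\<phi> s) * indicator {0..<real (Suc n) * h} s =
          ennreal (\<phi> s) * indicator {0..<real n * h} s + ennreal (\<phi> s) * indicator {real n * h..<real (Suc n) * h} s"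
        by (auto simp: indicator_def)
    qed
    also have "\<dots> = (\<integral>\<^sup>+s. ennreal (\<phi> s) * indicator {0..<real n * h} s \<partial>lborel) +
        (\<integral>\<^sup>+s. ennreal (\<phi> s) * indicator {real n * h..<real (Suc n) * h} s \<partial>lborel)"
      by (rule nn_integral_add) measurable
    also have "(\<integral>\<^sup>+s. ennreal (\<phi> s) * indicator {real n * h..<real (Suc n) * h} s \<partial>lborel) =
        (\<integral>\<^sup>+u. ennreal (\<phi> (u + real n * h)) * indicator {0..<h} u \<partial>lborel)"
      by (subst nn_integral_real_affine[where c = 1 and t = "real n * h"])
        (auto intro!: nn_integral_cong simp: indicator_def algebra_simps)
    finally show ?case using Suc by simp
  qed simp
  have int: "set_integrable lborel {0..t} \<phi>"
    unfolding set_integrable_def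
    by (rule integrableI_bounded_set[where A = "{0..t}" and B = N])
      (use \<phi> N t in \<open>auto intro!: AE_I2 simp: indicator_def\<close>)
  have a_nn: "0 \<le> a" unfolding a_def set_lebesgue_integral_def using \<phi> by (intro integral_nonneg_AE) auto
  have "ennreal a = (\<integral>\<^sup>+s. ennreal (indicator {0..t} s * \<phi> s) \<partial>lborel)"
    unfolding a_def set_lebesgue_integral_def using int \<phi>
    by (subst nn_integral_eq_integral) (auto simp: set_integrable_def)
  also have "\<dots> = (\<integral>\<^sup>+s. ennreal (\<phi> s) * indicator {0..<t} s \<partial>lborel)"
  proof (rule nn_integral_cong_AE)
    have "AE s in lborel. s \<noteq> t" by (rule AE_lborel_singleton)
    then show "AE s in lborel. ennreal (indicator {0..t} s * \<phi> s) = ennreal (\<phi> s) * indicator {0..<t} s"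
      by eventually_elim (auto simp: indicator_def)
  qed
  also have "\<dots> = (\<Sum>k<Suc m. ?T k)"
    unfolding t_def by (rule split)
  also have "\<dots> = (\<integral>\<^sup>+u. (\<Sum>k<Suc m. ennreal (\<phi> (u + real k * h)) * indicator {0..<h} u) \<partial>lborel)"
    by (rule nn_integral_sum[symmetric]) measurable
  also have "\<dots> = (\<integral>\<^sup>+u. ennreal (\<Sum>k\<le>m. \<phi> (u + real k * h)) * indicator {0..<h} u \<partial>lborel)"
    using \<phi>(1) by (intro nn_integral_cong) (simp add: lessThan_Suc_atMost sum_distrib_right[symmetric])
  finally have a_eq: "ennreal a = (\<integral>\<^sup>+u. ennreal (\<Sum>k\<le>m. \<phi> (u + real k * h)) * indicator {0..<h} u \<partial>lborel)" .
  define Y where "Y u = (\<Sum>k\<le>m. \<phi> (u + real k * h))" for u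
  have [measurable]: "Y \<in> borel_measurable borel" unfolding Y_def by measurable
  have Y: "0 \<le> Y u" for u unfolding Y_def using \<phi>(1) by (intro sum_nonneg) auto
  let ?E = "\<integral>\<^sup>+u. ennreal (exp (h * Y u)) * indicator {0..<h} u \<partial>lborel"
  have h_ind: "(\<integral>\<^sup>+u. ennreal c * indicator {0..<h} u \<partial>lborel) = ennreal (c * h)" if "0 \<le> c" for c
    using assms(1) that by (subst nn_integral_cmult_indicator) (auto simp: ennreal_mult)
  \<comment> \<open>Jensen's inequality through the tangent of exp at the mean a. The negative term
    of the tangent is carried to the other side, so that all integrands stay nonnegative; it cancels
    at the end because it is finite.\<close>
  have "ennreal (exp a * h) + ennreal (exp a * h * a) =
      (\<integral>\<^sup>+u. ennreal (exp a) * indicator {0..<h} u + ennreal (exp a * h) * (ennreal (Y u) * indicator {0..<h} u) \<partial>lborel)"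
    using assms(1) a_nn h_ind[of "exp a"] a_eq
    by (simp add: nn_integral_add nn_integral_cmult ennreal_mult Y_def)
  also have "\<dots> \<le> (\<integral>\<^sup>+u. ennreal (exp (h * Y u)) * indicator {0..<h} u + ennreal (exp a * a) * indicator {0..<h} u \<partial>lborel)"
  proof (rule nn_integral_mono)
    fix u :: real
    have "exp a * (1 + (h * Y u - a)) \<le> exp a * exp (h * Y u - a)"
      by (intro mult_left_mono exp_ge_add_one_self) auto
    then have "exp a + exp a * h * Y u \<le> exp (h * Y u) + exp a * a"
      by (simp add: exp_diff algebra_simps)
    then have "ennreal (exp a + exp a * h * Y u) \<le> ennreal (exp (h * Y u) + exp a * a)" by (rule ennreal_leI)
    then have "ennreal (exp a) + ennreal (exp a * h) * ennreal (Y u) \<le> ennreal (exp (h * Y u)) + ennreal (exp a * a)"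
      using assms(1) a_nn Y by (simp add: ennreal_mult)
    then show "ennreal (exp a) * indicator {0..<h} u + ennreal (exp a * h) * (ennreal (Y u) * indicator {0..<h} u) \<le>
        ennreal (exp (h * Y u)) * indicator {0..<h} u + ennreal (exp a * a) * indicator {0..<h} u"
      by (auto simp: indicator_def)
  qed
  also have "\<dots> = ?E + ennreal (exp a * a * h)"
    using h_ind[of "exp a * a"] a_nn by (simp add: nn_integral_add)
  finally have "ennreal (exp a * h) + ennreal (exp a * h * a) \<le> ?E + ennreal (exp a * h * a)"
    by (simp add: mult_ac)
  then have le: "ennreal (exp a * h) \<le> ?E" by simp
  have "ennreal (exp a) = ennreal (1 / h) * ennreal (exp a * h)"
    using assms(1) by (simp add: ennreal_mult[symmetric])
  also have "\<dots> \<le> ennreal (1 / h) * ?E" by (intro mult_left_mono le) simp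
  finally show ?thesis unfolding a_def t_def Y_def .
qed

section \<open>The exponential bound along paths of X\<close>

context subordinate_brownian
begin

text \<open>A discrete Gronwall argument. One step costs at most h A_j P_h F on top of P_h u_j, and
  by the semigroup law all operators gather in front, leaving P_(ih) F evaluated at x. With A_n
  growing like exp(\<beta> n h), the weighted kernel sum is at most \<alpha>, and 1 + \<alpha> A_m
  \<le> A_m closes the induction. Strong induction is needed because all earlier iterates
  occur.\<close>

lemma khasminskii_discrete:
  fixes F q :: "vec \<Rightarrow> ennreal"
  assumes h: "0 < h" and \<eta>: "0 < \<eta>" "\<eta> \<le> 1" and \<beta>: "0 < \<beta>" and \<alpha>: "\<alpha> < 1" and K: "0 \<le> K"
    and F[measurable]: "F \<in> borel_measurable (Rd_borel d)" and q[measurable]: "q \<in> borel_measurable (Rd_borel d)"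
    and q_le: "\<And>y. q y \<le> 1 + ennreal h * F y"
    and kernel: "\<And>s x. 0 < s \<Longrightarrow> s \<le> t \<Longrightarrow> x \<in> Rd d \<Longrightarrow> P s F x \<le> ennreal (K * s powr (\<eta> - 1))"
    and small: "K * (1 / \<eta> + 1) * \<beta> powr (- \<eta>) \<le> \<alpha>"
  shows "real m * h \<le> t \<Longrightarrow> x \<in> Rd d \<Longrightarrow>
    ((\<lambda>v. P h (\<lambda>z. q z * v z)) ^^ m) (\<lambda>_. 1) x \<le> ennreal (exp (\<beta> * (real m * h)) / (1 - \<alpha>))"
proof (induction m arbitrary: x rule: less_induct)
  case (less m)
  define u where "u n = ((\<lambda>v. P h (\<lambda>z. q z * v z)) ^^ n) (\<lambda>_. 1)" for n
  let ?a = "\<lambda>i. h * (K * (real i * h) powr (\<eta> - 1))"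
  define A where "A n = exp (\<beta> * (real n * h)) / (1 - \<alpha>)" for n :: nat
  have u_Suc: "u (Suc n) = P h (\<lambda>z. q z * u n z)" for n by (simp add: u_def)
  have u_meas[measurable]: "u n \<in> borel_measurable (Rd_borel d)" for n
  proof (induction n)
    case 0
    then show ?case by (simp add: u_def)
  next
    case (Suc n)
    note Suc[measurable]
    show ?case unfolding u_Suc by measurable
  qed
  have A_nn: "0 \<le> A n" for n using \<alpha> by (simp add: A_def)
  have IH: "u n y \<le> ennreal (A n)" if "n < m" "y \<in> Rd d" for n y
    unfolding u_def A_def
  proof (rule less.IH[OF that(1) _ that(2)])
    have "real n * h \<le> real m * h" using that h by (intro mult_right_mono) auto
    then show "real n * h \<le> t" using less.prems by simp
  qed
  \<comment> \<open>The recursion unrolled k times. The sum starts at i = 1: the weight acts after a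
    step of length h, so the singular time 0 of the kernel is never met.\<close>
  have step: "u m x \<le> P (real k * h) (u (m - k)) x + ennreal (\<Sum>i=1..k. ?a i * A (m - i))"
    if "k \<le> m" for k
    using that
  proof (induction k)
    case 0
    then show ?case using less.prems by (simp add: P_0)
  next
    case (Suc k)
    define j where "j = m - Suc k"
    have j: "j < m" "m - k = Suc j" using Suc.prems by (auto simp: j_def)
    have kh: "0 \<le> real k * h" "0 < real (Suc k) * h" using h by auto
    have "real (Suc k) * h \<le> real m * h" using Suc.prems h by (intro mult_right_mono) auto
    then have Skt: "real (Suc k) * h \<le> t" using less.prems by simp
    have "u (m - k) y \<le> P h (\<lambda>z. u j z + ennreal (h * A j) * F z) y" if "y \<in> Rd d" for y
      unfolding j(2) u_Suc
    proof (rule P_mono)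
      fix z assume z: "z \<in> Rd d"
      have "q z * u j z \<le> (1 + ennreal h * F z) * u j z" by (intro mult_right_mono q_le) simp
      also have "\<dots> = u j z + ennreal h * F z * u j z" by (simp add: distrib_right)
      also have "\<dots> \<le> u j z + ennreal h * F z * ennreal (A j)"
        by (intro add_left_mono mult_left_mono IH j(1) z) simp
      also have "\<dots> = u j z + ennreal (h * A j) * F z"
        using h A_nn by (simp add: ennreal_mult mult_ac)
      finally show "q z * u j z \<le> u j z + ennreal (h * A j) * F z" .
    qed
    then have "P (real k * h) (u (m - k)) x \<le> P (real k * h) (P h (\<lambda>z. u j z + ennreal (h * A j) * F z)) x"
      by (rule P_mono)
    also have "\<dots> = P (real (Suc k) * h) (\<lambda>z. u j z + ennreal (h * A j) * F z) x"
      using P_semigroup[OF kh(1) less_imp_le[OF h] less.prems(2), of "\<lambda>z. u j z + ennreal (h * A j) * F z"]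
      by (simp add: algebra_simps)
    also have "\<dots> = P (real (Suc k) * h) (u j) x + ennreal (h * A j) * P (real (Suc k) * h) F x"
      using less.prems(2) by (simp add: P_add P_cmult)
    also have "\<dots> \<le> P (real (Suc k) * h) (u j) x + ennreal (h * A j) * ennreal (K * (real (Suc k) * h) powr (\<eta> - 1))"
      by (intro add_left_mono mult_left_mono kernel kh(2) Skt less.prems(2)) simp
    also have "ennreal (h * A j) * ennreal (K * (real (Suc k) * h) powr (\<eta> - 1)) =
        ennreal (?a (Suc k) * A j)"
      using h A_nn K by (subst ennreal_mult[symmetric]) (auto simp: mult_ac)
    finally have "P (real k * h) (u (m - k)) x \<le> P (real (Suc k) * h) (u j) x +
        ennreal (?a (Suc k) * A j)" .
    moreover have "u m x \<le> P (real k * h) (u (m - k)) x + ennreal (\<Sum>i=1..k. ?a i * A (m - i))"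
      using Suc by simp
    ultimately have "u m x \<le> P (real (Suc k) * h) (u j) x +
        ennreal (?a (Suc k) * A j) +
        ennreal (\<Sum>i=1..k. ?a i * A (m - i))"
      by (meson add_right_mono order_trans)
    also have "\<dots> = P (real (Suc k) * h) (u j) x +
        ennreal (?a (Suc k) * A j +
          (\<Sum>i=1..k. ?a i * A (m - i)))"
      using h K A_nn by (subst ennreal_plus) (auto intro!: sum_nonneg mult_nonneg_nonneg simp: add.assoc)
    also have "?a (Suc k) * A j +
          (\<Sum>i=1..k. ?a i * A (m - i)) =
        (\<Sum>i=1..Suc k. ?a i * A (m - i))"
      by (simp add: j_def)
    finally show ?case by (simp add: j_def)
  qed
  have "u m x \<le> P (real m * h) (u 0) x + ennreal (\<Sum>i=1..m. ?a i * A (m - i))"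
    using step[of m] by simp
  also have "P (real m * h) (u 0) x = ennreal 1"
    by (simp add: u_def P_const)
  also have "ennreal 1 + ennreal (\<Sum>i=1..m. ?a i * A (m - i)) =
      ennreal (1 + (\<Sum>i=1..m. ?a i * A (m - i)))"
    using h K A_nn by (subst ennreal_plus) (auto intro!: sum_nonneg mult_nonneg_nonneg)
  also have "\<dots> \<le> ennreal (A m)"
  proof (rule ennreal_leI)
    have "(\<Sum>i=1..m. ?a i * A (m - i)) =
        K * A m * (\<Sum>i=1..m. h * (real i * h) powr (\<eta> - 1) * exp (- \<beta> * (real i * h)))"
      unfolding sum_distrib_left
    proof (rule sum.cong[OF refl])
      fix i assume "i \<in> {1..m}"
      then have "A (m - i) = A m * exp (- \<beta> * (real i * h))"
        by (simp add: A_def of_nat_diff exp_add[symmetric] algebra_simps)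
      then show "?a i * A (m - i) =
          K * A m * (h * (real i * h) powr (\<eta> - 1) * exp (- \<beta> * (real i * h)))" by simp
    qed
    also have "\<dots> \<le> K * A m * ((1 / \<eta> + 1) * \<beta> powr (- \<eta>))"
      using K A_nn by (intro mult_left_mono discrete_laplace_sum[OF \<eta> \<beta> h]) auto
    also have "\<dots> \<le> A m * \<alpha>"
      using mult_left_mono[OF small A_nn[of m]] by (simp add: mult_ac)
    finally have "1 + (\<Sum>i=1..m. ?a i * A (m - i)) \<le> 1 + A m * \<alpha>" by simp
    also have "\<dots> \<le> A m"
    proof -
      have "1 \<le> exp (\<beta> * (real m * h))" using \<beta> h by simp
      also have "\<dots> = A m * (1 - \<alpha>)" using \<alpha> by (simp add: A_def)
      finally show ?thesis by (simp add: algebra_simps)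
    qed
    finally show "1 + (\<Sum>i=1..m. ?a i * A (m - i)) \<le> A m" .
  qed
  finally show ?case unfolding u_def A_def .
qed

lemma path_measurable[measurable (raw)]:
  assumes "f \<in> borel_measurable (Rd_borel d)" "x \<in> Rd d" "g \<in> borel_measurable N" "k \<in> measurable N M"
  shows "(\<lambda>z. f (Z x (g z) (k z))) \<in> borel_measurable N"
proof -
  have [measurable]: "x \<in> space (Rd_borel d)" using assms by (simp add: space_Rd_borel)
  note assms(1,3,4)[measurable]
  show ?thesis by measurable
qed

text \<open>Boundedness of f linearises the weight on a fine grid: exp(h f) \<le> 1 + h exp(h N) f.
  Once h N \<le> ln 2 the factor exp(h N) is at most 2, hence the 2 in the smallness
  condition.\<close>

lemma khasminskii_bounded:
  fixes f :: "vec \<Rightarrow> real"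
  assumes t: "0 < t" and \<eta>: "0 < \<eta>" "\<eta> \<le> 1" and \<beta>: "0 < \<beta>" and \<alpha>: "\<alpha> < 1" and K: "0 \<le> K"
    and f[measurable]: "f \<in> borel_measurable (Rd_borel d)" and f_bd: "\<And>y. 0 \<le> f y" "\<And>y. f y \<le> N"
    and kernel: "\<And>s x. 0 < s \<Longrightarrow> s \<le> t \<Longrightarrow> x \<in> Rd d \<Longrightarrow> P s (\<lambda>y. ennreal (f y)) x \<le> ennreal (K * s powr (\<eta> - 1))"
    and small: "2 * K * (1 / \<eta> + 1) * \<beta> powr (- \<eta>) \<le> \<alpha>" and x: "x \<in> Rd d"
  shows "(\<integral>\<^sup>+\<omega>. ennreal (exp (LINT s:{0..t}|lborel. f (Z x s \<omega>))) \<partial>M) \<le> ennreal (exp (\<beta> * t) / (1 - \<alpha>))"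
    (is "?L \<le> _")
proof -
  have N: "0 \<le> N" using f_bd[of x] by linarith
  define h where "h m = t / real (Suc m)" for m
  let ?J = "\<lambda>\<omega>. LINT s:{0..t}|lborel. f (Z x s \<omega>)"
  let ?C = "exp (\<beta> * t) / (1 - \<alpha>)"
  have h: "0 < h m" "real (Suc m) * h m = t" for m using t by (auto simp: h_def)
  have bound: "?L \<le> ennreal (exp (h m * N) * ?C)" if hN: "h m * N \<le> ln 2" for m
  proof -
    define c where "c = exp (h m * N)"
    \<comment> \<open>\<open>c\<close> plays two roles: it inflates f in the linearisation, and it
      bounds the weight at the first sample u, which may be the singular time 0. The second loss
      disappears as the mesh tends to 0.\<close>
    have c: "0 < c" "c \<le> 2" using hN by (auto simp: c_def ln_ge_iff[symmetric] simp flip: ln_le_cancel_iff[of "exp _" 2])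
    define q where "q y = ennreal (exp (h m * f y))" for y
    let ?Q = "\<lambda>u \<omega>. \<Prod>k\<le>m. q (Z x (u + real k * h m) \<omega>)"
    let ?U = "((\<lambda>v. P (h m) (\<lambda>z. q z * v z)) ^^ m) (\<lambda>_. 1)"
    have [measurable]: "q \<in> borel_measurable (Rd_borel d)" unfolding q_def by measurable
    have q_le_c: "q y \<le> ennreal c" for y
      unfolding q_def c_def using f_bd[of y] h(1)[of m] by (intro ennreal_leI) simp
    have q_le: "q y \<le> 1 + ennreal (h m) * ennreal (c * f y)" for y
    proof -
      define z where "z = h m * f y"
      have z: "0 \<le> z" using h(1)[of m] f_bd[of y] by (simp add: z_def)
      have "exp z * (1 - z) \<le> exp z * exp (- z)"
        using exp_ge_add_one_self[of "- z"] by (intro mult_left_mono) auto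
      then have "exp z \<le> 1 + z * exp z" by (simp add: exp_minus algebra_simps)
      also have "\<dots> \<le> 1 + z * c"
        using z f_bd[of y] h(1)[of m] by (auto simp: z_def c_def intro!: mult_left_mono)
      finally have "ennreal (exp z) \<le> ennreal (1 + h m * (c * f y))"
        by (intro ennreal_leI) (simp add: z_def mult_ac)
      then show ?thesis
        using h(1)[of m] c f_bd[of y] by (simp add: q_def z_def ennreal_mult)
    qed
    have iter: "?U y \<le> ennreal (exp (\<beta> * (real m * h m)) / (1 - \<alpha>))"
      if "y \<in> Rd d" for y
    proof (rule khasminskii_discrete[OF h(1) \<eta> \<beta> \<alpha> _ _ _ q_le, where K = "2 * K" and t = t])
      show "P s (\<lambda>y. ennreal (c * f y)) x \<le> ennreal (2 * K * s powr (\<eta> - 1))"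
        if "0 < s" "s \<le> t" "x \<in> Rd d" for s x
      proof -
        have "P s (\<lambda>y. ennreal (c * f y)) x = ennreal c * P s (\<lambda>y. ennreal (f y)) x"
          using c f_bd that by (simp add: ennreal_mult P_cmult)
        also have "\<dots> \<le> ennreal c * ennreal (K * s powr (\<eta> - 1))"
          by (intro mult_left_mono kernel that) simp
        also have "\<dots> \<le> ennreal 2 * ennreal (K * s powr (\<eta> - 1))"
          using c by (intro mult_right_mono ennreal_leI) auto
        also have "\<dots> = ennreal (2 * K * s powr (\<eta> - 1))"
          using K by (subst ennreal_mult[symmetric]) (auto simp: mult.assoc)
        finally show ?thesis .
      qed
      have "real m * h m \<le> real (Suc m) * h m" using h(1)[of m] by (intro mult_right_mono) auto
      then show "real m * h m \<le> t" using h(2) by simp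
    qed (use K small that in auto)
    have avg: "(\<integral>\<^sup>+\<omega>. ?Q u \<omega> \<partial>M) \<le> ennreal (c * ?C)"
      if u: "0 \<le> u" for u
    proof -
      have "(\<integral>\<^sup>+\<omega>. ?Q u \<omega> \<partial>M) =
          P u (\<lambda>y. q y * ?U y) x"
        using nn_integral_prod_grid[OF less_imp_le[OF h(1)] u x, of q "\<lambda>_. 1" m] by simp
      also have "\<dots> \<le> P u (\<lambda>y. ennreal c * ennreal ?C) x"
      proof (intro P_mono mult_mono q_le_c)
        fix y assume "y \<in> Rd d"
        then have "?U y \<le> ennreal (exp (\<beta> * (real m * h m)) / (1 - \<alpha>))"
          by (rule iter)
        also have "\<dots> \<le> ennreal ?C"
        proof (intro ennreal_leI divide_right_mono)
          have "real m * h m \<le> real (Suc m) * h m" using h(1)[of m] by (intro mult_right_mono) auto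
          then show "exp (\<beta> * (real m * h m)) \<le> exp (\<beta> * t)" using h(2) \<beta> by simp
        qed (use \<alpha> in auto)
        finally show "?U y \<le> ennreal ?C" .
      qed auto
      also have "\<dots> = ennreal (c * ?C)"
        using c \<alpha> by (simp add: P_const ennreal_mult[symmetric])
      finally show ?thesis .
    qed
    interpret pair_sigma_finite M lborel by unfold_locales
    have "?L \<le> (\<integral>\<^sup>+\<omega>. ennreal (1 / h m) * (\<integral>\<^sup>+u. ?Q u \<omega> * indicator {0..<h m} u \<partial>lborel) \<partial>M)"
    proof (rule nn_integral_mono)
      fix \<omega> assume \<omega>[measurable]: "\<omega> \<in> space M"
      have "(\<lambda>s. f (Z x s \<omega>)) \<in> borel_measurable borel" using x by measurable
      from exp_integral_le_shifted_average[OF h(1)[of m] this, of N m] f_bd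
      show "ennreal (exp (?J \<omega>)) \<le>
          ennreal (1 / h m) * (\<integral>\<^sup>+u. ?Q u \<omega> * indicator {0..<h m} u \<partial>lborel)"
        unfolding h(2) q_def by (simp add: prod_ennreal exp_sum sum_distrib_left)
    qed
    also have "\<dots> = ennreal (1 / h m) * (\<integral>\<^sup>+\<omega>. \<integral>\<^sup>+u. ?Q u \<omega> * indicator {0..<h m} u \<partial>lborel \<partial>M)"
      using x by (intro nn_integral_cmult) measurable
    also have "(\<integral>\<^sup>+\<omega>. \<integral>\<^sup>+u. ?Q u \<omega> * indicator {0..<h m} u \<partial>lborel \<partial>M) =
        (\<integral>\<^sup>+u. \<integral>\<^sup>+\<omega>. ?Q u \<omega> * indicator {0..<h m} u \<partial>M \<partial>lborel)"
      by (rule Fubini'[symmetric]) (use x in measurable)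
    also have "\<dots> \<le> (\<integral>\<^sup>+u. ennreal (c * ?C) * indicator {0..<h m} u \<partial>lborel)"
    proof (rule nn_integral_mono)
      fix u :: real
      have "(\<integral>\<^sup>+\<omega>. ?Q u \<omega> * indicator {0..<h m} u \<partial>M) =
          (\<integral>\<^sup>+\<omega>. ?Q u \<omega> \<partial>M) * indicator {0..<h m} u"
        using x by (intro nn_integral_multc) measurable
      also have "\<dots> \<le> ennreal (c * ?C) * indicator {0..<h m} u"
        using avg[of u] by (auto simp: indicator_def)
      finally show "(\<integral>\<^sup>+\<omega>. ?Q u \<omega> * indicator {0..<h m} u \<partial>M) \<le>
          ennreal (c * ?C) * indicator {0..<h m} u" .
    qed
    also have "\<dots> = ennreal (c * ?C) * ennreal (h m)"
      using h(1)[of m] by (subst nn_integral_cmult_indicator) auto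
    finally have "?L \<le> ennreal (1 / h m) * (ennreal (c * ?C) * ennreal (h m))"
      by (simp add: mult_left_mono)
    also have "\<dots> = ennreal (1 / h m * (c * ?C * h m))"
      using h(1)[of m] c \<alpha> by (simp add: ennreal_mult'[symmetric] del: times_divide_eq_left times_divide_eq_right)
    also have "1 / h m * (c * ?C * h m) = c * ?C"
      using h(1)[of m] by simp
    finally show ?thesis unfolding c_def .
  qed
  have h_lim: "(\<lambda>m. h m * N) \<longlonglongrightarrow> 0"
  proof -
    have "(\<lambda>m. t * N * inverse (real (Suc m))) \<longlonglongrightarrow> t * N * 0"
      by (intro tendsto_mult_left LIMSEQ_inverse_real_of_nat)
    then show ?thesis by (simp add: h_def field_simps)
  qed
  have "(\<lambda>m. exp (h m * N) * ?C) \<longlonglongrightarrow> exp 0 * ?C"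
    by (intro tendsto_mult_right tendsto_exp h_lim)
  then have "(\<lambda>m. ennreal (exp (h m * N) * ?C)) \<longlonglongrightarrow> ennreal ?C"
    by (intro tendsto_ennrealI) simp
  then show ?thesis
  proof (rule tendsto_lowerbound)
    have "\<forall>\<^sub>F m in sequentially. h m * N < ln 2"
      by (rule order_tendstoD(2)[OF h_lim]) simp
    then show "\<forall>\<^sub>F m in sequentially. ?L \<le> ennreal (exp (h m * N) * ?C)"
      by eventually_elim (rule bound, simp)
  qed simp
qed

text \<open>Truncation at height n and Fatou. Integrability along almost every path guarantees that
  the truncated path integrals converge to the untruncated one, whose value would be 0 by convention
  on a non-integrable path.\<close>

lemma khasminskii:
  fixes f :: "vec \<Rightarrow> real"
  assumes t: "0 < t" and \<eta>: "0 < \<eta>" "\<eta> \<le> 1" and \<beta>: "0 < \<beta>" and \<alpha>: "\<alpha> < 1" and K: "0 \<le> K"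
    and f[measurable]: "f \<in> borel_measurable (Rd_borel d)" and f_nn: "\<And>y. 0 \<le> f y"
    and kernel: "\<And>s x. 0 < s \<Longrightarrow> s \<le> t \<Longrightarrow> x \<in> Rd d \<Longrightarrow> P s (\<lambda>y. ennreal (f y)) x \<le> ennreal (K * s powr (\<eta> - 1))"
    and small: "2 * K * (1 / \<eta> + 1) * \<beta> powr (- \<eta>) \<le> \<alpha>" and x: "x \<in> Rd d"
    and int: "AE \<omega> in M. set_integrable lborel {0..t} (\<lambda>s. f (Z x s \<omega>))"
  shows "(\<integral>\<^sup>+\<omega>. ennreal (exp (LINT s:{0..t}|lborel. f (Z x s \<omega>))) \<partial>M) \<le> ennreal (exp (\<beta> * t) / (1 - \<alpha>))"
proof -
  define g where "g n y = min (f y) (real n)" for n y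
  let ?J = "\<lambda>\<omega>. LINT s:{0..t}|lborel. f (Z x s \<omega>)"
  have g_meas[measurable]: "g n \<in> borel_measurable (Rd_borel d)" for n unfolding g_def by measurable
  define I where "I n \<omega> = (LINT s:{0..t}|lborel. g n (Z x s \<omega>))" for n \<omega>
  have [measurable]: "(\<lambda>\<omega>. ennreal (exp (I n \<omega>))) \<in> borel_measurable M" for n
    unfolding I_def set_lebesgue_integral_def using x by measurable
  have bound: "(\<integral>\<^sup>+\<omega>. ennreal (exp (I n \<omega>)) \<partial>M) \<le> ennreal (exp (\<beta> * t) / (1 - \<alpha>))" for n
    unfolding I_def
  proof (rule khasminskii_bounded[OF t \<eta> \<beta> \<alpha> K g_meas _ _ _ small x, where N = "real n"])
    fix s y assume s: "0 < s" "s \<le> t" "y \<in> Rd d"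
    have "P s (\<lambda>y. ennreal (g n y)) y \<le> P s (\<lambda>y. ennreal (f y)) y"
      by (intro P_mono ennreal_leI) (simp add: g_def)
    also have "\<dots> \<le> ennreal (K * s powr (\<eta> - 1))" by (rule kernel[OF s])
    finally show "P s (\<lambda>y. ennreal (g n y)) y \<le> ennreal (K * s powr (\<eta> - 1))" .
  qed (use f_nn in \<open>auto simp: g_def\<close>)
  have "(\<integral>\<^sup>+\<omega>. ennreal (exp (?J \<omega>)) \<partial>M) =
      (\<integral>\<^sup>+\<omega>. liminf (\<lambda>n. ennreal (exp (I n \<omega>))) \<partial>M)"
  proof (rule nn_integral_cong_AE)
    show "AE \<omega> in M. ennreal (exp (?J \<omega>)) = liminf (\<lambda>n. ennreal (exp (I n \<omega>)))"
      using int AE_space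
    proof eventually_elim
      fix \<omega> assume int: "set_integrable lborel {0..t} (\<lambda>s. f (Z x s \<omega>))" and [measurable]: "\<omega> \<in> space M"
      have "(\<lambda>n. I n \<omega>) \<longlonglongrightarrow> (?J \<omega>)"
        unfolding I_def set_lebesgue_integral_def
      proof (rule integral_dominated_convergence)
        show "integrable lborel (\<lambda>s. indicator {0..t} s *\<^sub>R f (Z x s \<omega>))"
          using int by (simp add: set_integrable_def)
        show "AE s in lborel. (\<lambda>n. indicator {0..t} s *\<^sub>R g n (Z x s \<omega>)) \<longlonglongrightarrow> indicator {0..t} s *\<^sub>R f (Z x s \<omega>)"
        proof (intro AE_I2 tendsto_scaleR tendsto_const tendsto_eventually)
          fix s
          obtain n where "f (Z x s \<omega>) \<le> real n" using real_arch_simple by blast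
          then have "g k (Z x s \<omega>) = f (Z x s \<omega>)" if "n \<le> k" for k
            using that by (simp add: g_def min_def)
          then show "\<forall>\<^sub>F k in sequentially. g k (Z x s \<omega>) = f (Z x s \<omega>)"
            unfolding eventually_sequentially by blast
        qed
        show "AE s in lborel. norm (indicator {0..t} s *\<^sub>R g n (Z x s \<omega>)) \<le> indicator {0..t} s *\<^sub>R f (Z x s \<omega>)" for n
          using f_nn by (intro AE_I2) (auto simp: indicator_def g_def)
      qed (use x in measurable)
      then have "(\<lambda>n. ennreal (exp (I n \<omega>))) \<longlonglongrightarrow> ennreal (exp (?J \<omega>))"
        by (intro tendsto_ennrealI tendsto_exp)
      then show "ennreal (exp (?J \<omega>)) = liminf (\<lambda>n. ennreal (exp (I n \<omega>)))"
        by (rule lim_imp_Liminf[symmetric, rotated]) simp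
    qed
  qed
  also have "\<dots> \<le> liminf (\<lambda>n. \<integral>\<^sup>+\<omega>. ennreal (exp (I n \<omega>)) \<partial>M)"
    by (rule nn_integral_liminf) measurable
  also have "\<dots> \<le> ennreal (exp (\<beta> * t) / (1 - \<alpha>))"
    using bound by (intro Liminf_le) auto
  finally show ?thesis .
qed

end

section \<open>Geometry of convex domains\<close>

lemma topspace_Rd_top: "topspace (Rd_top d) = Rd d"
  by (simp add: Rd_top_def Rd_def)

lemma Rd_dist_coord_le: "i < d \<Longrightarrow> \<bar>x i - y i\<bar> \<le> Rd_dist d x y"
  unfolding Rd_dist_def L2_set_def
  by (intro real_le_rsqrt) (auto intro!: member_le_sum[of i "{..<d}" "\<lambda>i. (x i - y i)\<^sup>2"])

lemma Rd_dist_sq: "(Rd_dist d x y)\<^sup>2 = (\<Sum>i<d. (y i - x i)\<^sup>2)"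
  by (simp add: Rd_dist_def L2_set_def sum_nonneg power2_commute)

lemma Rd_dist_update:
  "0 < d \<Longrightarrow> Rd_dist d x (\<lambda>i\<in>{..<d}. if i = 0 then x 0 + a else x i) = \<bar>a\<bar>"
proof -
  assume "0 < d"
  have "(\<Sum>i<d. (x i - (\<lambda>i\<in>{..<d}. if i = 0 then x 0 + a else x i) i)\<^sup>2) = (\<Sum>i<d. if i = 0 then a\<^sup>2 else 0)"
    by (intro sum.cong) auto
  also have "\<dots> = a\<^sup>2" using \<open>0 < d\<close> by simp
  finally show ?thesis by (simp add: Rd_dist_def L2_set_def)
qed

lemma openin_Rd_ball:
  assumes "openin (Rd_top d) D" "x \<in> D"
  obtains \<epsilon> where "0 < \<epsilon>" "Rd_ball d x \<epsilon> \<subseteq> D"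
proof -
  obtain U where U: "\<And>i. i < d \<Longrightarrow> open (U i)" "x \<in> Pi\<^sub>E {..<d} U" "Pi\<^sub>E {..<d} U \<subseteq> D"
    using assms unfolding Rd_top_def openin_product_topology_alt by (auto, metis lessThan_iff)
  have "\<exists>e>0. \<forall>z. \<bar>x i - z\<bar> < e \<longrightarrow> z \<in> U i" if "i < d" for i
  proof -
    have "x i \<in> U i" using U(2) that by auto
    then have "\<exists>e>0. \<forall>z. dist z (x i) < e \<longrightarrow> z \<in> U i"
      using U(1)[OF that] unfolding open_dist by blast
    then show ?thesis by (simp add: dist_real_def abs_minus_commute)
  qed
  then obtain e where e: "\<And>i. i < d \<Longrightarrow> 0 < e i" "\<And>i z. i < d \<Longrightarrow> \<bar>x i - z\<bar> < e i \<Longrightarrow> z \<in> U i"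
    by metis
  define \<epsilon> where "\<epsilon> = Min (insert 1 (e ` {..<d}))"
  have "0 < \<epsilon>" unfolding \<epsilon>_def using e(1) by (subst Min_gr_iff) auto
  moreover have "Rd_ball d x \<epsilon> \<subseteq> D"
  proof
    fix z assume z: "z \<in> Rd_ball d x \<epsilon>"
    have "z i \<in> U i" if "i < d" for i
    proof (rule e(2)[OF that])
      have "\<bar>x i - z i\<bar> < \<epsilon>" using Rd_dist_coord_le[OF that, of x z] z by (simp add: Rd_ball_def)
      also have "\<epsilon> \<le> e i" unfolding \<epsilon>_def using that by (intro Min_le) auto
      finally show "\<bar>x i - z i\<bar> < e i" .
    qed
    then have "z \<in> Pi\<^sub>E {..<d} U" using z by (auto simp: Rd_ball_def Rd_def PiE_iff)
    then show "z \<in> D" using U(3) by blast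
  qed
  ultimately show ?thesis by (rule that)
qed

text \<open>Extension by zero, \<open>J\<close>, and restriction move the set to the space of all
  functions on the naturals; there open sets are Borel, and \<open>J\<close> is measurable because
  each of its coordinates is.\<close>

lemma openin_Rd_measurable:
  assumes "openin (Rd_top d) D"
  shows "D \<in> sets (Rd_borel d)"
proof -
  have D: "D \<subseteq> Rd d" using openin_subset[OF assms] by (simp add: topspace_Rd_top)
  define J where "J x = (\<lambda>i. if i < d then x i else 0)" for x :: vec
  have "continuous_map euclidean (Rd_top d) (\<lambda>x. restrict x {..<d})"
    unfolding Rd_top_def continuous_map_componentwise
    by (auto intro: continuous_on_product_coordinates simp: continuous_map_iff_continuous2)
  from openin_continuous_map_preimage[OF this assms]
  have "open {x :: vec. restrict x {..<d} \<in> D}" by simp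
  then have "{x :: vec. restrict x {..<d} \<in> D} \<in> sets borel" by (rule borel_open)
  moreover have "J \<in> borel_measurable (Rd_borel d)"
  proof (rule measurable_coordinatewise_then_product)
    fix i
    show "(\<lambda>x. J x i) \<in> borel_measurable (Rd_borel d)"
      by (cases "i < d") (auto simp: J_def intro!: measurable_component_singleton)
  qed
  ultimately have "J -` {x. restrict x {..<d} \<in> D} \<inter> space (Rd_borel d) \<in> sets (Rd_borel d)"
    by (rule measurable_sets[rotated])
  also have "J -` {x. restrict x {..<d} \<in> D} \<inter> space (Rd_borel d) = D"
  proof -
    have "restrict (J x) {..<d} = x" if "x \<in> Rd d" for x
      using that by (auto simp: J_def Rd_def PiE_def extensional_def fun_eq_iff)
    then show ?thesis using D unfolding space_Rd_borel by auto
  qed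
  finally show ?thesis .
qed

lemma frontier_Rd:
  assumes "openin (Rd_top d) D" "y \<in> (Rd_top d) frontier_of D"
  shows "y \<in> Rd d" "y \<notin> D"
proof -
  show "y \<in> Rd d" using assms(2) frontier_of_subset_topspace[of "Rd_top d" D] by (auto simp: topspace_Rd_top)
  show "y \<notin> D" using assms by (simp add: frontier_of_def interior_of_openin)
qed

text \<open>By connectedness a nonempty set with empty frontier is the whole space, which is
  unbounded in direction 0 as soon as d \<ge> 1. This gives meaning to the infimum in
  \<open>boundary_dist\<close>.\<close>

lemma frontier_Rd_nonempty:
  assumes "openin (Rd_top d) D" "Rd_bounded d D" "D \<noteq> {}" "1 \<le> d"
  shows "(Rd_top d) frontier_of D \<noteq> {}"
proof
  assume "(Rd_top d) frontier_of D = {}"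
  moreover have "connected_space (Rd_top d)"
    unfolding Rd_top_def connected_space_product_topology
    using connectedin_topspace[of euclideanreal] by simp
  moreover have "D \<subseteq> topspace (Rd_top d)" using openin_subset[OF assms(1)] .
  ultimately have "D = Rd d"
    using assms(3) connected_space_frontier_eq_empty topspace_Rd_top by metis
  obtain K where K: "\<And>x y. x \<in> D \<Longrightarrow> y \<in> D \<Longrightarrow> Rd_dist d x y \<le> K"
    using assms(2) by (auto simp: Rd_bounded_def)
  obtain x where "x \<in> D" using assms(3) by auto
  moreover have "(\<lambda>i\<in>{..<d}. if i = 0 then x 0 + (\<bar>K\<bar> + 1) else x i) \<in> D"
    unfolding \<open>D = Rd d\<close> by (simp add: Rd_def)
  ultimately have "\<bar>\<bar>K\<bar> + 1\<bar> \<le> K"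
    using K Rd_dist_update[of d x "\<bar>K\<bar> + 1"] assms(4) by (metis less_le_trans zero_less_one)
  then show False by simp
qed

lemma boundary_dist_le:
  assumes "y \<in> (Rd_top d) frontier_of D"
  shows "boundary_dist d D x \<le> Rd_dist d x y"
  unfolding boundary_dist_def
  by (rule cINF_lower[OF _ assms]) (auto intro!: bdd_belowI[of _ 0] simp: Rd_dist_def L2_set_nonneg)

lemma boundary_dist_pos:
  assumes "openin (Rd_top d) D" "Rd_bounded d D" "1 \<le> d" "x \<in> D"
  shows "0 < boundary_dist d D x"
proof -
  obtain \<epsilon> where \<epsilon>: "0 < \<epsilon>" "Rd_ball d x \<epsilon> \<subseteq> D" using openin_Rd_ball[OF assms(1,4)] .
  have "\<epsilon> \<le> boundary_dist d D x"
    unfolding boundary_dist_def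
  proof (rule cINF_greatest)
    show "(Rd_top d) frontier_of D \<noteq> {}" using frontier_Rd_nonempty assms by blast
    fix y assume "y \<in> (Rd_top d) frontier_of D"
    then show "\<epsilon> \<le> Rd_dist d x y" using frontier_Rd[OF assms(1)] \<epsilon>(2) by (force simp: Rd_ball_def)
  qed
  then show ?thesis using \<epsilon>(1) by simp
qed

text \<open>A factor sqrt 2 above the infimum is enough for \<open>prob_escape\<close>, so no point
  realising the distance is required.\<close>

lemma near_boundary_point:
  assumes "openin (Rd_top d) D" "Rd_bounded d D" "1 \<le> d" "x \<in> D"
  obtains y where "y \<in> Rd d" "y \<notin> D" "(\<Sum>i<d. (y i - x i)\<^sup>2) \<le> 2 * (boundary_dist d D x)\<^sup>2"
proof -
  let ?r = "boundary_dist d D x"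
  have r: "0 < ?r" by (rule boundary_dist_pos[OF assms])
  then have "?r < sqrt 2 * ?r" by simp
  moreover have "(Rd_top d) frontier_of D \<noteq> {}" using frontier_Rd_nonempty assms by blast
  ultimately obtain y where y: "y \<in> (Rd_top d) frontier_of D" "Rd_dist d x y < sqrt 2 * ?r"
    unfolding boundary_dist_def
    by (subst (asm) cINF_less_iff) (auto intro!: bdd_belowI[of _ 0] simp: Rd_dist_def L2_set_nonneg)
  have "(Rd_dist d x y)\<^sup>2 \<le> (sqrt 2 * ?r)\<^sup>2"
    using y(2) by (intro power_mono) (auto simp: Rd_dist_def L2_set_nonneg)
  then have "(\<Sum>i<d. (y i - x i)\<^sup>2) \<le> 2 * ?r\<^sup>2" by (simp add: Rd_dist_sq power_mult_distrib)
  then show ?thesis using frontier_Rd[OF assms(1) y(1)] that by blast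
qed

text \<open>The segment from x to a point outside \<open>D\<close> is connected and has to cross the
  frontier, at a point no farther from x than its end.\<close>

lemma ball_boundary_dist_subset:
  assumes "openin (Rd_top d) D" "x \<in> D"
  shows "Rd_ball d x (boundary_dist d D x) \<subseteq> D"
proof (rule subsetI, rule ccontr)
  fix z assume z: "z \<in> Rd_ball d x (boundary_dist d D x)" "z \<notin> D"
  have x: "x \<in> Rd d" using openin_subset[OF assms(1)] assms(2) by (auto simp: topspace_Rd_top)
  define p where "p \<theta> = (\<lambda>i\<in>{..<d}. (1 - \<theta>) * x i + \<theta> * z i)" for \<theta> :: real
  have "continuous_map euclideanreal (Rd_top d) p"
    unfolding Rd_top_def continuous_map_componentwise
    by (auto simp: p_def continuous_map_iff_continuous2 intro!: continuous_intros)
  then have con: "connectedin (Rd_top d) (p ` {0..1})"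
    by (rule connectedin_continuous_map_image) (simp add: connectedin_iff_connected)
  have p01: "p 0 = x" "p 1 = z"
    using x z(1) by (auto simp: p_def Rd_def Rd_ball_def PiE_def extensional_def fun_eq_iff)
  have "x \<in> p ` {0..1} \<inter> D" "z \<in> p ` {0..1} - D"
    using p01 assms(2) z(2) by force+
  then obtain w where w: "w \<in> p ` {0..1}" "w \<in> (Rd_top d) frontier_of D"
    using connectedin_Int_frontier_of[OF con, of D] by blast
  then obtain \<theta> where \<theta>: "0 \<le> \<theta>" "\<theta> \<le> 1" "w = p \<theta>" by auto
  have "Rd_dist d x w = L2_set (\<lambda>i. \<theta> * (x i - z i)) {..<d}"
    unfolding Rd_dist_def by (intro L2_set_cong) (auto simp: \<theta> p_def algebra_simps)
  also have "\<dots> = \<theta> * Rd_dist d x z"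
    using \<theta> by (simp add: Rd_dist_def L2_set_right_distrib)
  also have "\<dots> \<le> Rd_dist d x z"
    using \<theta> by (simp add: mult_left_le_one_le Rd_dist_def L2_set_nonneg)
  also have "\<dots> < boundary_dist d D x" using z(1) by (simp add: Rd_ball_def)
  finally show False using boundary_dist_le[OF w(2), of x] by simp
qed

lemma boundary_dist_le_inradius:
  assumes "openin (Rd_top d) D" "Rd_bounded d D" "1 \<le> d" "x \<in> D"
  shows "boundary_dist d D x \<le> inradius d D"
  unfolding inradius_def
proof (rule cSup_upper)
  have "x \<in> Rd d" using openin_subset[OF assms(1)] assms(4) by (auto simp: topspace_Rd_top)
  then show "boundary_dist d D x \<in> {\<rho>. 0 < \<rho> \<and> (\<exists>x\<in>Rd d. Rd_ball d x \<rho> \<subseteq> D)}"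
    using boundary_dist_pos[OF assms] ball_boundary_dist_subset[OF assms(1,4)] by blast
  obtain K where K: "\<And>x y. x \<in> D \<Longrightarrow> y \<in> D \<Longrightarrow> Rd_dist d x y \<le> K"
    using assms(2) by (auto simp: Rd_bounded_def)
  \<comment> \<open>The supremum defining the inradius is meaningful: a ball of radius \<rho>
    contains two points at distance \<rho>/2, so \<rho> is at most twice the diameter bound.\<close>
  show "bdd_above {\<rho>. 0 < \<rho> \<and> (\<exists>x\<in>Rd d. Rd_ball d x \<rho> \<subseteq> D)}"
  proof (rule bdd_aboveI[of _ "2 * K"])
    fix \<rho> assume "\<rho> \<in> {\<rho>. 0 < \<rho> \<and> (\<exists>x\<in>Rd d. Rd_ball d x \<rho> \<subseteq> D)}"
    then obtain c where c: "0 < \<rho>" "c \<in> Rd d" "Rd_ball d c \<rho> \<subseteq> D" by auto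
    let ?y = "\<lambda>i\<in>{..<d}. if i = 0 then c 0 + \<rho> / 2 else c i"
    have dist: "Rd_dist d c ?y = \<rho> / 2" using Rd_dist_update[of d c "\<rho> / 2"] assms(3) c(1) by simp
    have "c \<in> Rd_ball d c \<rho>" "?y \<in> Rd_ball d c \<rho>"
      using c(1,2) dist by (auto simp: Rd_ball_def Rd_dist_def L2_set_def Rd_def)
    then have "Rd_dist d c ?y \<le> K" using c(3) by (intro K) auto
    then show "\<rho> \<le> 2 * K" using dist by simp
  qed
qed

section \<open>Proof of the eigenvalue estimate\<close>

text \<open>The dimension-free \<delta> produced by \<open>prob_escape\<close>.\<close>

definition escape_prob :: real where
  "escape_prob = (1 - exp (- 1)) * exp (- 1) / 4"

lemma escape_prob: "0 < escape_prob" "escape_prob < 1"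
proof -
  have e: "0 < exp (- 1 :: real)" "exp (- 1 :: real) < 1" by auto
  then show "0 < escape_prob" by (simp add: escape_prob_def)
  have "(1 - exp (- 1)) * exp (- 1) \<le> 1 * (1::real)" using e by (intro mult_mono) auto
  then show "escape_prob < 1" by (simp add: escape_prob_def)
qed

text \<open>The factor of \<open>negative_moment_S\<close> for a = d/2 and b = c T
  \<Psi>(T^(-1/\<mu>)), raised to the power 1/p by the passage through the L^p norm.\<close>

definition heat_const :: "(real \<Rightarrow> real) \<Rightarrow> nat \<Rightarrow> real \<Rightarrow> real \<Rightarrow> real \<Rightarrow> real \<Rightarrow> real" where
  "heat_const \<Psi> d \<mu> c T p =
     (1 + exp 1 * (real d / 2) * (((real d / 2 + 1) / \<mu>) / (c * T * \<Psi> (T powr (- 1 / \<mu>)))) powr ((real d / 2 + 1) / \<mu>))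
       powr (1 / p)"

lemma heat_const_pos: "0 < heat_const \<Psi> d \<mu> c T p"
proof -
  have "0 < 1 + exp 1 * (real d / 2) * (((real d / 2 + 1) / \<mu>) / (c * T * \<Psi> (T powr (- 1 / \<mu>)))) powr ((real d / 2 + 1) / \<mu>)"
    by (intro add_pos_nonneg) auto
  then show ?thesis by (simp add: heat_const_def)
qed

context subordinate_brownian
begin

text \<open>Scaling from u1 = T^(-1/\<mu>) gives \<Psi>(u) \<ge> b u^\<mu> for u \<ge> u1, since
  u1^(-\<mu>) = T. The cutoff s^(-1/\<mu>) of the moment bound stays in that range because s \<le>
  T. The p-th root of s^(-d/(2 \<mu>)) is s^(\<eta>-1).\<close>

lemma kernel_bound:
  fixes g :: "vec \<Rightarrow> real"
  assumes scal: "lower_scaling \<Psi> \<mu> c" and \<mu>: "0 < \<mu>" and c: "0 < c" and pos: "\<And>u. 0 < u \<Longrightarrow> 0 < \<Psi> u"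
    and s: "0 < s" "s \<le> T" and p: "1 \<le> p" and \<eta>: "\<eta> = 1 - real d / (2 * \<mu> * p)" and N: "0 < N"
    and g[measurable]: "g \<in> borel_measurable (Rd_borel d)" and g_nn: "\<And>y. 0 \<le> g y"
    and norm: "(\<integral>\<^sup>+y. ennreal (g y powr p) \<partial>Rd_lborel d) \<le> ennreal (N powr p)" and x: "x \<in> Rd d"
  shows "P s (\<lambda>y. ennreal (g y)) x \<le> ennreal (heat_const \<Psi> d \<mu> c T p * N * s powr (\<eta> - 1))"
proof -
  define a u1 b k C0 where "a = real d / 2" and "u1 = T powr (- 1 / \<mu>)" and "b = c * T * \<Psi> u1"
    and "k = (a + 1) / \<mu>" and "C0 = 1 + exp 1 * a * (k / b) powr k"
  have T: "0 < T" using s by simp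
  have u1: "0 < u1" using T by (simp add: u1_def)
  have b: "0 < b" using c T pos[OF u1] by (simp add: b_def)
  have a: "0 < a" using dim_pos by (simp add: a_def)
  have C0: "0 < C0" unfolding C0_def using a by (intro add_pos_nonneg) auto
  have C1: "heat_const \<Psi> d \<mu> c T p = C0 powr (1 / p)"
    by (simp add: heat_const_def C0_def k_def b_def a_def u1_def)
  have low1: "b * u powr \<mu> \<le> \<Psi> u" if "u1 \<le> u" for u
  proof -
    have "c * (u / u1) powr \<mu> * \<Psi> u1 \<le> \<Psi> (u / u1 * u1)"
      using scal[unfolded lower_scaling_def, rule_format, of u1 "u / u1"] u1 that by (simp add: le_divide_eq)
    moreover have "(u / u1) powr \<mu> = u powr \<mu> * T"
    proof -
      have "u1 powr \<mu> = 1 / T"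
        unfolding u1_def powr_powr using T \<mu> by (simp add: powr_neg_one)
      then show ?thesis using u1 that by (simp add: powr_divide)
    qed
    ultimately show ?thesis using u1 by (simp add: b_def mult_ac)
  qed
  have low: "b * u powr \<mu> \<le> \<Psi> u" if "s powr (- 1 / \<mu>) \<le> u" for u
  proof (rule low1)
    have "u1 \<le> s powr (- 1 / \<mu>)"
      unfolding u1_def using s \<mu> by (intro powr_mono2') auto
    then show "u1 \<le> u" using that by simp
  qed
  \<comment> \<open>\<open>B\<close> is the p-th root of the product of the moment bound and the
    norm bound, which is what \<open>P_le_Lp\<close> asks for.\<close>
  define B where "B = heat_const \<Psi> d \<mu> c T p * N * s powr (\<eta> - 1)"
  have B: "0 < B" using C0 N s by (simp add: B_def C1)
  have p_exp: "\<eta> - 1 = - a / \<mu> * (1 / p)" using p \<mu> by (simp add: \<eta> a_def)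
  have Bp: "B powr p = C0 * s powr (- a / \<mu>) * N powr p"
    unfolding B_def C1 p_exp using C0 N s p by (simp add: powr_mult powr_powr mult_ac)
  have "P s (\<lambda>y. ennreal (g y powr p)) x \<le>
      (\<integral>\<^sup>+\<omega>. ennreal (S s \<omega> powr (- (real d / 2))) \<partial>M) * (\<integral>\<^sup>+y. ennreal (g y powr p) \<partial>Rd_lborel d)"
    using s by (intro P_le_heat AE_S_pos[OF s(1) b \<mu> low1] x) auto
  also have "\<dots> \<le> ennreal (C0 * s powr (- a / \<mu>)) * ennreal (N powr p)"
    using negative_moment_S[OF s(1) b \<mu> a low] by (intro mult_mono norm) (auto simp: a_def C0_def k_def)
  also have "\<dots> = ennreal (B powr p)" using C0 by (simp add: Bp ennreal_mult[symmetric])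
  finally show ?thesis unfolding B_def[symmetric]
    by (intro P_le_Lp[OF p B g g_nn x])
qed

text \<open>The Kato condition bounds the expected integral over one short window uniformly in the
  starting point. The semigroup law carries the bound to every later window, and finitely many
  windows cover [0, t].\<close>

lemma kato_path_integrable:
  assumes V: "V \<in> kato_space M d S B" and x: "x \<in> Rd d" and "0 \<le> t"
  shows "AE \<omega> in M. set_integrable lborel {0..t} (\<lambda>s. V (Z x s \<omega>))"
proof -
  have [measurable]: "V \<in> borel_measurable (Rd_borel d)"
    using V by (simp add: kato_space_def cong: measurable_cong_sets[OF sets_Rd_lborel refl])
  define f where "f y = ennreal \<bar>V y\<bar>" for y
  have [measurable]: "f \<in> borel_measurable (Rd_borel d)" unfolding f_def by measurable
  interpret pair_sigma_finite M lborel by unfold_locales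
  have sx[measurable]: "x \<in> space (Rd_borel d)" using x by (simp add: space_Rd_borel)
  let ?K = "\<lambda>t. SUP x\<in>Rd d. \<integral>\<^sup>+\<omega>. (\<integral>\<^sup>+s\<in>{0..t}. ennreal \<bar>V (sbm d S B x s \<omega>)\<bar> \<partial>lborel) \<partial>M"
  have "\<forall>\<^sub>F t in at_right 0. ?K t < 1"
    using V unfolding kato_space_def by (intro order_tendstoD(2)[of _ 0]) auto
  then obtain t1 where t1: "0 < t1"
    "\<And>t. 0 < t \<Longrightarrow> t < t1 \<Longrightarrow> ?K t < 1"
    unfolding eventually_at_right_field by auto
  define t0 where "t0 = t1 / 2"
  have t0: "0 < t0" using t1 by (simp add: t0_def)
  have swap: "(\<integral>\<^sup>+s. P s f y * indicator A s \<partial>lborel) = (\<integral>\<^sup>+\<omega>. \<integral>\<^sup>+s. f (Z y s \<omega>) * indicator A s \<partial>lborel \<partial>M)"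
    if [measurable]: "y \<in> Rd d" "A \<in> sets borel" for y A
  proof -
    have "(\<integral>\<^sup>+s. P s f y * indicator A s \<partial>lborel) = (\<integral>\<^sup>+s. \<integral>\<^sup>+\<omega>. f (Z y s \<omega>) * indicator A s \<partial>M \<partial>lborel)"
      unfolding P_def using that by (intro nn_integral_cong nn_integral_multc[symmetric]) measurable
    also have "\<dots> = (\<integral>\<^sup>+\<omega>. \<integral>\<^sup>+s. f (Z y s \<omega>) * indicator A s \<partial>lborel \<partial>M)"
      by (rule Fubini') (use that in measurable)
    finally show ?thesis .
  qed
  have unit: "(\<integral>\<^sup>+s. P s f y * indicator {0..<t0} s \<partial>lborel) \<le> 1" if y: "y \<in> Rd d" for y
  proof -
    have "(\<integral>\<^sup>+s. P s f y * indicator {0..<t0} s \<partial>lborel) = (\<integral>\<^sup>+\<omega>. \<integral>\<^sup>+s. f (Z y s \<omega>) * indicator {0..<t0} s \<partial>lborel \<partial>M)"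
      by (rule swap[OF y]) simp
    also have "\<dots> \<le> (\<integral>\<^sup>+\<omega>. (\<integral>\<^sup>+s\<in>{0..t0}. ennreal \<bar>V (sbm d S B y s \<omega>)\<bar> \<partial>lborel) \<partial>M)"
      by (intro nn_integral_mono) (auto simp: f_def sbm_eq split: split_indicator)
    also have "\<dots> \<le> ?K t0"
      by (rule SUP_upper[OF y])
    also have "\<dots> \<le> 1" using t1 by (intro less_imp_le t1(2)) (auto simp: t0_def)
    finally show ?thesis .
  qed
  have joint[measurable]: "(\<lambda>z. P (fst z) f (snd z)) \<in> borel_measurable (borel \<Otimes>\<^sub>M Rd_borel d)"
    unfolding P_def by measurable
  have Ps[measurable]: "(\<lambda>s. P s f x) \<in> borel_measurable borel"
    unfolding P_def by measurable
  have total: "(\<integral>\<^sup>+s. P s f x * indicator {0..<real n * t0} s \<partial>lborel) \<le> of_nat n" for n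
  proof (induction n)
    case (Suc n)
    have n: "0 \<le> real n * t0" using t0 by simp
    let ?q = "\<lambda>s. P s f x * indicator {real n * t0..<real (Suc n) * t0} s"
    have "(\<integral>\<^sup>+s. ?q s \<partial>lborel) =
        (\<integral>\<^sup>+u. P (real n * t0 + u) f x * indicator {0..<t0} u \<partial>lborel)"
      by (subst nn_integral_real_affine[where c = 1 and t = "real n * t0"])
        (auto intro!: nn_integral_cong simp: indicator_def algebra_simps)
    \<comment> \<open>The process restarts at time n t0: the window becomes an average over the
      position reached, to which the bound \<open>unit\<close> applies.\<close>
    also have "\<dots> = (\<integral>\<^sup>+u. P (real n * t0) (P u f) x * indicator {0..<t0} u \<partial>lborel)"
      by (intro nn_integral_cong) (auto simp: P_semigroup[OF n _ x] split: split_indicator)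
    also have "\<dots> = (\<integral>\<^sup>+u. \<integral>\<^sup>+\<omega>. P u f (Z x (real n * t0) \<omega>) * indicator {0..<t0} u \<partial>M \<partial>lborel)"
      unfolding P_def[of "real n * t0"] by (intro nn_integral_cong nn_integral_multc[symmetric]) measurable
    also have "\<dots> = (\<integral>\<^sup>+\<omega>. \<integral>\<^sup>+u. P u f (Z x (real n * t0) \<omega>) * indicator {0..<t0} u \<partial>lborel \<partial>M)"
    proof (rule Fubini')
      have "(\<lambda>z. P (snd z) f (Z x (real n * t0) (fst z))) \<in> borel_measurable (M \<Otimes>\<^sub>M lborel)"
        using measurable_compose[OF _ joint, of "\<lambda>z. (snd z, Z x (real n * t0) (fst z))" "M \<Otimes>\<^sub>M lborel"]
        by simp
      then show "(\<lambda>(\<omega>, u). P u f (Z x (real n * t0) \<omega>) * indicator {0..<t0} u) \<in> borel_measurable (M \<Otimes>\<^sub>M lborel)"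
        by (simp add: case_prod_beta')
    qed
    also have "\<dots> \<le> (\<integral>\<^sup>+\<omega>. 1 \<partial>M)"
      by (intro nn_integral_mono unit) simp
    finally have piece: "(\<integral>\<^sup>+s. ?q s \<partial>lborel) \<le> 1"
      by (simp add: emeasure_space_1)
    have "(\<integral>\<^sup>+s. P s f x * indicator {0..<real (Suc n) * t0} s \<partial>lborel) =
        (\<integral>\<^sup>+s. (P s f x * indicator {0..<real n * t0} s + ?q s) \<partial>lborel)"
    proof (intro nn_integral_cong)
      fix s :: real
      have "real n * t0 \<le> real (Suc n) * t0" using t0 by (intro mult_right_mono) auto
      then show "P s f x * indicator {0..<real (Suc n) * t0} s =
          P s f x * indicator {0..<real n * t0} s + ?q s"
        using n by (auto simp: indicator_def)
    qed
    also have "\<dots> = (\<integral>\<^sup>+s. P s f x * indicator {0..<real n * t0} s \<partial>lborel) +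
        (\<integral>\<^sup>+s. ?q s \<partial>lborel)"
      by (rule nn_integral_add) measurable
    also have "\<dots> \<le> of_nat n + 1" by (rule add_mono[OF Suc piece])
    finally show ?case by (simp add: add.commute)
  qed simp
  obtain n where n: "t < real n * t0" using ex_less_of_nat_mult[OF t0] by blast
  have "(\<integral>\<^sup>+\<omega>. \<integral>\<^sup>+s. f (Z x s \<omega>) * indicator {0..t} s \<partial>lborel \<partial>M) \<le>
      (\<integral>\<^sup>+\<omega>. \<integral>\<^sup>+s. f (Z x s \<omega>) * indicator {0..<real n * t0} s \<partial>lborel \<partial>M)"
    using n by (intro nn_integral_mono) (auto split: split_indicator)
  also have "\<dots> \<le> of_nat n" using total[of n] swap[OF x, of "{0..<real n * t0}"] by simp
  finally have "(\<integral>\<^sup>+\<omega>. \<integral>\<^sup>+s. f (Z x s \<omega>) * indicator {0..t} s \<partial>lborel \<partial>M) \<noteq> \<infinity>"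
    by (auto simp: top_unique)
  then have "AE \<omega> in M. (\<integral>\<^sup>+s. f (Z x s \<omega>) * indicator {0..t} s \<partial>lborel) \<noteq> \<infinity>"
    using x by (intro nn_integral_noteq_infinite) measurable
  with AE_space show ?thesis
  proof eventually_elim
    fix \<omega> assume [measurable]: "\<omega> \<in> space M"
      and fin: "(\<integral>\<^sup>+s. f (Z x s \<omega>) * indicator {0..t} s \<partial>lborel) \<noteq> \<infinity>"
    have "(\<integral>\<^sup>+s. ennreal (norm (indicator {0..t} s *\<^sub>R V (Z x s \<omega>))) \<partial>lborel) =
        (\<integral>\<^sup>+s. f (Z x s \<omega>) * indicator {0..t} s \<partial>lborel)"
      by (intro nn_integral_cong) (auto simp: f_def indicator_def)
    then show "set_integrable lborel {0..t} (\<lambda>s. V (Z x s \<omega>))"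
      unfolding set_integrable_def using fin x
      by (intro integrableI_bounded) (auto simp: less_top)
  qed
qed

end

text \<open>Half of the growth rate \<beta> with the factor N^(1/\<eta>) removed. The 8 collects one
  2 from the doubled potential, one from \<open>khasminskii_bounded\<close> and one from \<alpha> =
  \<delta>/2, written as 2 * 2 / (\<delta>/2). The argument d/(2 \<mu> (1 - \<eta>)) is p expressed
  through \<eta>, and the absolute value makes the constant positive for every \<eta>.\<close>

definition growth_const :: "(real \<Rightarrow> real) \<Rightarrow> nat \<Rightarrow> real \<Rightarrow> real \<Rightarrow> real \<Rightarrow> real \<Rightarrow> real" where
  "growth_const \<Psi> d \<mu> c \<eta> R =
     (8 * heat_const \<Psi> d \<mu> c (2 / \<Psi> (1 / R\<^sup>2)) (real d / (2 * \<mu> * (1 - \<eta>))) * (\<bar>1 / \<eta>\<bar> + 1) / escape_prob)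
       powr (1 / \<eta>) / 2"

lemma growth_const_pos: "0 < growth_const \<Psi> d \<mu> c \<eta> R"
proof -
  have "0 < \<bar>1 / \<eta>\<bar> + 1" by (rule add_nonneg_pos) auto
  then have "0 < 8 * heat_const \<Psi> d \<mu> c (2 / \<Psi> (1 / R\<^sup>2)) (real d / (2 * \<mu> * (1 - \<eta>))) * (\<bar>1 / \<eta>\<bar> + 1) / escape_prob"
    by (intro divide_pos_pos mult_pos_pos heat_const_pos escape_prob) auto
  then show ?thesis
    unfolding growth_const_def half_gt_zero_iff powr_gt_zero by (rule less_imp_neq[THEN not_sym])
qed

text \<open>The logarithm of the ratio won by \<alpha> = \<delta>/2 over \<delta>, divided by 2 for
  the square root in Cauchy-Schwarz and by 2 again for t \<Psi>(r^(-2)) = 2.\<close>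

definition gap_const :: real where
  "gap_const = ln ((1 - escape_prob / 2) / (1 - escape_prob)) / 4"

lemma gap_const_pos: "0 < gap_const"
  using escape_prob by (simp add: gap_const_def)

section \<open>The semigroup identity at the maximum point\<close>

context subordinate_brownian
begin

text \<open>Before the exit time the path lies in \<open>D\<close>, where V^+ is at least its
  infimum. The survival event is then relaxed to the position at the single time t, which is all
  that \<open>prob_escape\<close> controls.\<close>

lemma feynman_kac_le:
  fixes V \<phi> :: "vec \<Rightarrow> real"
  assumes D: "D \<in> sets (Rd_borel d)" and xs: "xs \<in> D" and max: "\<And>x. x \<in> Rd d \<Longrightarrow> \<bar>\<phi> x\<bar> \<le> \<bar>\<phi> xs\<bar>"
    and t: "0 < t" and V: "V \<in> kato_space M d S B"
  shows "ennreal \<bar>feynman_kac M d S B D V t \<phi> xs\<bar> \<le> ennreal (\<bar>\<phi> xs\<bar> * exp (- t * (INF x\<in>D. pos_part V x))) *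
    (\<integral>\<^sup>+\<omega>. ennreal (exp (LINT s:{0..t}|lborel. neg_part V (Z xs s \<omega>))) * indicator D (Z xs t \<omega>) \<partial>M)"
proof -
  have x: "xs \<in> Rd d" using sets.sets_into_space[OF D] xs by (auto simp: space_Rd_borel)
  have [measurable]: "V \<in> borel_measurable (Rd_borel d)"
    using V by (simp add: kato_space_def cong: measurable_cong_sets[OF sets_Rd_lborel refl])
  have [measurable]: "neg_part V \<in> borel_measurable (Rd_borel d)"
    unfolding neg_part_def by measurable
  note D[measurable]
  define v where "v = (INF x\<in>D. pos_part V x)"
  let ?I = "\<lambda>\<omega>. LINT s:{0..t}|lborel. neg_part V (Z xs s \<omega>)"
  have v: "v \<le> pos_part V y" if "y \<in> D" for y
    unfolding v_def using that by (intro cINF_lower bdd_belowI[of _ 0]) (auto simp: pos_part_def)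
  define W where "W \<omega> = exp (- (LINT s:{0..t}|lborel. V (sbm d S B xs s \<omega>))) * \<phi> (sbm d S B xs t \<omega>) *
      indicator {\<omega>. exit_time D (\<lambda>s. sbm d S B xs s \<omega>) > ereal t} \<omega>" for \<omega>
  have "ennreal \<bar>feynman_kac M d S B D V t \<phi> xs\<bar> = ennreal (norm (\<integral>\<omega>. W \<omega> \<partial>completion M))"
    by (simp add: feynman_kac_def W_def)
  also have "\<dots> \<le> (\<integral>\<^sup>+\<omega>. ennreal (norm (W \<omega>)) \<partial>completion M)"
  \<comment> \<open>For a non-integrable \<open>W\<close> the Bochner integral is 0 and the bound is
    trivial.\<close>
  proof (cases "integrable (completion M) W")
    case True
    then show ?thesis by (rule integral_norm_bound_ennreal)
  qed (simp add: not_integrable_integral_eq)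
  \<comment> \<open>The nonnegative integral is unchanged by completion even for integrands
    measurable only after it, such as those involving the exit time.\<close>
  also have "\<dots> = (\<integral>\<^sup>+\<omega>. ennreal (norm (W \<omega>)) \<partial>M)" by (rule nn_integral_completion)
  also have "\<dots> \<le> (\<integral>\<^sup>+\<omega>. ennreal (\<bar>\<phi> xs\<bar> * exp (- t * v)) *
      (ennreal (exp (?I \<omega>)) * indicator D (Z xs t \<omega>)) \<partial>M)"
  proof (rule nn_integral_mono_AE)
    show "AE \<omega> in M. ennreal (norm (W \<omega>)) \<le> ennreal (\<bar>\<phi> xs\<bar> * exp (- t * v)) *
        (ennreal (exp (?I \<omega>)) * indicator D (Z xs t \<omega>))"
      using AE_space kato_path_integrable[OF V x less_imp_le[OF t]]
    proof eventually_elim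
      fix \<omega> assume \<omega>: "\<omega> \<in> space M" and int: "set_integrable lborel {0..t} (\<lambda>s. V (Z xs s \<omega>))"
      show "ennreal (norm (W \<omega>)) \<le> ennreal (\<bar>\<phi> xs\<bar> * exp (- t * v)) *
        (ennreal (exp (?I \<omega>)) * indicator D (Z xs t \<omega>))"
      proof (cases "exit_time D (\<lambda>s. sbm d S B xs s \<omega>) > ereal t")
        case False
        then show ?thesis by (simp add: W_def)
      next
        case True
        have inD: "Z xs s \<omega> \<in> D" if "0 < s" "s \<le> t" for s
        proof (rule ccontr)
          assume "Z xs s \<omega> \<notin> D"
          then have "exit_time D (\<lambda>s. sbm d S B xs s \<omega>) \<le> ereal s"
            unfolding exit_time_def using that sbm_eq[OF \<omega>, of s xs] by (intro Inf_lower) auto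
          also have "\<dots> \<le> ereal t" using that by simp
          finally show False using True by simp
        qed
        let ?V = "\<lambda>s. indicator {0..t} s * V (Z xs s \<omega>)"
        have intV: "integrable lborel ?V" using int by (simp add: set_integrable_def)
        have int_p: "integrable lborel (\<lambda>s. max (?V s) 0)" and int_n: "integrable lborel (\<lambda>s. max (- ?V s) 0)"
          using intV by (auto intro!: integrable_max)
        have "(LINT s:{0..t}|lborel. V (sbm d S B xs s \<omega>)) = (\<integral>s. ?V s \<partial>lborel)"
          unfolding set_lebesgue_integral_def
          by (intro Bochner_Integration.integral_cong refl) (auto simp: indicator_def sbm_eq[OF \<omega>])
        also have "\<dots> = (\<integral>s. max (?V s) 0 - max (- ?V s) 0 \<partial>lborel)"
          by (intro Bochner_Integration.integral_cong refl) (auto simp: max_def)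
        also have "\<dots> = (\<integral>s. max (?V s) 0 \<partial>lborel) - (\<integral>s. max (- ?V s) 0 \<partial>lborel)"
          using int_p int_n by (rule Bochner_Integration.integral_diff)
        also have "(\<integral>s. max (- ?V s) 0 \<partial>lborel) = (?I \<omega>)"
          unfolding set_lebesgue_integral_def
          by (intro Bochner_Integration.integral_cong refl) (auto simp: indicator_def neg_part_def)
        finally have split: "(LINT s:{0..t}|lborel. V (sbm d S B xs s \<omega>)) =
            (\<integral>s. max (?V s) 0 \<partial>lborel) - (?I \<omega>)" .
        have "t * v = (\<integral>s. indicator {0..t} s * v \<partial>lborel)"
          using t by simp
        also have "\<dots> \<le> (\<integral>s. max (?V s) 0 \<partial>lborel)"
        proof (rule integral_mono_AE[OF _ int_p])
          show "integrable lborel (\<lambda>s. indicator {0..t} s * v)" using t by simp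
          \<comment> \<open>The exit time concerns strictly positive times, so the path is
            controlled on (0, t]; the single time 0 is a null set.\<close>
          have "AE s in lborel. s \<noteq> (0::real)" by (rule AE_lborel_singleton)
          then show "AE s in lborel. indicator {0..t} s * v \<le> max (?V s) 0"
          proof eventually_elim
            fix s :: real assume "s \<noteq> 0"
            then show "indicator {0..t} s * v \<le> max (?V s) 0"
              using v[OF inD[of s]] by (auto simp: indicator_def pos_part_def)
          qed
        qed
        finally have "exp (- (LINT s:{0..t}|lborel. V (sbm d S B xs s \<omega>))) \<le>
            exp (- t * v + (?I \<omega>))"
          unfolding split by simp
        then have "exp (- (LINT s:{0..t}|lborel. V (sbm d S B xs s \<omega>))) * \<bar>\<phi> (sbm d S B xs t \<omega>)\<bar> \<le>
            exp (- t * v + (?I \<omega>)) * \<bar>\<phi> xs\<bar>"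
          using t by (intro mult_mono max) (auto simp: sbm_eq[OF \<omega>])
        then have "norm (W \<omega>) \<le> \<bar>\<phi> xs\<bar> * exp (- t * v) * exp (?I \<omega>)"
          using True unfolding exp_add by (simp add: W_def abs_mult mult_ac)
        then have "ennreal (norm (W \<omega>)) \<le> ennreal (\<bar>\<phi> xs\<bar> * exp (- t * v) * exp (?I \<omega>))"
          by (rule ennreal_leI)
        also have "\<dots> = ennreal (\<bar>\<phi> xs\<bar> * exp (- t * v)) * ennreal (exp (?I \<omega>))"
          by (rule ennreal_mult) auto
        finally show ?thesis using inD[of t] t by simp
      qed
    qed
  qed
  also have "\<dots> = ennreal (\<bar>\<phi> xs\<bar> * exp (- t * v)) *
    (\<integral>\<^sup>+\<omega>. ennreal (exp (?I \<omega>)) * indicator D (Z xs t \<omega>) \<partial>M)"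
    unfolding set_lebesgue_integral_def using x by (intro nn_integral_cmult) measurable
  finally show ?thesis unfolding v_def .
qed

text \<open>Stated for a strict upper bound N of the norm: then N, the kernel constant K and the
  rate \<beta> are positive even if V^- vanishes.\<close>

lemma eigenvalue_estimate:
  fixes V \<phi> :: "vec \<Rightarrow> real"
  assumes D: "openin (Rd_top d) D" "Rd_bounded d D" "Rd_convex d D"
    and \<mu>: "0 < \<mu>" and c: "0 < c" and scal: "lower_scaling \<Psi> \<mu> c" and nz: "0 < u0" "\<Psi> u0 \<noteq> 0"
    and V: "V \<in> kato_space M d S B"
    and p: "1 \<le> p" "real d / (2 * \<mu>) < p" and Lp: "neg_part V \<in> Lp_space d p"
    and eig: "dirichlet_eigenfunction M d S B D V lam \<phi>"
    and xs: "xs \<in> D" and max: "\<And>x. x \<in> Rd d \<Longrightarrow> \<bar>\<phi> x\<bar> \<le> \<bar>\<phi> xs\<bar>"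
    and N: "Lp_norm d p (neg_part V) < N"
  defines "\<eta> \<equiv> 1 - real d / (2 * \<mu> * p)" and "r \<equiv> boundary_dist d D xs"
  shows "gap_const * \<Psi> (1 / r\<^sup>2) \<le>
    growth_const \<Psi> d \<mu> c \<eta> (inradius d D) * N powr (1 / \<eta>) - (INF x\<in>D. pos_part V x) + lam"
proof -
  have D_meas[measurable]: "D \<in> sets (Rd_borel d)" by (rule openin_Rd_measurable[OF D(1)])
  have x: "xs \<in> Rd d" using openin_subset[OF D(1)] xs by (auto simp: topspace_Rd_top)
  have V_meas[measurable]: "V \<in> borel_measurable (Rd_borel d)"
    using V by (simp add: kato_space_def cong: measurable_cong_sets[OF sets_Rd_lborel refl])
  have nV_meas[measurable]: "neg_part V \<in> borel_measurable (Rd_borel d)"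
    unfolding neg_part_def by measurable
  have pos: "0 < \<Psi> u" if "0 < u" for u using \<Psi>_pos[OF nz that] .
  define R where "R = inradius d D"
  have r: "0 < r" "r \<le> R"
    unfolding r_def R_def
    using boundary_dist_pos[OF D(1,2) dim_pos xs] boundary_dist_le_inradius[OF D(1,2) dim_pos xs] by auto
  \<comment> \<open>\<open>T\<close> is \<open>t\<close> with the inradius in place of r. It
    dominates t, and the kernel constant taken at \<open>T\<close> depends on the domain through the
    inradius alone.\<close>
  define t T where "t = 2 / \<Psi> (1 / r\<^sup>2)" and "T = 2 / \<Psi> (1 / R\<^sup>2)"
  have \<Psi>r: "0 < \<Psi> (1 / r\<^sup>2)" "0 < \<Psi> (1 / R\<^sup>2)" using r by (auto intro!: pos)
  have t: "0 < t" "t * \<Psi> (1 / r\<^sup>2) = 2" using \<Psi>r by (auto simp: t_def)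
  have tT: "t \<le> T"
  proof -
    have "\<Psi> (1 / R\<^sup>2) \<le> \<Psi> (1 / r\<^sup>2)"
      using r by (intro \<Psi>_mono) (auto intro!: divide_left_mono power_mono)
    then show ?thesis using \<Psi>r unfolding t_def T_def by (intro divide_left_mono) auto
  qed
  have d0: "0 < real d" using dim_pos by simp
  have \<eta>: "0 < \<eta>" "\<eta> < 1"
    using p \<mu> d0 by (auto simp: \<eta>_def field_simps)
  have p_eq: "p = real d / (2 * \<mu> * (1 - \<eta>))" using p \<mu> d0 by (simp add: \<eta>_def)
  have N0: "0 < N" using N unfolding Lp_norm_def by (smt (verit) powr_ge_zero)
  define C1 where "C1 = heat_const \<Psi> d \<mu> c T p"
  have C1: "0 < C1" unfolding C1_def by (rule heat_const_pos)
  \<comment> \<open>Doubled, because Cauchy-Schwarz will require the exponential moment of twice the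
    path integral.\<close>
  define f where "f y = 2 * neg_part V y" for y
  have f_meas[measurable]: "f \<in> borel_measurable (Rd_borel d)" unfolding f_def by measurable
  have f_nn: "0 \<le> f y" for y by (simp add: f_def neg_part_def)
  have norm: "(\<integral>\<^sup>+y. ennreal (f y powr p) \<partial>Rd_lborel d) \<le> ennreal ((2 * N) powr p)"
  proof -
    define Q where "Q = (\<integral>y. \<bar>neg_part V y\<bar> powr p \<partial>Rd_lborel d)"
    have int: "integrable (Rd_lborel d) (\<lambda>y. \<bar>neg_part V y\<bar> powr p)" using Lp by (simp add: Lp_space_def)
    have Q0: "0 \<le> Q" unfolding Q_def by (intro integral_nonneg_AE) auto
    have "Q = (Q powr (1 / p)) powr p" using p Q0 by (simp add: powr_powr)
    also have "\<dots> \<le> N powr p"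
      using N p by (intro powr_mono2) (auto simp: Lp_norm_def Q_def)
    finally have Q: "Q \<le> N powr p" .
    have "(\<integral>\<^sup>+y. ennreal (f y powr p) \<partial>Rd_lborel d) = (\<integral>\<^sup>+y. ennreal (2 powr p * \<bar>neg_part V y\<bar> powr p) \<partial>Rd_lborel d)"
      by (intro nn_integral_cong) (simp add: f_def powr_mult neg_part_def)
    also have "\<dots> = ennreal (2 powr p * Q)"
      unfolding Q_def using int by (subst nn_integral_eq_integral) auto
    also have "\<dots> \<le> ennreal ((2 * N) powr p)"
      using Q N0 by (intro ennreal_leI) (simp add: powr_mult)
    finally show ?thesis .
  qed
  define K where "K = C1 * (2 * N)"
  have K: "0 < K" using C1 N0 by (simp add: K_def)
  have kernel: "P s (\<lambda>y. ennreal (f y)) y \<le> ennreal (K * s powr (\<eta> - 1))" if "0 < s" "s \<le> t" "y \<in> Rd d" for s y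
    unfolding K_def C1_def
    using that tT N0
    by (intro kernel_bound[OF scal \<mu> c pos _ _ p(1) _ _ f_meas f_nn norm]) (auto simp: \<eta>_def)
  define \<delta> where "\<delta> = escape_prob"
  have \<delta>: "0 < \<delta>" "\<delta> < 1" unfolding \<delta>_def by (rule escape_prob)+
  \<comment> \<open>The rate at which the smallness condition of \<open>khasminskii\<close> with
    \<alpha> = \<delta>/2 becomes an equality.\<close>
  define \<beta> where "\<beta> = (2 * K * (1 / \<eta> + 1) / (\<delta> / 2)) powr (1 / \<eta>)"
  have base: "0 < 2 * K * (1 / \<eta> + 1) / (\<delta> / 2)"
    using K \<eta> \<delta> by (intro divide_pos_pos mult_pos_pos add_pos_pos) auto
  have \<beta>: "0 < \<beta>" unfolding \<beta>_def powr_gt_zero using base by (rule less_imp_neq[THEN not_sym])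
  have small: "2 * K * (1 / \<eta> + 1) * \<beta> powr (- \<eta>) \<le> \<delta> / 2"
  proof -
    have b: "\<beta> powr (- \<eta>) = 1 / (2 * K * (1 / \<eta> + 1) / (\<delta> / 2))"
    proof -
      have "1 / \<eta> * - \<eta> = -1" using \<eta> by simp
      then show ?thesis unfolding \<beta>_def powr_powr by (simp only: powr_neg_one[OF base])
    qed
    have cancel: "z * (1 / (z / w)) = w" if "0 < z" "0 < w" for z w :: real using that by simp
    have "2 * K * (1 / \<eta> + 1) * \<beta> powr (- \<eta>) = \<delta> / 2"
      unfolding b using K \<eta> \<delta> by (intro cancel mult_pos_pos add_pos_pos) auto
    then show ?thesis by simp
  qed
  have \<beta>_eq: "\<beta> / 2 = growth_const \<Psi> d \<mu> c \<eta> R * N powr (1 / \<eta>)"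
  proof -
    have e: "2 * K * (1 / \<eta> + 1) / (\<delta> / 2) = (8 * C1 * (\<bar>1 / \<eta>\<bar> + 1) / \<delta>) * N"
      using \<eta> by (simp add: K_def)
    have "\<beta> = (8 * C1 * (\<bar>1 / \<eta>\<bar> + 1) / \<delta>) powr (1 / \<eta>) * N powr (1 / \<eta>)"
      unfolding \<beta>_def e by (rule powr_mult)
    then show ?thesis by (simp add: growth_const_def C1_def T_def \<delta>_def flip: p_eq)
  qed
  define I where "I \<omega> = (LINT s:{0..t}|lborel. neg_part V (Z xs s \<omega>))" for \<omega>
  let ?D = "\<lambda>\<omega>. indicator D (Z xs t \<omega>) :: ennreal"
  have I_meas[measurable]: "I \<in> borel_measurable M"
    unfolding I_def set_lebesgue_integral_def using x by measurable
  define E where "E = exp (\<beta> * t) / (1 - \<delta> / 2)"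
  have E: "0 < E" using \<delta> by (simp add: E_def)
  have exp_moment: "(\<integral>\<^sup>+\<omega>. ennreal (exp (2 * I \<omega>)) \<partial>M) \<le> ennreal E"
  proof -
    have "(\<integral>\<^sup>+\<omega>. ennreal (exp (LINT s:{0..t}|lborel. f (Z xs s \<omega>))) \<partial>M) \<le> ennreal E"
      unfolding E_def
    proof (rule khasminskii[OF t(1) \<eta>(1) less_imp_le[OF \<eta>(2)] \<beta> _ less_imp_le[OF K] f_meas f_nn kernel small x])
      show "AE \<omega> in M. set_integrable lborel {0..t} (\<lambda>s. f (Z xs s \<omega>))"
        using kato_path_integrable[OF V x less_imp_le[OF t(1)]]
      proof eventually_elim
        fix \<omega> assume "set_integrable lborel {0..t} (\<lambda>s. V (Z xs s \<omega>))"
        then have "integrable lborel (\<lambda>s. 2 * max (- (indicator {0..t} s * V (Z xs s \<omega>))) 0)"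
          by (auto simp: set_integrable_def intro!: integrable_max)
        moreover have "(\<lambda>s. 2 * max (- (indicator {0..t} s * V (Z xs s \<omega>))) 0) =
            (\<lambda>s. indicator {0..t} s *\<^sub>R f (Z xs s \<omega>))"
          by (auto simp: f_def neg_part_def indicator_def)
        ultimately show "set_integrable lborel {0..t} (\<lambda>s. f (Z xs s \<omega>))"
          unfolding set_integrable_def by simp
      qed
    qed (use \<delta> in auto)
    then show ?thesis by (simp add: I_def f_def)
  qed
  have stay: "(\<integral>\<^sup>+\<omega>. ?D \<omega> \<partial>M) \<le> ennreal (1 - \<delta>)"
  proof -
    obtain y where y: "y \<in> Rd d" "y \<notin> D" "(\<Sum>i<d. (y i - xs i)\<^sup>2) \<le> 2 * r\<^sup>2"
      unfolding r_def using near_boundary_point[OF D(1,2) dim_pos xs] by blast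
    have [measurable]: "xs \<in> space (Rd_borel d)" using x by (simp add: space_Rd_borel)
    have "(\<integral>\<^sup>+\<omega>. ?D \<omega> \<partial>M) = emeasure M {\<omega> \<in> space M. Z xs t \<omega> \<in> D}"
      by (rule nn_integral_indicator_comp[OF _ D_meas]) measurable
    also have "\<dots> \<le> ennreal (1 - \<delta>)"
      using prob_escape[OF less_imp_le[OF t(1)] r(1) t(2) D_meas D(3) y(1,2) x y(3)]
      by (simp add: emeasure_eq_measure \<delta>_def escape_prob_def ennreal_leI)
    finally show ?thesis .
  qed
  \<comment> \<open>If the maximum were 0, the function would vanish identically, against its being
    a non-zero solution. This permits the division by its value at \<open>xs\<close>.\<close>
  have \<phi>_pos: "0 < \<bar>\<phi> xs\<bar>"
  proof (rule ccontr)
    assume "\<not> 0 < \<bar>\<phi> xs\<bar>"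
    then have "\<phi> y = 0" if "y \<in> Rd d" for y using max[OF that] by simp
    then have "AE y in completion (Rd_lborel d). \<phi> y = 0"
      using sets_eq_imp_space_eq[OF sets_Rd_lborel[of d]] by (intro AE_I2) (simp add: space_Rd_borel)
    then show False using eig by (simp add: dirichlet_eigenfunction_def)
  qed
  define v where "v = (INF x\<in>D. pos_part V x)"
  \<comment> \<open>Cauchy-Schwarz as a weighted arithmetic-geometric inequality. This weight
    minimises \<kappa> E / 2 + (1 - \<delta>) / (2 \<kappa>) and returns the square root of E (1 -
    \<delta>).\<close>
  define \<kappa> where "\<kappa> = sqrt ((1 - \<delta>) / E)"
  have \<kappa>: "0 < \<kappa>" using \<delta> E by (simp add: \<kappa>_def)
  have "(\<integral>\<^sup>+\<omega>. ennreal (exp (I \<omega>)) * ?D \<omega> \<partial>M) \<le>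
      (\<integral>\<^sup>+\<omega>. ennreal (\<kappa> / 2) * ennreal (exp (2 * I \<omega>)) + ennreal (1 / (2 * \<kappa>)) * ?D \<omega> \<partial>M)"
  proof (rule nn_integral_mono)
    fix \<omega>
    have "0 \<le> (\<kappa> * exp (I \<omega>) - 1)\<^sup>2 / (2 * \<kappa>)" using \<kappa> by simp
    also have "\<dots> = \<kappa> / 2 * exp (2 * I \<omega>) + 1 / (2 * \<kappa>) - exp (I \<omega>)"
      unfolding exp_double using \<kappa> by (simp add: power2_eq_square field_simps)
    finally have "ennreal (exp (I \<omega>)) \<le> ennreal (\<kappa> / 2 * exp (2 * I \<omega>) + 1 / (2 * \<kappa>))"
      by (intro ennreal_leI) simp
    also have "\<dots> = ennreal (\<kappa> / 2) * ennreal (exp (2 * I \<omega>)) + ennreal (1 / (2 * \<kappa>))"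
      using \<kappa> by (simp only: ennreal_plus ennreal_mult exp_ge_zero mult_nonneg_nonneg divide_nonneg_nonneg
          less_imp_le zero_le_one zero_le_numeral)
    finally show "ennreal (exp (I \<omega>)) * ?D \<omega> \<le>
        ennreal (\<kappa> / 2) * ennreal (exp (2 * I \<omega>)) + ennreal (1 / (2 * \<kappa>)) * ?D \<omega>"
      by (auto simp: indicator_def)
  qed
  also have "\<dots> = ennreal (\<kappa> / 2) * (\<integral>\<^sup>+\<omega>. ennreal (exp (2 * I \<omega>)) \<partial>M) +
      ennreal (1 / (2 * \<kappa>)) * (\<integral>\<^sup>+\<omega>. ?D \<omega> \<partial>M)"
    using path_measurable[of "indicator D :: vec \<Rightarrow> real" xs "\<lambda>_. t" M "\<lambda>\<omega>. \<omega>"] x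
    by (subst nn_integral_add) (auto intro!: nn_integral_cmult arg_cong2[where f = "(+)"])
  also have "\<dots> \<le> ennreal (\<kappa> / 2) * ennreal E + ennreal (1 / (2 * \<kappa>)) * ennreal (1 - \<delta>)"
    by (intro add_mono mult_left_mono exp_moment stay) auto
  also have "\<dots> = ennreal (\<kappa> / 2 * E + 1 / (2 * \<kappa>) * (1 - \<delta>))"
  proof -
    have nn: "0 \<le> \<kappa> / 2" "0 \<le> 1 / (2 * \<kappa>)" "0 \<le> E" "0 \<le> 1 - \<delta>" using \<kappa> E \<delta> by auto
    show ?thesis by (simp only: ennreal_mult[symmetric] ennreal_plus[symmetric] nn mult_nonneg_nonneg)
  qed
  also have "\<kappa> / 2 * E + 1 / (2 * \<kappa>) * (1 - \<delta>) = sqrt (E * (1 - \<delta>))"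
  proof -
    have "\<kappa> * \<kappa> = (1 - \<delta>) / E" using \<delta> E by (simp add: \<kappa>_def)
    then have "1 - \<delta> = \<kappa> * \<kappa> * E" using E by simp
    moreover from this have "sqrt (E * (1 - \<delta>)) = \<kappa> * E"
      using \<kappa> E by (intro real_sqrt_unique) (auto simp: power2_eq_square)
    ultimately show ?thesis using \<kappa> by simp
  qed
  finally have FK: "(\<integral>\<^sup>+\<omega>. ennreal (exp (I \<omega>)) * ?D \<omega> \<partial>M) \<le> ennreal (sqrt (E * (1 - \<delta>)))" .
  have "ennreal \<bar>exp (- lam * t) * \<phi> xs\<bar> = ennreal \<bar>feynman_kac M d S B D V t \<phi> xs\<bar>"
    using eig t(1) xs by (simp add: dirichlet_eigenfunction_def)
  also have "\<dots> \<le> ennreal (\<bar>\<phi> xs\<bar> * exp (- t * v)) *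
      (\<integral>\<^sup>+\<omega>. ennreal (exp (I \<omega>)) * ?D \<omega> \<partial>M)"
    unfolding v_def I_def by (rule feynman_kac_le[where \<phi> = \<phi>, OF D_meas xs max t(1) V])
  also have "\<dots> \<le> ennreal (\<bar>\<phi> xs\<bar> * exp (- t * v)) * ennreal (sqrt (E * (1 - \<delta>)))"
    by (rule mult_left_mono[OF FK]) simp
  also have "\<dots> = ennreal (\<bar>\<phi> xs\<bar> * exp (- t * v) * sqrt (E * (1 - \<delta>)))"
    using E \<delta> by (intro ennreal_mult[symmetric]) auto
  finally have "\<bar>exp (- lam * t) * \<phi> xs\<bar> \<le> \<bar>\<phi> xs\<bar> * exp (- t * v) * sqrt (E * (1 - \<delta>))"
    using E \<delta> by (subst (asm) ennreal_le_iff) auto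
  then have "\<bar>\<phi> xs\<bar> * exp (- lam * t) \<le> \<bar>\<phi> xs\<bar> * (exp (- t * v) * sqrt (E * (1 - \<delta>)))"
    by (simp add: abs_mult mult_ac)
  then have "exp (- lam * t) \<le> exp (- t * v) * sqrt (E * (1 - \<delta>))"
    using \<phi>_pos by (rule mult_left_le_imp_le)
  \<comment> \<open>After taking logarithms everything is linear in t; the only term without t is
    the gap 2 \<open>gap_const\<close>, and 2 / t = \<Psi>(r^(-2)) converts it into the right-hand
    side of the theorem.\<close>
  then have "ln (exp (- lam * t)) \<le> ln (exp (- t * v) * sqrt (E * (1 - \<delta>)))"
    using E \<delta> by (subst ln_le_cancel_iff) auto
  also have "\<dots> = - t * v + (\<beta> * t - ln (1 - \<delta> / 2) + ln (1 - \<delta>)) / 2"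
    using E \<delta> by (simp add: ln_mult ln_sqrt E_def ln_div)
  also have "\<dots> = - t * v + \<beta> * t / 2 - 2 * gap_const"
    using \<delta> by (simp add: gap_const_def ln_div flip: \<delta>_def) (simp add: field_simps)
  finally have "2 * gap_const \<le> t * (\<beta> / 2 - v + lam)" by (simp add: algebra_simps)
  then have "2 * gap_const / t \<le> \<beta> / 2 - v + lam" using t(1) by (simp add: divide_le_eq mult.commute)
  moreover have "2 * gap_const / t = gap_const * \<Psi> (1 / r\<^sup>2)" using \<Psi>r by (simp add: t_def)
  ultimately show ?thesis unfolding \<beta>_eq v_def R_def by simp
qed

end

text \<open>The strict bound N decreases to the norm along L + 1/(n+1). The passage to the limit
  uses continuity of the power 1/\<eta> > 0, which holds also at L = 0.\<close>

lemma eigenvalue_estimate_Lp: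
  fixes M :: "'w measure"
  assumes nz: "\<exists>u>0. \<Psi> u \<noteq> 0" and "1 \<le> d"
    and D: "openin (Rd_top d) D" "Rd_bounded d D" "Rd_convex d D"
    and \<mu>: "0 < \<mu>" and c: "0 < c" and scal: "lower_scaling \<Psi> \<mu> c" and "sbm_setup M d \<Psi> S B"
    and V: "V \<in> kato_space M d S B"
    and p: "1 \<le> p" "real d / (2 * \<mu>) < p" and Lp: "neg_part V \<in> Lp_space d p"
    and eig: "dirichlet_eigenfunction M d S B D V lam \<phi>"
    and xs: "xs \<in> D" and max: "\<forall>x\<in>Rd d. \<bar>\<phi> x\<bar> \<le> \<bar>\<phi> xs\<bar>"
    and r_eq: "r = boundary_dist d D xs" and \<eta>_eq: "\<eta> = 1 - real d / (2 * \<mu> * p)"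
  shows "gap_const * \<Psi> (r powr (- 2)) \<le> growth_const \<Psi> d \<mu> c \<eta> (inradius d D) *
      Lp_norm d p (neg_part V) powr (1 / \<eta>) - (INF x\<in>D. pos_part V x) + lam"
proof -
  interpret subordinate_brownian M d \<Psi> S B using assms by unfold_locales auto
  obtain u0 where u0: "0 < u0" "\<Psi> u0 \<noteq> 0" using nz by auto
  have r: "0 < r" unfolding r_eq by (rule boundary_dist_pos[OF D(1,2) dim_pos xs])
  then have r2: "r powr (- 2) = 1 / r\<^sup>2" by (simp add: powr_minus_divide)
  define L where "L = Lp_norm d p (neg_part V)"
  have "real d / (2 * \<mu> * p) < 1" using p \<mu> by (simp add: field_simps)
  then have \<eta>: "0 < \<eta>" by (simp add: \<eta>_eq)
  have L: "0 \<le> L" by (simp add: L_def Lp_norm_def)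
  let ?b = "\<lambda>N. growth_const \<Psi> d \<mu> c \<eta> (inradius d D) * N powr (1 / \<eta>) - (INF x\<in>D. pos_part V x) + lam"
  have bound: "gap_const * \<Psi> (r powr (- 2)) \<le> ?b (L + inverse (real (Suc n)))" for n
    unfolding r2 unfolding r_eq \<eta>_eq L_def
    by (rule eigenvalue_estimate[OF D \<mu> c scal u0 V p Lp eig xs]) (use max in auto)
  have "(\<lambda>n. ?b (L + inverse (real (Suc n)))) \<longlonglongrightarrow> ?b (L + 0)"
    using \<eta> L by (intro tendsto_intros LIMSEQ_inverse_real_of_nat) auto
  from LIMSEQ_le_const[OF this] bound show ?thesis by (auto simp: L_def)
qed

theorem theorem3p1:
  shows "\<exists>\<Theta>2 :: real \<Rightarrow> real. (\<forall>\<eta>. \<Theta>2 \<eta> > 0) \<and>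
    (\<forall>\<Psi> :: real \<Rightarrow> real. bernstein0 \<Psi> \<and> (\<exists>u>0. \<Psi> u \<noteq> 0) \<longrightarrow>
      (\<exists>\<Theta>1 :: nat \<Rightarrow> real \<Rightarrow> real \<Rightarrow> real \<Rightarrow> real \<Rightarrow> real.
        (\<forall>d \<mu> c \<eta> R. \<Theta>1 d \<mu> c \<eta> R > 0) \<and>
        (\<forall>(d :: nat) (\<mu> :: real) (c :: real) (p :: real) (\<eta> :: real) (r :: real) (lam :: real)
            (D :: vec set) (V :: vec \<Rightarrow> real) (\<phi> :: vec \<Rightarrow> real) (xs :: vec)
            (M :: 'w measure) (S :: real \<Rightarrow> 'w \<Rightarrow> real) (B :: nat \<Rightarrow> real \<Rightarrow> 'w \<Rightarrow> real).
          d \<ge> 1 \<and>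
          openin (Rd_top d) D \<and> Rd_bounded d D \<and> Rd_convex d D \<and>
          \<mu> > 0 \<and> 0 < c \<and> c \<le> 1 \<and> lower_scaling \<Psi> \<mu> c \<and>
          sbm_setup M d \<Psi> S B \<and>
          V \<in> kato_space M d S B \<and> kato_potential M d S B V \<and>
          p \<ge> 1 \<and> p > real d / (2 * \<mu>) \<and> neg_part V \<in> Lp_space d p \<and>
          dirichlet_eigenfunction M d S B D V lam \<phi> \<and>
          xs \<in> D \<and> (\<forall>x\<in>Rd d. \<bar>\<phi> x\<bar> \<le> \<bar>\<phi> xs\<bar>) \<and>
          r = boundary_dist d D xs \<and>
          \<eta> = 1 - real d / (2 * \<mu> * p)
          \<longrightarrow>
          \<Theta>1 d \<mu> c \<eta> (inradius d D) * Lp_norm d p (neg_part V) powr (1 / \<eta>)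
            - (INF x\<in>D. pos_part V x) + lam
          \<ge> \<Theta>2 \<eta> * \<Psi> (r powr (- 2)))))"
  \<comment> \<open>\<Theta>2 is the constant function with value \<open>gap_const\<close>, fixed
    before \<Psi>; \<Theta>1 is \<open>growth_const\<close> for the given \<Psi>.\<close>
  by (rule exI[of _ "\<lambda>_. gap_const"], intro conjI allI impI gap_const_pos, elim conjE,
      rule_tac x = "growth_const \<Psi>" in exI, intro conjI allI impI growth_const_pos, elim conjE,
      rule eigenvalue_estimate_Lp; assumption)

end
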